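(* Let $(q_1,b_1,h_1)$ and $(q_2,b_2,h_2)$ be two potentials with $m$-functions $m_1,m_2$. For $b\in(0,\infty)$ consider the condition $$(\ast)_b\qquad b_1=b_2=b,\quad |h_1|+|h_2|<\infty,\quad q_1(x)=q_2(x)\ \text{ for (a.e.) } x\in(0,b).$$ If $(\ast)_b$ holds for some $b\in(0,\infty)$, then $$\lim_{\kappa\to\infty}e^{2b\kappa}\,|m_1(-\kappa^2)-m_2(-\kappa^2)|=4|h_1-h_2|.$$ Conversely, if for some $b\in(0,\infty)$ the limit $\lim_{\kappa\to\infty}e^{2b\kappa}|m_1(-\kappa^2)-m_2(-\kappa^2)|$ exists and lies in $(0,\infty)$, then $(\ast)_b$ holds (and hence the limit equals $4|h_1-h_2|$).
   Context: A potential is a triple $(q,b,h)$ with $0<b\le\infty$ and $q$ a real-valued measurable function on $(0,b)$. If $b<\infty$, assume $\int_0^b|q(x)|\,dx<\infty$ and $h\in\mathbb{R}\cup\{\infty\}$, specifying the boundary condition $u'(b)+hu(b)=0$ ($h=\infty$ means $u(b)=0$). If $b=\infty$, there is no $h$, and assume $\int_y^{y+1}|q(x)|\,dx<\infty$ for all $y\ge0$ and $\sup_{y>0}\int_y^{y+1}\max(-q(x),0)\,dx<\infty$ (so that $-\frac{d^2}{dx^2}+q$ is limit point at infinity). For $z\in\mathbb{C}\setminus[\beta,\infty)$ with $-\beta$ sufficiently large there is, up to a constant multiple, a unique nonzero solution $u(x,z)$ of $-u''+qu=zu$ on $(0,b)$ which satisfies the boundary condition at $b$ if $b<\infty$, or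 is $L^2$ at infinity if $b=\infty$. The $m$-function is $m(z)=u'(0,z)/u(0,z)$. Here $\kappa\to\infty$ through real values. *)

theory Defs
  imports "HOL-Analysis.Analysis"
begin

text \<open>A potential is given by \<open>q\<close>, \<open>b\<close>, \<open>h\<close> with \<open>b\<close> and \<open>h\<close> extended reals. There is no boundary
  condition at infinity: for \<open>b = \<infinity>\<close> the argument \<open>h\<close> is a dummy, which is unconstrained and is
  ignored by all definitions below. Values of \<open>q\<close> outside \<open>(0,b)\<close> are irrelevant. Measurability is
  in the sense of Lebesgue.\<close>

definition is_potential :: "(real \<Rightarrow> real) \<Rightarrow> ereal \<Rightarrow> ereal \<Rightarrow> bool" where
  "is_potential q b h \<longleftrightarrow>
     0 < b \<and>
     q \<in> borel_measurable (lebesgue_on {x. 0 < x \<and> ereal x < b}) \<and>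
     (b < \<infinity> \<longrightarrow> q absolutely_integrable_on {0<..<real_of_ereal b} \<and> h \<noteq> -\<infinity>) \<and>
     (b = \<infinity> \<longrightarrow>
        (\<forall>y\<ge>0. q absolutely_integrable_on {y..y + 1}) \<and>
        bdd_above ((\<lambda>y. integral {y..y + 1} (\<lambda>x. max (- q x) 0)) ` {0<..}))"

text \<open>\<open>u\<close> solves \<open>- u'' + q u = z u\<close> with derivative \<open>u'\<close>. As \<open>q\<close> is merely locally integrable, this
  is meant in the usual sense that \<open>u'\<close> is locally absolutely continuous and
  \<open>u'' = (q - z) u\<close> almost everywhere, that is, \<open>u'\<close> is an indefinite integral of \<open>(q - z) u\<close>. The
  finite endpoints are included, since such \<open>u\<close> and \<open>u'\<close> extend continuously to them; the
  derivative there is one-sided.\<close>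

definition solves_schroedinger ::
    "(real \<Rightarrow> real) \<Rightarrow> ereal \<Rightarrow> complex \<Rightarrow> (real \<Rightarrow> complex) \<Rightarrow> (real \<Rightarrow> complex) \<Rightarrow> bool" where
  "solves_schroedinger q b z u u' \<longleftrightarrow>
     (let I = {x. 0 \<le> x \<and> ereal x \<le> b} in
       (\<forall>x\<in>I. (u has_vector_derivative u' x) (at x within I)) \<and>
       (\<forall>x\<in>I. \<forall>y\<in>I. x \<le> y \<longrightarrow>
          ((\<lambda>t. (of_real (q t) - z) * u t) has_integral (u' y - u' x)) {x..y}))"

definition right_condition ::
    "ereal \<Rightarrow> ereal \<Rightarrow> (real \<Rightarrow> complex) \<Rightarrow> (real \<Rightarrow> complex) \<Rightarrow> bool" where
  "right_condition b h u u' \<longleftrightarrow>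
     (if b = \<infinity> then \<exists>R\<ge>0. (\<lambda>x. (cmod (u x))\<^sup>2) absolutely_integrable_on {R..}
      else if h = \<infinity> then u (real_of_ereal b) = 0
      else u' (real_of_ereal b) + of_real (real_of_ereal h) * u (real_of_ereal b) = 0)"

definition weyl_solution ::
    "(real \<Rightarrow> real) \<Rightarrow> ereal \<Rightarrow> ereal \<Rightarrow> complex \<Rightarrow> (real \<Rightarrow> complex) \<Rightarrow> (real \<Rightarrow> complex) \<Rightarrow> bool" where
  "weyl_solution q b h z u u' \<longleftrightarrow>
     solves_schroedinger q b z u u' \<and> right_condition b h u u' \<and>
     (\<exists>x\<ge>0. ereal x \<le> b \<and> u x \<noteq> 0)"

text \<open>The quotient does not depend on the choice of the solution when the latter is unique up to a
  constant multiple, which holds for \<open>z\<close> off a half-line \<open>[\<beta>, \<infinity>)\<close>. For other \<open>z\<close> the value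
  may be unspecified.\<close>

definition m_function :: "(real \<Rightarrow> real) \<Rightarrow> ereal \<Rightarrow> ereal \<Rightarrow> complex \<Rightarrow> complex" where
  "m_function q b h z = (THE m. \<exists>u u'. weyl_solution q b h z u u' \<and> m = u' 0 / u 0)"

definition star_condition ::
    "real \<Rightarrow> (real \<Rightarrow> real) \<Rightarrow> ereal \<Rightarrow> ereal \<Rightarrow> (real \<Rightarrow> real) \<Rightarrow> ereal \<Rightarrow> ereal \<Rightarrow> bool" where
  "star_condition b q1 b1 h1 q2 b2 h2 \<longleftrightarrow>
     b1 = ereal b \<and> b2 = ereal b \<and> \<bar>h1\<bar> + \<bar>h2\<bar> < \<infinity> \<and>
     (AE x in lebesgue. x \<in> {0<..<b} \<longrightarrow> q1 x = q2 x)"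

end

theory Submission
  imports Defs "HOL-Complex_Analysis.Complex_Analysis" "HOL-Real_Asymp.Real_Asymp"
begin

text \<open>Let \<open>u\<^sub>j\<close> be the Weyl solutions at \<open>z = - \<kappa>\<^sup>2\<close>, normalised by \<open>u\<^sub>j(0) = 1\<close>. If \<open>q\<^sub>1 = q\<^sub>2\<close> on
  \<open>(0,a)\<close>, constancy of the Wronskian expresses \<open>m\<^sub>2 - m\<^sub>1\<close> by the values of \<open>u\<^sub>j\<close> and \<open>u\<^sub>j'\<close> at
  \<open>a\<close>, and \<open>exp (\<kappa> a) u\<^sub>j(a)\<close> tends to \<open>1\<close> if \<open>a < b\<^sub>j\<close> and to \<open>2\<close> if \<open>a = b\<^sub>j\<close> and \<open>h\<^sub>j\<close> is
  finite, whereas \<open>u\<^sub>j(a) = 0\<close> and \<open>exp (\<kappa> a) u\<^sub>j'(a) \<sim> - 2 \<kappa>\<close> if \<open>h\<^sub>j = \<infinity>\<close>. Going through the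
  combinations with \<open>a = min b b\<^sub>1 b\<^sub>2\<close>, a limit in \<open>(0,\<infinity>)\<close> occurs only under the stated condition.

  That \<open>q\<^sub>1 = q\<^sub>2\<close> on \<open>(0,a)\<close> in the converse is the local Borg-Marchenko theorem, for which we
  follow Bennewitz: with the solutions \<open>\<theta>\<^sub>j\<close>, \<open>\<phi>\<^sub>j\<close> normalised at \<open>0\<close>, the function
  \<open>\<phi>\<^sub>1 \<theta>\<^sub>2 - \<phi>\<^sub>2 \<theta>\<^sub>1\<close> at a fixed \<open>x < a\<close> is entire of exponential type in \<open>\<kappa>\<close>, tends to \<open>0\<close> on the
  real axis and is bounded on the imaginary axis, so that it vanishes by the theorems of Phragmen-Lindeloef
  and Liouville. Hence \<open>\<theta>\<^sub>1 / \<phi>\<^sub>1 = \<theta>\<^sub>2 / \<phi>\<^sub>2\<close>, and differentiation gives \<open>\<phi>\<^sub>1\<^sup>2 = \<phi>\<^sub>2\<^sup>2\<close> and then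
  \<open>q\<^sub>1 = q\<^sub>2\<close>.\<close>

section \<open>Absolutely continuous functions\<close>

text \<open>Since \<open>q\<close> is only integrable, \<open>u''\<close> exists merely almost
  everywhere, so differential identities are phrased through indefinite integrals; the product rule
  for these carries Wronskians, integrating factors and monotonicity. On a half-line the positive
  part of \<open>q\<close> may be arbitrarily large, so for a Weyl solution only an upper bound of
  \<open>u' / u\<close> is at hand, and \<open>u(d)\<close> alone is no safe normalisation at a far
  point \<open>d\<close>. The quantity \<open>u(d) - u'(d) / \<kappa>\<close> is: it controls the
  size of the data, and it is the coefficient of the part that grows when the equation is read from
  \<open>d\<close> back to \<open>0\<close>. This reversed reading treats finite and infinite
  \<open>b\<close> alike and explains the factor 2: an interior point sees one exponential, while at
  a Robin end two of asymptotically equal amplitude add up. The 4 in the limit is a product of two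
  such factors. The delicate case of the converse is \<open>min b b1 b2 < b\<close>. There
  \<open>exp (2 b \<kappa>)\<close> magnifies the difference, so a limit 0 for the smaller weight
  excludes nothing; with equal boundary conditions at a common end, the m-functions have to coincide
  exactly for all large \<open>\<kappa>\<close>.\<close>

lemma le_zero_if_le_eps_mult:
  fixes x c :: real
  assumes "\<And>e. 0 < e \<Longrightarrow> x \<le> e * c"
  shows "x \<le> 0"
proof (rule ccontr)
  assume "\<not> x \<le> 0"
  define d where "d = \<bar>c\<bar> + 1"
  define e where "e = x / (2 * d)"
  have "0 < d" "c \<le> d" by (auto simp: d_def)
  then have e: "0 < e" and ex: "e * d = x / 2" using \<open>\<not> x \<le> 0\<close> by (auto simp: e_def)
  have "e * c \<le> e * d" using e \<open>c \<le> d\<close> by (intro mult_left_mono) auto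
  with assms[OF e] ex \<open>\<not> x \<le> 0\<close> show False by linarith
qed

text \<open>Substitute for the mean value theorem when derivatives exist only almost everywhere:
  splitting \<open>{l..r}\<close> into steps shorter than \<open>d\<close> and telescoping bounds
  the total increment by \<open>e * (V r - V l)\<close> for every \<open>e\<close>. In use,
  \<open>V\<close> is the integral of the norms of the derivatives.\<close>

lemma eq_if_small_increments:
  fixes F :: "real \<Rightarrow> 'a::real_normed_vector" and V :: "real \<Rightarrow> real"
  assumes "l \<le> r"
    and small: "\<And>e. 0 < e \<Longrightarrow> \<exists>d>0. \<forall>x y. l \<le> x \<longrightarrow> x \<le> y \<longrightarrow> y \<le> r \<longrightarrow> y - x < d \<longrightarrow>
                  norm (F y - F x) \<le> e * (V y - V x)"
  shows "F r = F l"
proof -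
  have bound: "norm (F r - F l) \<le> e * (V r - V l)" if "0 < e" for e
  proof -
    obtain d where d0: "0 < d \<and> (\<forall>x y. l \<le> x \<longrightarrow> x \<le> y \<longrightarrow> y \<le> r \<longrightarrow> y - x < d \<longrightarrow>
                  norm (F y - F x) \<le> e * (V y - V x))" using small[OF \<open>0 < e\<close>] by (rule exE)
    from d0 have d: "0 < d" by (rule conjunct1)
    from d0 have dd: "norm (F y - F x) \<le> e * (V y - V x)"
      if "l \<le> x" "x \<le> y" "y \<le> r" "y - x < d" for x y using that by simp
    obtain n where n: "(r - l) / d < real n" using reals_Archimedean2 by blast
    moreover have "0 \<le> (r - l) / d" by (rule divide_nonneg_pos) (use d \<open>l \<le> r\<close> in auto)
    ultimately have n0: "0 < n" by (cases n) auto
    have nd: "(r - l) / real n < d" using n n0 d by (simp add: pos_divide_less_eq mult.commute)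
    define p where "p i = l + real i * ((r - l) / real n)" for i
    have pn: "p n = r" and p0: "p 0 = l" using n0 by (auto simp: p_def)
    have step: "p (Suc i) - p i = (r - l) / real n" for i
      unfolding p_def of_nat_Suc distrib_right by simp
    have mono: "p i \<le> p j" if "i \<le> j" for i j
      unfolding p_def using that \<open>l \<le> r\<close> by (intro add_left_mono mult_right_mono) auto
    have "norm (F r - F l) = norm (\<Sum>i<n. F (p (Suc i)) - F (p i))"
      using sum_lessThan_telescope[of "\<lambda>i. F (p i)" n] by (simp add: pn p0)
    also have "\<dots> \<le> (\<Sum>i<n. norm (F (p (Suc i)) - F (p i)))" by (rule norm_sum)
    also have "\<dots> \<le> (\<Sum>i<n. e * (V (p (Suc i)) - V (p i)))"
    proof (rule sum_mono)
      fix i assume "i \<in> {..<n}"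
      then have "l \<le> p i" "p i \<le> p (Suc i)" "p (Suc i) \<le> r"
        using mono[of 0 i] mono[of "Suc i" n] mono[of i "Suc i"] by (auto simp: pn p0)
      moreover have "p (Suc i) - p i < d" unfolding step by (rule nd)
      ultimately show "norm (F (p (Suc i)) - F (p i)) \<le> e * (V (p (Suc i)) - V (p i))" by (rule dd)
    qed
    also have "\<dots> = e * (V r - V l)" using sum_lessThan_telescope[of "\<lambda>i. V (p i)" n]
      by (simp only: sum_distrib_left[symmetric] pn p0)
    finally show ?thesis .
  qed
  have "norm (F r - F l) \<le> 0" by (rule le_zero_if_le_eps_mult[OF bound])
  then show ?thesis by simp
qed

lemma absolutely_integrable_continuous_mult:
  fixes f g :: "real \<Rightarrow> 'a::{euclidean_space,real_normed_field}"
  assumes "continuous_on {l..r} f" "g absolutely_integrable_on {l..r}"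
  shows "(\<lambda>x. f x * g x) absolutely_integrable_on {l..r}"
proof (rule absolutely_integrable_bounded_measurable_product[where h = "(*)"])
  show "bilinear ((*) :: 'a \<Rightarrow> 'a \<Rightarrow> 'a)" by (rule bilinear_times)
  show "f \<in> borel_measurable (lebesgue_on {l..r})"
    using assms(1) by (intro continuous_imp_measurable_on_sets_lebesgue) auto
  show "bounded (f ` {l..r})"
    using assms(1) by (intro compact_imp_bounded compact_continuous_image) auto
qed (use assms in auto)

abbreviation l1_norm :: "(real \<Rightarrow> real) \<Rightarrow> real \<Rightarrow> real" where
  "l1_norm q T \<equiv> integral {0..T} (\<lambda>t. \<bar>q t\<bar>)"

section \<open>Indefinite integrals and their product rule\<close>

text \<open>An integral identity takes the place of a pointwise derivative, as \<open>g\<close>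
  matters only up to null sets. Absolute integrability is included so that \<open>g\<close> may be
  multiplied by continuous functions. For \<open>r < l\<close> the relation holds trivially, which
  permits statements about all real right ends.\<close>

definition ac_deriv :: "real \<Rightarrow> real \<Rightarrow> (real \<Rightarrow> 'a::euclidean_space) \<Rightarrow> (real \<Rightarrow> 'a) \<Rightarrow> bool" where
  "ac_deriv l r f g \<longleftrightarrow> g absolutely_integrable_on {l..r} \<and>
     (\<forall>x\<in>{l..r}. f x = f l + integral {l..x} g)"

lemma ac_deriv_eq: "ac_deriv l r f g \<Longrightarrow> l \<le> x \<Longrightarrow> x \<le> r \<Longrightarrow> f x = f l + integral {l..x} g"
  unfolding ac_deriv_def by (elim conjE) (erule bspec, simp only: atLeastAtMost_iff simp_thms)

lemma ac_deriv_abs_int: "ac_deriv l r f g \<Longrightarrow> l \<le> x \<Longrightarrow> y \<le> r \<Longrightarrow> g absolutely_integrable_on {x..y}"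
  unfolding ac_deriv_def by (rule absolutely_integrable_on_subinterval[where S = "{l..r}"]) auto

lemma ac_deriv_integrable: "ac_deriv l r f g \<Longrightarrow> l \<le> x \<Longrightarrow> y \<le> r \<Longrightarrow> g integrable_on {x..y}"
  by (rule set_lebesgue_integral_eq_integral(1)[OF ac_deriv_abs_int])

lemma ac_deriv_norm_integrable:
  "ac_deriv l r f g \<Longrightarrow> l \<le> x \<Longrightarrow> y \<le> r \<Longrightarrow> (\<lambda>t. norm (g t)) integrable_on {x..y}"
  using ac_deriv_abs_int[of l r f g x y] unfolding absolutely_integrable_on_def by blast

lemma integrable_has_integral_diff:
  fixes g :: "real \<Rightarrow> 'a::euclidean_space"
  assumes "g integrable_on {l..r}" "l \<le> x" "x \<le> y" "y \<le> r"
  shows "(g has_integral (integral {l..y} g - integral {l..x} g)) {x..y}"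
proof -
  have "g integrable_on {l..y}" "g integrable_on {x..y}"
    using assms by (auto intro: integrable_on_subinterval)
  moreover from this(1) have "integral {l..x} g + integral {x..y} g = integral {l..y} g"
    by (rule Henstock_Kurzweil_Integration.integral_combine[OF assms(2,3)])
  then have "integral {l..y} g - integral {l..x} g = integral {x..y} g"
    by (metis add_diff_cancel_left')
  ultimately show ?thesis by (simp add: integrable_integral)
qed

lemma ac_deriv_has_integral:
  assumes "ac_deriv l r f g" "l \<le> x" "x \<le> y" "y \<le> r"
  shows "(g has_integral (f y - f x)) {x..y}"
proof -
  have "f y = f l + integral {l..y} g" "f x = f l + integral {l..x} g"
    by (rule ac_deriv_eq[OF assms(1)]; use assms in linarith)+
  then show ?thesis
    using integrable_has_integral_diff[OF ac_deriv_integrable[OF assms(1) order_refl order_refl] assms(2-4)]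
    by simp
qed

lemmas ac_deriv_integral = integral_unique[OF ac_deriv_has_integral]

lemma ac_derivI:
  assumes "g absolutely_integrable_on {l..r}"
    and "\<And>x. l \<le> x \<Longrightarrow> x \<le> r \<Longrightarrow> (g has_integral (f x - f l)) {l..x}"
  shows "ac_deriv l r f g" unfolding ac_deriv_def
proof (intro conjI ballI assms(1))
  fix x assume "x \<in> {l..r}"
  then have "integral {l..x} g = f x - f l" by (intro integral_unique assms(2)) auto
  then show "f x = f l + integral {l..x} g" by simp
qed

lemma ac_deriv_subinterval:
  assumes "ac_deriv l r f g" "l \<le> x" "y \<le> r"
  shows "ac_deriv x y f g"
proof (rule ac_derivI)
  show "g absolutely_integrable_on {x..y}" by (rule ac_deriv_abs_int[OF assms])
  show "(g has_integral (f z - f x)) {x..z}" if "x \<le> z" "z \<le> y" for z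
    by (rule ac_deriv_has_integral[OF assms(1,2)]) (use that assms in auto)
qed

lemma ac_deriv_continuous:
  assumes "ac_deriv l r f g"
  shows "continuous_on {l..r} f"
proof -
  have "continuous_on {l..r} (\<lambda>x. f l + integral {l..x} g)"
    using ac_deriv_integrable[OF assms, of l r]
    by (intro continuous_intros indefinite_integral_continuous_1) auto
  then show ?thesis by (rule continuous_on_eq) (rule ac_deriv_eq[OF assms, symmetric]; simp)
qed

lemma ac_deriv_C1:
  fixes f :: "real \<Rightarrow> 'a::euclidean_space"
  assumes "\<And>x. x \<in> {l..r} \<Longrightarrow> (f has_vector_derivative g x) (at x within {l..r})"
    and "continuous_on {l..r} g"
  shows "ac_deriv l r f g"
proof (rule ac_derivI)
  show "g absolutely_integrable_on {l..r}"
    using assms(2) by (rule absolutely_integrable_continuous_real)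
  fix x assume "l \<le> x" "x \<le> r"
  then show "(g has_integral (f x - f l)) {l..x}" by (intro fundamental_theorem_of_calculus)
      (auto intro: has_vector_derivative_within_subset[OF assms(1)])
qed

lemma ac_deriv_vector_derivative:
  assumes "ac_deriv l r f g" "continuous_on {l..r} g" "x \<in> {l..r}"
  shows "(f has_vector_derivative g x) (at x within {l..r})"
proof -
  have "((\<lambda>y. f l + integral {l..y} g) has_vector_derivative (0 + g x)) (at x within {l..r})"
    using assms by (intro derivative_intros integral_has_vector_derivative)
  then have "((\<lambda>y. f l + integral {l..y} g) has_vector_derivative g x) (at x within {l..r})" by simp
  then show ?thesis
    by (rule has_vector_derivative_transform[OF assms(3), rotated]) (rule ac_deriv_eq[OF assms(1)]; simp)
qed

lemma ac_deriv_linear: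
  assumes "ac_deriv l r f g" "bounded_linear h"
  shows "ac_deriv l r (\<lambda>x. h (f x)) (\<lambda>x. h (g x))"
proof (rule ac_derivI)
  show "(\<lambda>x. h (g x)) absolutely_integrable_on {l..r}"
    using absolutely_integrable_linear[OF ac_deriv_abs_int[OF assms(1)] assms(2), of l r]
    by (simp add: o_def)
  fix x assume "l \<le> x" "x \<le> r"
  then show "((\<lambda>x. h (g x)) has_integral (h (f x) - h (f l))) {l..x}"
    using has_integral_linear[OF ac_deriv_has_integral[OF assms(1)] assms(2), of l x]
    by (simp add: o_def linear_diff[OF bounded_linear.linear[OF assms(2)]])
qed

lemma ac_deriv_const: "ac_deriv l r (\<lambda>x. c) (\<lambda>x. 0)" by (rule ac_derivI) auto

lemma ac_deriv_add:
  assumes "ac_deriv l r f f'" "ac_deriv l r g g'"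
  shows "ac_deriv l r (\<lambda>x. f x + g x) (\<lambda>x. f' x + g' x)"
proof (rule ac_derivI)
  show "(\<lambda>x. f' x + g' x) absolutely_integrable_on {l..r}"
    by (intro set_integral_add ac_deriv_abs_int[OF assms(1)] ac_deriv_abs_int[OF assms(2)]) auto
  fix x assume "l \<le> x" "x \<le> r"
  then show "((\<lambda>x. f' x + g' x) has_integral (f x + g x - (f l + g l))) {l..x}"
    using has_integral_add[OF ac_deriv_has_integral[OF assms(1), of l x] ac_deriv_has_integral[OF assms(2), of l x]]
    by (simp add: algebra_simps)
qed

lemma ac_deriv_minus:
  "ac_deriv l r f f' \<Longrightarrow> ac_deriv l r (\<lambda>x. - f x) (\<lambda>x. - f' x)"
  by (rule ac_deriv_linear[OF _ bounded_linear_minus[OF bounded_linear_ident]])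

lemma ac_deriv_diff:
  assumes "ac_deriv l r f f'" "ac_deriv l r g g'"
  shows "ac_deriv l r (\<lambda>x. f x - g x) (\<lambda>x. f' x - g' x)"
  using ac_deriv_add[OF assms(1) ac_deriv_minus[OF assms(2)]] by simp

lemma ac_deriv_cong:
  assumes "ac_deriv l r f g" "\<And>x. x \<in> {l..r} \<Longrightarrow> f x = f1 x" "\<And>x. x \<in> {l..r} \<Longrightarrow> g x = g1 x"
  shows "ac_deriv l r f1 g1"
proof (rule ac_derivI)
  show "g1 absolutely_integrable_on {l..r}" using ac_deriv_abs_int[OF assms(1), of l r] assms(3)
    by (auto intro: absolutely_integrable_spike[OF _ negligible_empty])
  fix x assume x: "l \<le> x" "x \<le> r"
  then have "(g has_integral (f1 x - f1 l)) {l..x}"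
    using ac_deriv_has_integral[OF assms(1), of l x] assms(2) by auto
  then show "(g1 has_integral (f1 x - f1 l)) {l..x}"
    by (rule has_integral_eq[rotated]) (use x assms(3) in auto)
qed

lemma ac_deriv_spike:
  assumes "ac_deriv l r f g" "negligible N" "\<And>x. x \<in> {l..r} - N \<Longrightarrow> g1 x = g x"
  shows "ac_deriv l r f g1"
proof (rule ac_derivI)
  show "g1 absolutely_integrable_on {l..r}" using ac_deriv_abs_int[OF assms(1), of l r] assms(2,3)
    by (auto intro: absolutely_integrable_spike)
  fix x assume x: "l \<le> x" "x \<le> r"
  then show "(g1 has_integral (f x - f l)) {l..x}"
    by (intro has_integral_spike[OF assms(2) _ ac_deriv_has_integral[OF assms(1)]])
       (use assms(3) x in auto)
qed

text \<open>The product minus the integral of the expected derivative is constant by small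
  increments: on a short \<open>{x..y}\<close> its increment is the integral of
  \<open>f' * (g y - g)\<close> plus \<open>(f x - f) * g'\<close>, and uniform continuity makes
  both differences smaller than \<open>e\<close>.\<close>

lemma ac_deriv_mult:
  fixes f g :: "real \<Rightarrow> 'a::{euclidean_space,real_normed_field}"
  assumes f: "ac_deriv l r f f'" and g: "ac_deriv l r g g'"
  shows "ac_deriv l r (\<lambda>x. f x * g x) (\<lambda>x. f' x * g x + f x * g' x)"
proof (rule ac_derivI)
  note fc = ac_deriv_continuous[OF f] and gc = ac_deriv_continuous[OF g]
  note fi = ac_deriv_abs_int[OF f, of l r, simplified] and gi = ac_deriv_abs_int[OF g, of l r, simplified]
  define h where "h x = f' x * g x + f x * g' x" for x
  show "(\<lambda>x. f' x * g x + f x * g' x) absolutely_integrable_on {l..r}"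
    using absolutely_integrable_continuous_mult[OF gc fi] absolutely_integrable_continuous_mult[OF fc gi]
    by (intro set_integral_add) (auto simp: mult.commute)
  then have hi: "h integrable_on {l..r}"
    unfolding h_def[abs_def] by (rule set_lebesgue_integral_eq_integral(1))
  fix z assume z: "l \<le> z" "z \<le> r"
  define n where "n t = norm (f' t) + norm (g' t)" for t
  have ni: "n integrable_on {l..r}" unfolding n_def[abs_def]
    by (intro integrable_add ac_deriv_norm_integrable[OF f] ac_deriv_norm_integrable[OF g]) auto
  define V where "V x = integral {l..x} n" for x
  have "f z * g z - integral {l..z} h = f l * g l - integral {l..l} h"
  proof (rule eq_if_small_increments[where V = V])
    fix e :: real assume e: "0 < e"
    have "uniformly_continuous_on {l..r} f" "uniformly_continuous_on {l..r} g"
      using fc gc by (auto intro: compact_uniformly_continuous)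
    then obtain d1 d2 where d: "0 < d1" "0 < d2"
      and d1: "\<And>x y. x \<in> {l..r} \<Longrightarrow> y \<in> {l..r} \<Longrightarrow> dist y x < d1 \<Longrightarrow> dist (f y) (f x) < e"
      and d2: "\<And>x y. x \<in> {l..r} \<Longrightarrow> y \<in> {l..r} \<Longrightarrow> dist y x < d2 \<Longrightarrow> dist (g y) (g x) < e"
      using e unfolding uniformly_continuous_on_def by metis
    show "\<exists>d>0. \<forall>x y. l \<le> x \<longrightarrow> x \<le> y \<longrightarrow> y \<le> z \<longrightarrow> y - x < d \<longrightarrow>
         norm (f y * g y - integral {l..y} h - (f x * g x - integral {l..x} h)) \<le> e * (V y - V x)"
    proof (intro exI[of _ "min d1 d2"] conjI allI impI)
      fix x y assume xy: "l \<le> x" "x \<le> y" "y \<le> z" "y - x < min d1 d2"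
      then have yr: "y \<le> r" using z by simp
      \<comment> \<open>This kernel comes from \<open>f y * g y - f x * g x = (f y - f x) * g y + f
        x * (g y - g x)\<close>, with each undifferentiated factor frozen at one endpoint.\<close>
      let ?k = "\<lambda>t. f' t * (g y - g t) + (f x - f t) * g' t"
      have "((\<lambda>t. f' t * g y + f x * g' t - h t) has_integral
          ((f y - f x) * g y + f x * (g y - g x) - (integral {l..y} h - integral {l..x} h))) {x..y}"
        by (intro has_integral_diff has_integral_add has_integral_mult_left has_integral_mult_right
             integrable_has_integral_diff[OF hi]
             ac_deriv_has_integral[OF f] ac_deriv_has_integral[OF g] xy yr)
      moreover have "(\<lambda>t. f' t * g y + f x * g' t - h t) = ?k"
        by (rule ext) (simp add: h_def ring_distribs mult.commute)
      moreover have "(f y - f x) * g y + f x * (g y - g x) - (integral {l..y} h - integral {l..x} h)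
         = f y * g y - integral {l..y} h - (f x * g x - integral {l..x} h)"
        by (simp add: algebra_simps)
      ultimately have k: "(?k has_integral
          (f y * g y - integral {l..y} h - (f x * g x - integral {l..x} h))) {x..y}" by simp
      have V: "(n has_integral (V y - V x)) {x..y}"
        unfolding V_def by (rule integrable_has_integral_diff[OF ni]) (use xy yr in auto)
      have "norm (integral {x..y} ?k) \<le> integral {x..y} (\<lambda>t. e * n t)"
      proof (rule integral_norm_bound_integral)
        show "?k integrable_on {x..y}" using k by blast
        show "(\<lambda>t. e * n t) integrable_on {x..y}" using has_integral_mult_right[OF V, of e] by blast
        fix t assume t: "t \<in> {x..y}"
        have "dist (g y) (g t) < e" "dist (f x) (f t) < e"
          using t xy yr by (auto intro!: d1 d2 simp: dist_real_def)
        then have "norm (f' t * (g y - g t)) \<le> norm (f' t) * e" "norm ((f x - f t) * g' t) \<le> e * norm (g' t)"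
          using e by (auto simp: norm_mult dist_norm intro!: mult_mono)
        then have "norm (f' t * (g y - g t)) + norm ((f x - f t) * g' t) \<le> e * n t"
          by (simp add: n_def distrib_left mult.commute)
        then show "norm (?k t) \<le> e * n t" by (rule norm_triangle_le)
      qed
      then show "norm (f y * g y - integral {l..y} h - (f x * g x - integral {l..x} h)) \<le> e * (V y - V x)"
        unfolding integral_unique[OF k] integral_unique[OF has_integral_mult_right[OF V]] .
    qed (use d in auto)
  qed (use z in auto)
  then have "f z * g z - f l * g l = integral {l..z} h" by (simp add: algebra_simps)
  moreover have "h integrable_on {l..z}" using hi z by (auto intro: integrable_on_subinterval)
  ultimately show "((\<lambda>x. f' x * g x + f x * g' x) has_integral (f z * g z - f l * g l)) {l..z}"
    unfolding h_def[abs_def, symmetric] by (simp add: integrable_integral)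
qed

lemma ac_deriv_mono:
  fixes f :: "real \<Rightarrow> real"
  assumes "ac_deriv l r f g" "\<And>x. l \<le> x \<Longrightarrow> x \<le> r \<Longrightarrow> 0 \<le> g x" "l \<le> x" "x \<le> y" "y \<le> r"
  shows "f x \<le> f y"
  using has_integral_nonneg[OF ac_deriv_has_integral[OF assms(1,3,4,5)]] assms by auto

lemma ac_deriv_zero_const:
  assumes "ac_deriv l r f (\<lambda>x. 0)" "l \<le> x" "x \<le> r"
  shows "f x = f l" using ac_deriv_integral[OF assms(1), of l x] assms by simp

text \<open>Integration by parts shows that \<open>g\<close> integrates to \<open>0\<close> against polynomials, hence against
  continuous functions, and bounded continuous functions converge a.e. to \<open>sgn g\<close> where \<open>g \<noteq> 0\<close>.\<close>

lemma ac_deriv_zero_AE: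
  fixes g :: "real \<Rightarrow> real"
  assumes "ac_deriv l r (\<lambda>x. c) g"
  shows "AE x in lebesgue. x \<in> {l..r} \<longrightarrow> g x = 0"
proof (cases "l \<le> r")
  case True
  note gi = ac_deriv_abs_int[OF assms, of l r, simplified]
  have cont0: "((\<lambda>t. h t * g t) has_integral 0) {l..r}" if hc: "continuous_on {l..r} h" for h
  proof -
    have hg: "(\<lambda>t. h t * g t) integrable_on {l..r}"
      by (rule set_lebesgue_integral_eq_integral(1)[OF absolutely_integrable_continuous_mult[OF hc gi]])
    have gn: "(\<lambda>t. \<bar>g t\<bar>) integrable_on {l..r}"
      using ac_deriv_norm_integrable[OF assms, of l r] by simp
    have "norm (integral {l..r} (\<lambda>t. h t * g t)) \<le> e * integral {l..r} (\<lambda>t. \<bar>g t\<bar>)" if e: "0 < e" for e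
    proof -
      obtain p where p: "real_polynomial_function p" and hp: "\<And>x. x \<in> {l..r} \<Longrightarrow> \<bar>h x - p x\<bar> < e"
        using Stone_Weierstrass_real_polynomial_function[OF compact_Icc hc e] by blast
      obtain p' where p': "real_polynomial_function p'" "\<And>x. (p has_real_derivative p' x) (at x)"
        using has_real_derivative_polynomial_function[OF p] by blast
      have "continuous_on {l..r} p'"
        using has_real_derivative_polynomial_function[OF p'(1)]
        by (meson DERIV_isCont continuous_at_imp_continuous_on)
      then have "ac_deriv l r p p'"
        by (rule ac_deriv_C1[rotated])
           (auto simp: has_real_derivative_iff_has_vector_derivative[symmetric] intro: DERIV_subset[OF p'(2)])
      \<comment> \<open>Subtracting the constant \<open>c\<close> makes the second factor
        identically 0, so the boundary terms and the term with \<open>p'\<close> vanish and the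
        integral of \<open>p * g\<close> is left.\<close>
      from ac_deriv_has_integral[OF ac_deriv_mult[OF this ac_deriv_diff[OF assms ac_deriv_const[of l r c]]]
          order_refl True order_refl]
      have "((\<lambda>t. p t * g t) has_integral 0) {l..r}" by simp
      from has_integral_diff[OF integrable_integral[OF hg] this]
      have k: "((\<lambda>t. (h t - p t) * g t) has_integral integral {l..r} (\<lambda>t. h t * g t)) {l..r}"
        by (simp add: left_diff_distrib)
      have "norm (integral {l..r} (\<lambda>t. (h t - p t) * g t)) \<le> integral {l..r} (\<lambda>t. e * \<bar>g t\<bar>)"
      proof (rule integral_norm_bound_integral)
        show "(\<lambda>t. (h t - p t) * g t) integrable_on {l..r}" using k by blast
        show "(\<lambda>t. e * \<bar>g t\<bar>) integrable_on {l..r}" by (rule integrable_on_mult_right[OF gn])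
        show "norm ((h t - p t) * g t) \<le> e * \<bar>g t\<bar>" if "t \<in> {l..r}" for t
          unfolding real_norm_def abs_mult by (rule mult_right_mono) (use hp[OF that] in auto)
      qed
      then show ?thesis unfolding integral_unique[OF k] by simp
    qed
    then have "norm (integral {l..r} (\<lambda>t. h t * g t)) \<le> 0" by (rule le_zero_if_le_eps_mult)
    then have "integral {l..r} (\<lambda>t. h t * g t) = 0" by simp
    then show ?thesis using integrable_integral[OF hg] by simp
  qed
  have "g \<in> borel_measurable (lebesgue_on {l..r})"
    using gi by (rule absolutely_integrable_imp_borel_measurable) auto
  then have "g measurable_on {l..r}" by (simp add: measurable_on_iff_borel_measurable)
  then obtain N G where N: "negligible N" and Gc: "\<And>n. continuous_on UNIV (G n)"
    and Gl: "\<And>x. x \<notin> N \<Longrightarrow> (\<lambda>n. G n x) \<longlonglongrightarrow> (if x \<in> {l..r} then g x else 0)"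
    unfolding measurable_on_def by blast
  define h where "h n x = max (-1) (min 1 (real n * G n x))" for n x
  have hc: "continuous_on {l..r} (h n)" for n
    unfolding h_def by (intro continuous_intros continuous_on_subset[OF Gc]) auto
  have lim: "(\<lambda>n. h n x * g x) \<longlonglongrightarrow> \<bar>g x\<bar>" if "x \<in> {l..r} - N" for x
  proof -
    have Gx: "(\<lambda>n. G n x) \<longlonglongrightarrow> g x" using Gl[of x] that by auto
    have "\<forall>\<^sub>F n in sequentially. h n x * g x = \<bar>g x\<bar>"
    proof (cases "g x" "0 :: real" rule: linorder_cases)
      case greater
      then have "filterlim (\<lambda>n. real n * G n x) at_top sequentially"
        using filterlim_at_top_mult_tendsto_pos[OF Gx greater filterlim_real_sequentially]
        by (simp add: mult.commute)
      then have "\<forall>\<^sub>F n in sequentially. 1 \<le> real n * G n x" by (auto simp: filterlim_at_top)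
      then show ?thesis by eventually_elim (use greater in \<open>auto simp: h_def\<close>)
    next
      case less
      then have "filterlim (\<lambda>n. real n * - G n x) at_top sequentially"
        using filterlim_at_top_mult_tendsto_pos[OF tendsto_minus[OF Gx] _ filterlim_real_sequentially]
        by (simp add: mult.commute)
      then have "\<forall>\<^sub>F n in sequentially. 1 \<le> real n * - G n x" unfolding filterlim_at_top by blast
      then show ?thesis by eventually_elim (use less in \<open>auto simp: h_def\<close>)
    qed auto
    then show ?thesis by (rule tendsto_eventually)
  qed
  have "((\<lambda>x. \<bar>g x\<bar>) has_integral 0) {l..r}"
  proof -
    have "(\<lambda>n. 0) \<longlonglongrightarrow> integral {l..r} (\<lambda>x. if x \<in> N then 0 else \<bar>g x\<bar>)"
    proof (rule dominated_convergence(2)[where f = "\<lambda>n x. if x \<in> N then 0 else h n x * g x" and h = "\<lambda>x. \<bar>g x\<bar>",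
          THEN Lim_transform_eventually])
      have I: "((\<lambda>x. if x \<in> N then 0 else h n x * g x) has_integral 0) {l..r}" for n
        by (rule has_integral_spike[OF N _ cont0[OF hc]]) auto
      then show "(\<lambda>x. if x \<in> N then 0 else h n x * g x) integrable_on {l..r}" for n by blast
      show "(\<lambda>x. \<bar>g x\<bar>) integrable_on {l..r}" using ac_deriv_norm_integrable[OF assms, of l r] by simp
      show "norm (if x \<in> N then 0 else h n x * g x) \<le> \<bar>g x\<bar>" for n x
        by (auto simp: h_def abs_mult intro!: mult_left_le_one_le)
      show "(\<lambda>n. if x \<in> N then 0 else h n x * g x) \<longlonglongrightarrow> (if x \<in> N then 0 else \<bar>g x\<bar>)" if "x \<in> {l..r}" for x
        using lim[of x] that by auto
      show "\<forall>\<^sub>F n in sequentially. integral {l..r} (\<lambda>x. if x \<in> N then 0 else h n x * g x) = 0"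
        using I by (auto simp: integral_unique)
    qed
    then have "integral {l..r} (\<lambda>x. if x \<in> N then 0 else \<bar>g x\<bar>) = 0" by (simp add: LIMSEQ_const_iff)
    moreover have "integral {l..r} (\<lambda>x. if x \<in> N then 0 else \<bar>g x\<bar>) = integral {l..r} (\<lambda>x. \<bar>g x\<bar>)"
      by (rule integral_spike[OF N]) auto
    ultimately show ?thesis
      using ac_deriv_norm_integrable[OF assms, of l r] by (simp add: has_integral_integrable_integral)
  qed
  moreover have ni: "(\<lambda>x. \<bar>g x\<bar>) absolutely_integrable_on {l..r}"
    using absolutely_integrable_norm[OF gi] by (simp add: o_def)
  ultimately have "(LINT x:{l..r}|lebesgue. \<bar>g x\<bar>) = 0"
    by (simp add: set_lebesgue_integral_eq_integral(2) integral_unique)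
  then have "AE x in lebesgue. indicator {l..r} x *\<^sub>R \<bar>g x\<bar> = 0"
    using ni unfolding set_lebesgue_integral_def set_integrable_def
    by (subst (asm) integral_nonneg_eq_0_iff_AE) auto
  then show ?thesis by eventually_elim (auto simp: indicator_def)
qed auto

section \<open>Solutions of the Schroedinger equation\<close>

lemma has_integral_reflect_about:
  fixes f :: "real \<Rightarrow> 'a::euclidean_space"
  assumes "(f has_integral i) {a..b}"
  shows "((\<lambda>x. f (d - x)) has_integral i) {d - b..d - a}"
proof -
  have "((\<lambda>x. f ((-1) *\<^sub>R x + d)) has_integral i) ((\<lambda>x. - x + d) ` {a..b})"
    using has_integral_affinity[of f i a b "-1" d] assms by simp
  moreover have "(\<lambda>x. - x + d) ` {a..b} = {d - b..d - a}"
    using image_affinity_atLeastAtMost[of "-1" d a b] by (auto split: if_splits)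
  ultimately show ?thesis by simp
qed

lemma absolutely_integrable_reflect_about:
  fixes f :: "real \<Rightarrow> 'a::euclidean_space"
  assumes "f absolutely_integrable_on {a..b}"
  shows "(\<lambda>x. f (d - x)) absolutely_integrable_on {d - b..d - a}"
proof -
  have "f integrable_on {a..b}" "(\<lambda>x. norm (f x)) integrable_on {a..b}"
    using assms unfolding absolutely_integrable_on_def by blast+
  then show ?thesis unfolding absolutely_integrable_on_def integrable_on_def
    using has_integral_reflect_about[of f _ a b d] has_integral_reflect_about[of "\<lambda>x. norm (f x)" _ a b d]
    by blast
qed

lemma ac_deriv_reflect:
  assumes "ac_deriv l r f g" "l \<le> r"
  shows "ac_deriv (d - r) (d - l) (\<lambda>x. f (d - x)) (\<lambda>x. - g (d - x))"
proof (rule ac_derivI)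
  have "(\<lambda>x. - g x) absolutely_integrable_on {l..r}"
    by (rule ac_deriv_abs_int[OF ac_deriv_minus[OF assms(1)]]) auto
  then show "(\<lambda>x. - g (d - x)) absolutely_integrable_on {d - r..d - l}"
    by (rule absolutely_integrable_reflect_about)
  fix x assume x: "d - r \<le> x" "x \<le> d - l"
  have "(g has_integral (f r - f (d - x))) {d - x..r}"
    by (rule ac_deriv_has_integral[OF assms(1)]) (use x in auto)
  then have "((\<lambda>x. - g x) has_integral (f (d - x) - f r)) {d - x..r}"
    using has_integral_neg[of g "f r - f (d - x)" "{d - x..r}"] by simp
  from has_integral_reflect_about[OF this, of d]
  show "((\<lambda>x. - g (d - x)) has_integral (f (d - x) - f (d - (d - r)))) {d - r..x}" by simp
qed

text \<open>Domination of the partial sums by an integrable \<open>h\<close> is required instead of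
  uniform convergence, because the series for \<open>u''\<close> carries the unbounded factor
  \<open>q\<close>.\<close>

lemma ac_deriv_suminf:
  fixes F f :: "nat \<Rightarrow> real \<Rightarrow> 'a::euclidean_space"
  assumes F: "\<And>n. ac_deriv l r (F n) (f n)"
    and "\<And>x. x \<in> {l..r} \<Longrightarrow> (\<lambda>n. F n x) sums G x"
    and "\<And>x. x \<in> {l..r} \<Longrightarrow> (\<lambda>n. f n x) sums g x"
    and le: "\<And>N x. x \<in> {l..r} \<Longrightarrow> norm (\<Sum>n<N. f n x) \<le> h x"
    and h: "h integrable_on {l..r}"
  shows "ac_deriv l r G g"
proof (cases "l \<le> r")
  case True
  have S: "ac_deriv l r (\<lambda>x. \<Sum>n<N. F n x) (\<lambda>x. \<Sum>n<N. f n x)" for N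
    by (induction N) (auto intro: ac_deriv_add F ac_deriv_const)
  have conv: "(\<lambda>N. \<Sum>n<N. f n x) \<longlonglongrightarrow> g x" if "x \<in> {l..r}" for x
    using assms(3)[OF that] by (simp add: sums_def)
  have convF: "(\<lambda>N. \<Sum>n<N. F n x) \<longlonglongrightarrow> G x" if "x \<in> {l..r}" for x
    using assms(2)[OF that] by (simp add: sums_def)
  have DC: "g integrable_on {l..x}" "(\<lambda>N. integral {l..x} (\<lambda>x. \<Sum>n<N. f n x)) \<longlonglongrightarrow> integral {l..x} g"
    if "x \<in> {l..r}" for x
  proof -
    have 1: "(\<lambda>x. \<Sum>n<N. f n x) integrable_on {l..x}" for N
      using that by (intro ac_deriv_integrable[OF S]) auto
    have 2: "h integrable_on {l..x}" by (rule integrable_on_subinterval[OF h]) (use that in auto)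
    show "g integrable_on {l..x}" "(\<lambda>N. integral {l..x} (\<lambda>x. \<Sum>n<N. f n x)) \<longlonglongrightarrow> integral {l..x} g"
      by (rule dominated_convergence[where f = "\<lambda>N x. \<Sum>n<N. f n x", OF 1 2];
          use that conv le in simp)+
  qed
  have "norm (g x) \<le> h x" if "x \<in> {l..r}" for x
    by (rule tendsto_upperbound[OF tendsto_norm[OF conv[OF that]]]) (use le that in auto)
  then have gi: "g absolutely_integrable_on {l..r}"
    by (rule absolutely_integrable_integrable_bound[OF _ DC(1) h]) (use True in auto)
  show ?thesis
  proof (rule ac_derivI[OF gi])
    fix x assume x: "l \<le> x" "x \<le> r"
    have "(\<lambda>N. (\<Sum>n<N. F n x) - (\<Sum>n<N. F n l)) \<longlonglongrightarrow> G x - G l"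
      by (intro tendsto_diff convF) (use x in auto)
    moreover have "(\<Sum>n<N. F n x) - (\<Sum>n<N. F n l) = integral {l..x} (\<lambda>x. \<Sum>n<N. f n x)" for N
      by (rule ac_deriv_integral[OF S, symmetric]) (use x in auto)
    ultimately have "integral {l..x} g = G x - G l" using LIMSEQ_unique[OF DC(2)[of x]] x by simp
    then show "(g has_integral (G x - G l)) {l..x}"
      using DC(1)[of x] x by (simp add: has_integral_integrable_integral)
  qed
next
  case False
  then show ?thesis by (simp add: ac_deriv_def set_integrable_def)
qed

text \<open>The parameter \<open>w\<close> stands for \<open>- z\<close>, so that \<open>w = k\<^sup>2\<close> at the spectral parameter \<open>z = - k\<^sup>2\<close>.\<close>

definition schr_sol :: "(real \<Rightarrow> real) \<Rightarrow> complex \<Rightarrow> real \<Rightarrow> real \<Rightarrow> (real \<Rightarrow> complex) \<Rightarrow> (real \<Rightarrow> complex) \<Rightarrow> bool" where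
  "schr_sol q w l r u u' \<longleftrightarrow>
     ac_deriv l r u u' \<and> ac_deriv l r u' (\<lambda>t. (of_real (q t) + w) * u t)"

section \<open>Operations on solutions and the Wronskian\<close>

lemma schr_sol_subinterval:
  "schr_sol q w l r u u' \<Longrightarrow> l \<le> x \<Longrightarrow> y \<le> r \<Longrightarrow> schr_sol q w x y u u'"
  unfolding schr_sol_def using ac_deriv_subinterval by blast

lemma schr_sol_continuous:
  assumes "schr_sol q w l r u u'"
  shows "continuous_on {l..r} u" "continuous_on {l..r} u'"
  using assms ac_deriv_continuous unfolding schr_sol_def by blast+

lemma schr_sol_add:
  "schr_sol q w l r u u' \<Longrightarrow> schr_sol q w l r v v' \<Longrightarrow>
    schr_sol q w l r (\<lambda>x. u x + v x) (\<lambda>x. u' x + v' x)"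
  unfolding schr_sol_def distrib_left by (elim conjE, intro conjI ac_deriv_add)

lemma schr_sol_cmult:
  assumes "schr_sol q w l r u u'"
  shows "schr_sol q w l r (\<lambda>x. c * u x) (\<lambda>x. c * u' x)"
proof -
  have "(of_real (q t) + w) * (c * u t) = c * ((of_real (q t) + w) * u t)" for t by simp
  then show ?thesis
    using assms ac_deriv_linear[OF _ bounded_linear_mult_right, of l r _ _ c] unfolding schr_sol_def by presburger
qed

text \<open>Turns a right endpoint into the initial point 0, so that a boundary condition there
  becomes initial data and a decaying solution a growing one.\<close>

lemma schr_sol_reflect:
  assumes "schr_sol q w l r u u'" "l \<le> r"
  shows "schr_sol (\<lambda>t. q (d - t)) w (d - r) (d - l) (\<lambda>x. u (d - x)) (\<lambda>x. - u' (d - x))"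
proof -
  have 1: "ac_deriv (d - r) (d - l) (\<lambda>x. u (d - x)) (\<lambda>x. - u' (d - x))"
    and 2: "ac_deriv (d - r) (d - l) (\<lambda>x. u' (d - x)) (\<lambda>x. - ((of_real (q (d - x)) + w) * u (d - x)))"
    using assms ac_deriv_reflect[of l r] unfolding schr_sol_def by auto
  from ac_deriv_minus[OF 2] 1 show ?thesis unfolding schr_sol_def by simp
qed

lemma schr_sol_AE_cong:
  assumes "schr_sol q1 w l r u u'" "AE x in lebesgue. x \<in> {l<..<r} \<longrightarrow> q1 x = q2 x"
  shows "schr_sol q2 w l r u u'"
proof -
  obtain N where N: "N \<in> null_sets lebesgue" "{x. \<not> (x \<in> {l<..<r} \<longrightarrow> q1 x = q2 x)} \<subseteq> N"
    using assms(2) by (auto simp: eventually_ae_filter)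
  then have neg: "negligible (N \<union> {l, r})" by (simp add: negligible_iff_null_sets[symmetric])
  have "ac_deriv l r u' (\<lambda>t. (of_real (q2 t) + w) * u t)"
    by (rule ac_deriv_spike[OF _ neg, where g = "\<lambda>t. (of_real (q1 t) + w) * u t"])
       (use assms(1) N(2) in \<open>auto simp: schr_sol_def subset_eq\<close>)
  then show ?thesis using assms(1) unfolding schr_sol_def by simp
qed

lemma schr_sol_wronskian:
  assumes u: "schr_sol q w l r u u'" and v: "schr_sol q w l r v v'" and x: "l \<le> x" "x \<le> r"
  shows "u x * v' x - u' x * v x = u l * v' l - u' l * v l"
proof -
  have "ac_deriv l r (\<lambda>x. u x * v' x - u' x * v x)
     (\<lambda>x. (u' x * v' x + u x * ((of_real (q x) + w) * v x)) - (((of_real (q x) + w) * u x) * v x + u' x * v' x))"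
    using u v unfolding schr_sol_def by (intro ac_deriv_diff ac_deriv_mult) auto
  then have "ac_deriv l r (\<lambda>x. u x * v' x - u' x * v x) (\<lambda>x. 0)"
    by (rule ac_deriv_cong) (auto simp: algebra_simps)
  from ac_deriv_zero_const[OF this x] show ?thesis .
qed

section \<open>Existence by Picard iteration\<close>

lemma potential_abs_int:
  fixes q :: "real \<Rightarrow> real"
  assumes "q absolutely_integrable_on {l..r}"
  shows "(\<lambda>t. complex_of_real (q t) + w) absolutely_integrable_on {l..r}"
proof (rule set_integral_add(1))
  show "(\<lambda>t. complex_of_real (q t)) absolutely_integrable_on {l..r}"
    using absolutely_integrable_linear[OF assms bounded_linear_of_real] by (simp add: o_def)
  show "(\<lambda>t. w) absolutely_integrable_on {l..r}"
    by (rule absolutely_integrable_continuous_real) (rule continuous_on_const)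
qed

lemma potential_mult_abs_int:
  fixes q :: "real \<Rightarrow> real"
  assumes "q absolutely_integrable_on {l..r}" "continuous_on {l..r} u"
  shows "(\<lambda>t. (complex_of_real (q t) + w) * u t) absolutely_integrable_on {l..r}"
  using absolutely_integrable_continuous_mult[OF assms(2) potential_abs_int[OF assms(1)], of w]
  by (simp add: mult.commute)

lemma integrable_continuous_mult_norm:
  fixes g :: "real \<Rightarrow> complex" and h :: "real \<Rightarrow> real"
  assumes "g absolutely_integrable_on {l..r}" "continuous_on {l..r} h"
  shows "(\<lambda>t. norm (g t) * h t) integrable_on {l..r}"
proof -
  have "(\<lambda>t. norm (g t)) absolutely_integrable_on {l..r}"
    using absolutely_integrable_norm[OF assms(1)] by (simp add: o_def)
  from absolutely_integrable_continuous_mult[OF assms(2) this] show ?thesis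
    by (auto dest: set_lebesgue_integral_eq_integral(1) simp: mult.commute)
qed

lemma integral_norm_mult_exp_le:
  fixes g :: "real \<Rightarrow> complex" and u :: "real \<Rightarrow> complex"
  assumes g: "g absolutely_integrable_on {0..T}" and u: "continuous_on {0..T} u"
    and B: "integral {0..T} (\<lambda>t. norm (g t)) \<le> B"
    and ub: "\<And>t. t \<in> {0..T} \<Longrightarrow> norm (u t) \<le> M * exp (c * t)" and "0 \<le> M" "0 \<le> c" and s: "0 \<le> s" "s \<le> T"
  shows "norm (integral {0..s} (\<lambda>t. g t * u t)) \<le> B * M * exp (c * s)"
proof -
  have gs: "g absolutely_integrable_on {0..s}"
    by (rule absolutely_integrable_on_subinterval[OF g]) (use s in auto)
  have us: "continuous_on {0..s} u" by (rule continuous_on_subset[OF u]) (use s in auto)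
  have gu: "(\<lambda>t. g t * u t) integrable_on {0..s}"
    using absolutely_integrable_continuous_mult[OF us gs]
    by (auto dest: set_lebesgue_integral_eq_integral(1) simp: mult.commute)
  have gn: "(\<lambda>t. norm (g t)) integrable_on {0..s}" "(\<lambda>t. norm (g t)) integrable_on {0..T}"
    using g gs unfolding absolutely_integrable_on_def by blast+
  have "norm (integral {0..s} (\<lambda>t. g t * u t)) \<le> integral {0..s} (\<lambda>t. norm (g t) * (M * exp (c * s)))"
  proof (rule integral_norm_bound_integral[OF gu])
    show "(\<lambda>t. norm (g t) * (M * exp (c * s))) integrable_on {0..s}"
      by (rule integrable_on_mult_left[OF gn(1)])
    fix t assume t: "t \<in> {0..s}"
    then have "norm (u t) \<le> M * exp (c * t)" using ub s by auto
    also have "\<dots> \<le> M * exp (c * s)"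
      using t assms by (intro mult_left_mono) (auto intro: mult_left_mono)
    finally show "norm (g t * u t) \<le> norm (g t) * (M * exp (c * s))"
      unfolding norm_mult by (rule mult_left_mono) simp
  qed
  also have "\<dots> = integral {0..s} (\<lambda>t. norm (g t)) * (M * exp (c * s))" by simp
  also have "\<dots> \<le> B * (M * exp (c * s))"
  proof (rule mult_right_mono)
    have "integral {0..s} (\<lambda>t. norm (g t)) \<le> integral {0..T} (\<lambda>t. norm (g t))"
      by (rule integral_subset_le[OF _ gn]) (use s in auto)
    with B show "integral {0..s} (\<lambda>t. norm (g t)) \<le> B" by simp
  qed (use \<open>0 \<le> M\<close> in auto)
  finally show ?thesis by (simp add: mult.assoc)
qed

text \<open>Integrating the weight gains \<open>1 / c\<close>; with \<open>c = 2 * B\<close> this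
  outweighs the factor \<open>B\<close> lost in \<open>integral_norm_mult_exp_le\<close>.\<close>

lemma integral_exp_le:
  assumes "0 \<le> C" "0 < c" "0 \<le> x" and v: "v absolutely_integrable_on {0..x}"
    and vb: "\<And>s. s \<in> {0..x} \<Longrightarrow> norm (v s) \<le> C * exp (c * s)"
  shows "norm (integral {0..x} (v :: real \<Rightarrow> complex)) \<le> C / c * exp (c * x)"
proof -
  have I: "((\<lambda>s. C * exp (c * s)) has_integral (C / c * exp (c * x) - C / c * exp (c * 0))) {0..x}"
  proof (rule fundamental_theorem_of_calculus[OF \<open>0 \<le> x\<close>])
    fix s assume "s \<in> {0..x}"
    have "((\<lambda>s. C / c * exp (c * s)) has_real_derivative C * exp (c * s)) (at s within {0..x})"
      using \<open>0 < c\<close> by (auto intro!: derivative_eq_intros)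
    then show "((\<lambda>s. C / c * exp (c * s)) has_vector_derivative C * exp (c * s)) (at s within {0..x})"
      by (simp add: has_real_derivative_iff_has_vector_derivative)
  qed
  have "norm (integral {0..x} v) \<le> integral {0..x} (\<lambda>s. C * exp (c * s))"
    by (rule integral_norm_bound_integral[OF set_lebesgue_integral_eq_integral(1)[OF v]])
       (use I vb in auto)
  also have "\<dots> \<le> C / c * exp (c * x)" unfolding integral_unique[OF I] using assms by simp
  finally show ?thesis .
qed

text \<open>The whole coefficient \<open>q + w\<close> is treated as a perturbation of
  \<open>u'' = 0\<close>, whose solution is the zeroth iterate. Every iterate is therefore a
  polynomial in \<open>w\<close>.\<close>

fun picard :: "(real \<Rightarrow> real) \<Rightarrow> complex \<Rightarrow> complex \<Rightarrow> complex \<Rightarrow> nat \<Rightarrow> real \<Rightarrow> complex" where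
  "picard q w u0 u1 0 = (\<lambda>x. u0 + of_real x * u1)"
| "picard q w u0 u1 (Suc n) = (\<lambda>x. integral {0..x} (\<lambda>s.
     integral {0..s} (\<lambda>t. (of_real (q t) + w) * picard q w u0 u1 n t)))"

definition picard_deriv :: "(real \<Rightarrow> real) \<Rightarrow> complex \<Rightarrow> complex \<Rightarrow> complex \<Rightarrow> nat \<Rightarrow> real \<Rightarrow> complex" where
  "picard_deriv q w u0 u1 n = (\<lambda>s. integral {0..s} (\<lambda>t. (of_real (q t) + w) * picard q w u0 u1 n t))"

definition schr_u :: "(real \<Rightarrow> real) \<Rightarrow> complex \<Rightarrow> complex \<Rightarrow> complex \<Rightarrow> real \<Rightarrow> complex" where
  "schr_u q w u0 u1 x = (\<Sum>n. picard q w u0 u1 n x)"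

definition schr_u' :: "(real \<Rightarrow> real) \<Rightarrow> complex \<Rightarrow> complex \<Rightarrow> complex \<Rightarrow> real \<Rightarrow> complex" where
  "schr_u' q w u0 u1 x = u1 + (\<Sum>n. picard_deriv q w u0 u1 n x)"

lemma ac_deriv_integral_left:
  assumes "g absolutely_integrable_on {0..T}"
  shows "ac_deriv 0 T (\<lambda>x. integral {0..x} g) g" using assms unfolding ac_deriv_def by simp

context
  fixes q :: "real \<Rightarrow> real" and T :: real
  assumes q: "q absolutely_integrable_on {0..T}" and T: "0 \<le> T"
begin

lemma picard_continuous: "continuous_on {0..T} (picard q w u0 u1 n)"
  and picard_deriv_ac: "ac_deriv 0 T (picard_deriv q w u0 u1 n) (\<lambda>t. (of_real (q t) + w) * picard q w u0 u1 n t)"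
  and picard_ac: "ac_deriv 0 T (picard q w u0 u1 (Suc n)) (picard_deriv q w u0 u1 n)"
proof -
  have D: "ac_deriv 0 T (picard_deriv q w u0 u1 n) (\<lambda>t. (of_real (q t) + w) * picard q w u0 u1 n t)"
    if "continuous_on {0..T} (picard q w u0 u1 n)" for n
    unfolding picard_deriv_def by (intro ac_deriv_integral_left potential_mult_abs_int q that)
  have P: "ac_deriv 0 T (picard q w u0 u1 (Suc n)) (picard_deriv q w u0 u1 n)"
    if "continuous_on {0..T} (picard q w u0 u1 n)" for n
    using ac_deriv_integral_left[OF absolutely_integrable_continuous_real[OF ac_deriv_continuous[OF D[OF that]]]]
    by (simp add: picard_deriv_def)
  have C: "continuous_on {0..T} (picard q w u0 u1 n)" for n
  proof (induction n)
    case 0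
    then show ?case by (auto intro!: continuous_intros)
  next
    case (Suc n)
    show ?case by (rule ac_deriv_continuous[OF P[OF Suc]])
  qed
  show "continuous_on {0..T} (picard q w u0 u1 n)"
    "ac_deriv 0 T (picard_deriv q w u0 u1 n) (\<lambda>t. (of_real (q t) + w) * picard q w u0 u1 n t)"
    "ac_deriv 0 T (picard q w u0 u1 (Suc n)) (picard_deriv q w u0 u1 n)" using C D P by blast+
qed

text \<open>With the weight \<open>exp (2 B x)\<close> one iteration gains the factor \<open>1 / 2\<close>, uniformly on bounded sets
  of \<open>w\<close>.\<close>

lemma picard_bound:
  assumes B: "integral {0..T} (\<lambda>t. norm (of_real (q t) + w)) \<le> B" and "0 < B"
  shows "x \<in> {0..T} \<Longrightarrow> norm (picard q w u0 u1 n x) \<le> (norm u0 + T * norm u1) * (1 / 2) ^ n * exp (2 * B * x)"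
    and "x \<in> {0..T} \<Longrightarrow> norm (picard_deriv q w u0 u1 n x) \<le> B * ((norm u0 + T * norm u1) * (1 / 2) ^ n) * exp (2 * B * x)"
proof -
  define C where "C = norm u0 + T * norm u1"
  have C0: "0 \<le> C" using T by (simp add: C_def)
  have D: "norm (picard_deriv q w u0 u1 n x) \<le> B * (C * (1 / 2) ^ n) * exp (2 * B * x)"
    if P: "\<And>x. x \<in> {0..T} \<Longrightarrow> norm (picard q w u0 u1 n x) \<le> C * (1 / 2) ^ n * exp (2 * B * x)"
      and x: "x \<in> {0..T}" for n x unfolding picard_deriv_def
    by (rule integral_norm_mult_exp_le[OF potential_abs_int[OF q] picard_continuous B P])
       (use x C0 \<open>0 < B\<close> in auto)
  have P: "\<forall>x\<in>{0..T}. norm (picard q w u0 u1 n x) \<le> C * (1 / 2) ^ n * exp (2 * B * x)" for n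
  proof (induction n)
    case 0
    show ?case
    proof
      fix x assume x: "x \<in> {0..T}"
      have "norm (picard q w u0 u1 0 x) \<le> norm u0 + norm (of_real x * u1)"
        by (simp del: norm_mult) (rule norm_triangle_ineq)
      also have "\<dots> \<le> C" using x by (auto simp: C_def norm_mult intro!: mult_right_mono)
      also have "C * 1 \<le> C * exp (2 * B * x)" using x \<open>0 < B\<close> C0 by (intro mult_left_mono) auto
      finally show "norm (picard q w u0 u1 0 x) \<le> C * (1 / 2) ^ 0 * exp (2 * B * x)" by simp
    qed
  next
    case (Suc n)
    show ?case
    proof
      fix x assume x: "x \<in> {0..T}"
      have "norm (integral {0..x} (picard_deriv q w u0 u1 n)) \<le> (B * (C * (1 / 2) ^ n)) / (2 * B) * exp (2 * B * x)"
      proof (rule integral_exp_le)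
        show "picard_deriv q w u0 u1 n absolutely_integrable_on {0..x}"
          by (rule ac_deriv_abs_int[OF picard_ac]) (use x in auto)
        fix s assume "s \<in> {0..x}"
        then show "norm (picard_deriv q w u0 u1 n s) \<le> B * (C * (1 / 2) ^ n) * exp (2 * B * s)"
          by (intro D) (use Suc x in auto)
      qed (use x \<open>0 < B\<close> C0 in auto)
      also have "(B * (C * (1 / 2) ^ n)) / (2 * B) = C * (1 / 2) ^ Suc n" using \<open>0 < B\<close> by simp
      finally show "norm (picard q w u0 u1 (Suc n) x) \<le> C * (1 / 2) ^ Suc n * exp (2 * B * x)"
        by (simp add: picard_deriv_def)
    qed
  qed
  show "norm (picard q w u0 u1 n x) \<le> (norm u0 + T * norm u1) * (1 / 2) ^ n * exp (2 * B * x)"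
    if "x \<in> {0..T}" using P that unfolding C_def by blast
  show "norm (picard_deriv q w u0 u1 n x) \<le> B * ((norm u0 + T * norm u1) * (1 / 2) ^ n) * exp (2 * B * x)"
    if "x \<in> {0..T}" using D[of n x] P that unfolding C_def by blast
qed

lemma potential_integral_le:
  fixes w :: complex
  assumes "norm w \<le> \<rho>"
  shows "integral {0..T} (\<lambda>t. norm (of_real (q t) + w)) \<le> l1_norm q T + T * \<rho>"
proof -
  have qi: "(\<lambda>t. \<bar>q t\<bar>) integrable_on {0..T}" using q unfolding absolutely_integrable_on_def by simp
  have "integral {0..T} (\<lambda>t. norm (of_real (q t) + w)) \<le> integral {0..T} (\<lambda>t. \<bar>q t\<bar> + \<rho>)"
  proof (rule integral_le)
    show "(\<lambda>t. norm (of_real (q t) + w)) integrable_on {0..T}"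
      using potential_abs_int[OF q, of w] unfolding absolutely_integrable_on_def by blast
    show "(\<lambda>t. \<bar>q t\<bar> + \<rho>) integrable_on {0..T}" by (intro integrable_add qi) auto
    show "norm (of_real (q t) + w) \<le> \<bar>q t\<bar> + \<rho>" for t
      using norm_triangle_ineq[of "of_real (q t)" w] assms by simp
  qed
  also have "\<dots> = l1_norm q T + integral {0..T} (\<lambda>t. \<rho>)" by (rule integral_add[OF qi]) auto
  finally show ?thesis using T by simp
qed

lemma picard_uniform_bound:
  obtains M where "0 \<le> M"
    "\<And>n w x. norm w \<le> \<rho> \<Longrightarrow> x \<in> {0..T} \<Longrightarrow> norm (picard q w u0 u1 n x) \<le> M * (1 / 2) ^ n"
    "\<And>n w x. norm w \<le> \<rho> \<Longrightarrow> x \<in> {0..T} \<Longrightarrow> norm (picard_deriv q w u0 u1 n x) \<le> M * (1 / 2) ^ n"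
proof -
  \<comment> \<open>The summand 1 makes \<open>B\<close> at least 1, so the extra factor
    \<open>B\<close> in the bound of \<open>picard_deriv\<close> fits into a constant
    \<open>M\<close> that serves both bounds.\<close>
  define B where "B = l1_norm q T + T * \<bar>\<rho>\<bar> + 1"
  have "0 \<le> l1_norm q T"
    using q unfolding absolutely_integrable_on_def by (intro integral_nonneg) auto
  then have B1: "1 \<le> B" using T by (simp add: B_def)
  define C where "C = (norm u0 + T * norm u1)"
  have C0: "0 \<le> C" using T by (simp add: C_def)
  define M where "M = B * C * exp (2 * B * T)"
  have int: "integral {0..T} (\<lambda>t. norm (of_real (q t) + w)) \<le> B" if "norm w \<le> \<rho>" for w :: complex
    using potential_integral_le[OF that] T mult_left_mono[OF abs_ge_self T, of \<rho>] unfolding B_def by linarith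
  have e: "exp (2 * B * x) \<le> exp (2 * B * T)" if "x \<in> {0..T}" for x using that B1 by auto
  show ?thesis
  proof (rule that)
    show "0 \<le> M" using B1 C0 by (simp add: M_def)
    fix n and w :: complex and x assume w: "norm w \<le> \<rho>" and x: "x \<in> {0..T}"
    have "norm (picard q w u0 u1 n x) \<le> C * (1 / 2) ^ n * exp (2 * B * x)"
      unfolding C_def by (rule picard_bound(1)[OF int[OF w]]) (use B1 x in auto)
    also have "\<dots> \<le> C * (1 / 2) ^ n * exp (2 * B * T)" using C0 by (intro mult_left_mono e x) auto
    also have "\<dots> \<le> B * (C * (1 / 2) ^ n * exp (2 * B * T))"
      using B1 C0 mult_right_mono[of 1 B "C * (1 / 2) ^ n * exp (2 * B * T)"] by simp
    finally show "norm (picard q w u0 u1 n x) \<le> M * (1 / 2) ^ n" by (simp add: M_def mult_ac)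
    have "norm (picard_deriv q w u0 u1 n x) \<le> B * (C * (1 / 2) ^ n) * exp (2 * B * x)"
      unfolding C_def by (rule picard_bound(2)[OF int[OF w]]) (use B1 x in auto)
    also have "\<dots> \<le> B * (C * (1 / 2) ^ n) * exp (2 * B * T)"
      using C0 B1 by (intro mult_left_mono e x) auto
    finally show "norm (picard_deriv q w u0 u1 n x) \<le> M * (1 / 2) ^ n" by (simp add: M_def mult_ac)
  qed
qed

lemma geometric_dominated:
  fixes f :: "nat \<Rightarrow> complex"
  assumes "\<And>n. norm (f n) \<le> M * (1 / 2) ^ n" "0 \<le> M"
  shows "summable f" "norm (\<Sum>n<N. f n) \<le> 2 * M"
proof -
  have s: "summable (\<lambda>n. M * (1 / 2 :: real) ^ n)" by (intro summable_mult summable_geometric) simp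
  show "summable f" by (rule summable_comparison_test[OF _ s]) (use assms in auto)
  have "norm (\<Sum>n<N. f n) \<le> (\<Sum>n<N. M * (1 / 2) ^ n)"
    by (rule order_trans[OF norm_sum]) (intro sum_mono assms)
  also have "\<dots> \<le> (\<Sum>n. M * (1 / 2) ^ n)" by (rule sum_le_suminf[OF s]) (use assms in auto)
  also have "\<dots> = 2 * M" by (simp add: suminf_mult suminf_geometric summable_geometric)
  finally show "norm (\<Sum>n<N. f n) \<le> 2 * M" .
qed

lemma schr_u_sol: "schr_sol q w 0 T (schr_u q w u0 u1) (schr_u' q w u0 u1)"
proof -
  obtain M where M: "0 \<le> M"
    and P: "\<And>n x. x \<in> {0..T} \<Longrightarrow> norm (picard q w u0 u1 n x) \<le> M * (1 / 2) ^ n"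
    and P': "\<And>n x. x \<in> {0..T} \<Longrightarrow> norm (picard_deriv q w u0 u1 n x) \<le> M * (1 / 2) ^ n"
    using picard_uniform_bound[of "norm w" u0 u1] by (metis order_refl)
  have S: "(\<lambda>n. picard q w u0 u1 n x) sums schr_u q w u0 u1 x" if "x \<in> {0..T}" for x
    unfolding schr_u_def by (rule summable_sums[OF geometric_dominated(1)[OF P[OF that] M]])
  have S': "(\<lambda>n. picard_deriv q w u0 u1 n x) sums (schr_u' q w u0 u1 x - u1)" if "x \<in> {0..T}" for x
    unfolding schr_u'_def using summable_sums[OF geometric_dominated(1)[OF P'[OF that] M]] by simp
  have gi: "(\<lambda>t. norm (of_real (q t) + w) * (2 * M)) integrable_on {0..T}"
    by (rule integrable_continuous_mult_norm[OF potential_abs_int[OF q]]) (rule continuous_on_const)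
  have "ac_deriv 0 T (\<lambda>x. schr_u' q w u0 u1 x - u1) (\<lambda>t. (of_real (q t) + w) * schr_u q w u0 u1 t)"
  proof (rule ac_deriv_suminf[OF picard_deriv_ac S' _ _ gi])
    fix x assume x: "x \<in> {0..T}"
    show "(\<lambda>n. (of_real (q x) + w) * picard q w u0 u1 n x) sums ((of_real (q x) + w) * schr_u q w u0 u1 x)"
      by (rule sums_mult[OF S[OF x]])
    show "norm (\<Sum>n<N. (of_real (q x) + w) * picard q w u0 u1 n x) \<le> norm (of_real (q x) + w) * (2 * M)" for N
      unfolding sum_distrib_left[symmetric] norm_mult
      by (rule mult_left_mono[OF geometric_dominated(2)[OF P[OF x] M]]) simp
  qed
  from ac_deriv_add[OF this ac_deriv_const[of 0 T u1]]
  have 1: "ac_deriv 0 T (schr_u' q w u0 u1) (\<lambda>t. (of_real (q t) + w) * schr_u q w u0 u1 t)" by simp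
  \<comment> \<open>The zeroth iterate is not an integral of the others and is split off; the n-th
    term of the shifted series has derivative \<open>picard_deriv n\<close>.\<close>
  have "ac_deriv 0 T (\<lambda>x. schr_u q w u0 u1 x - (u0 + of_real x * u1)) (\<lambda>x. schr_u' q w u0 u1 x - u1)"
  proof (rule ac_deriv_suminf[OF picard_ac _ S', where h = "\<lambda>x. 2 * M"])
    fix x assume x: "x \<in> {0..T}"
    have "(\<lambda>n. picard q w u0 u1 (Suc n) x) sums (schr_u q w u0 u1 x - picard q w u0 u1 0 x)"
      by (subst sums_Suc_iff) (use S[OF x] in simp)
    then show "(\<lambda>n. picard q w u0 u1 (Suc n) x) sums (schr_u q w u0 u1 x - (u0 + of_real x * u1))" by simp
    show "norm (\<Sum>n<N. picard_deriv q w u0 u1 n x) \<le> 2 * M" for N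
      by (rule geometric_dominated(2)[OF P'[OF x] M])
  qed auto
  moreover have "ac_deriv 0 T (\<lambda>x. u0 + of_real x * u1) (\<lambda>x. u1)"
  proof (rule ac_deriv_C1)
    fix x :: real
    have "bounded_linear (\<lambda>x. of_real x * u1)"
      by (intro bounded_linear_compose[OF bounded_linear_mult_left bounded_linear_of_real])
    from bounded_linear.has_vector_derivative[OF this has_vector_derivative_id]
    have "((\<lambda>x. of_real x * u1) has_vector_derivative u1) (at x within {0..T})" by simp
    from has_vector_derivative_add[OF has_vector_derivative_const[of u0] this]
    show "((\<lambda>x. u0 + of_real x * u1) has_vector_derivative u1) (at x within {0..T})" by simp
  qed (rule continuous_on_const)
  ultimately have "ac_deriv 0 T (schr_u q w u0 u1) (schr_u' q w u0 u1)"
    using ac_deriv_add[of 0 T "\<lambda>x. schr_u q w u0 u1 x - (u0 + of_real x * u1)" "\<lambda>x. schr_u' q w u0 u1 x - u1"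
        "\<lambda>x. u0 + of_real x * u1" "\<lambda>x. u1"] by simp
  with 1 show ?thesis unfolding schr_sol_def by simp
qed

end

lemma picard_at_0: "picard q w u0 u1 n 0 = (if n = 0 then u0 else 0)" by (cases n) auto

lemma schr_u_0 [simp]: "schr_u q w u0 u1 0 = u0" "schr_u' q w u0 u1 0 = u1"
proof -
  have "(\<lambda>n. picard q w u0 u1 n 0) sums u0"
    using sums_single[of 0 "\<lambda>_. u0"] by (simp add: picard_at_0)
  then show "schr_u q w u0 u1 0 = u0" unfolding schr_u_def by (rule sums_unique[symmetric])
  show "schr_u' q w u0 u1 0 = u1" by (simp add: schr_u'_def picard_deriv_def)
qed

section \<open>Uniqueness and dependence on the parameter\<close>

lemma schr_u_wronskian:
  assumes q: "q absolutely_integrable_on {0..T}" and x: "0 \<le> x" "x \<le> T"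
  shows "schr_u q w 1 0 x * schr_u' q w 0 1 x - schr_u' q w 1 0 x * schr_u q w 0 1 x = 1"
proof -
  have T: "0 \<le> T" using x by simp
  show ?thesis
    using schr_sol_wronskian[OF schr_u_sol[OF q T, of w 1 0] schr_u_sol[OF q T, of w 0 1] x] by simp
qed

text \<open>No Gronwall estimate is involved: the Wronskians of \<open>u\<close> with both
  fundamental solutions vanish, and these two linear equations for \<open>u x\<close> and
  \<open>u' x\<close> have determinant 1 up to sign.\<close>

lemma schr_sol_zero:
  assumes u: "schr_sol q w 0 T u u'" and q: "q absolutely_integrable_on {0..T}"
    and "u 0 = 0" "u' 0 = 0" and x: "0 \<le> x" "x \<le> T"
  shows "u x = 0"
proof -
  have "0 \<le> T" using x by simp
  note W = schr_sol_wronskian[OF u schr_u_sol[OF q this] x, unfolded assms(3,4)]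
  show ?thesis using W[of 1 0] W[of 0 1] schr_u_wronskian[OF q x, of w] by algebra
qed

text \<open>The iterates are polynomials in \<open>w\<close> with coefficients continuous in
  \<open>x\<close>, and the bound of the Picard terms is uniform for bounded \<open>w\<close>, so
  the partial sums converge locally uniformly in \<open>w\<close>.\<close>

lemma schr_u_holomorphic:
  assumes q: "q absolutely_integrable_on {0..T}" and x: "x \<in> {0..T}"
  shows "(\<lambda>w. schr_u q w u0 u1 x) holomorphic_on UNIV"
proof -
  have T: "0 \<le> T" using x by simp
  have poly: "\<exists>c. (\<forall>k. continuous_on {0..T} (c k)) \<and>
      (\<forall>w. \<forall>x\<in>{0..T}. picard q w u0 u1 n x = (\<Sum>k\<le>n. c k x * w ^ k))" for n
  proof (induction n)
    case 0
    show ?case by (rule exI[of _ "\<lambda>k x. u0 + of_real x * u1"]) (auto intro!: continuous_intros)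
  next
    case (Suc n)
    then obtain c where c: "\<And>k. continuous_on {0..T} (c k)"
      and cp: "\<And>w x. x \<in> {0..T} \<Longrightarrow> picard q w u0 u1 n x = (\<Sum>k\<le>n. c k x * w ^ k)" by blast
    define I where "I g = (\<lambda>x. integral {0..x} (\<lambda>s. integral {0..s} g))" for g :: "real \<Rightarrow> complex"
    have ci: "continuous_on {0..T} (\<lambda>s. integral {0..s} g)" if "g absolutely_integrable_on {0..T}" for g :: "real \<Rightarrow> complex"
      by (rule ac_deriv_continuous[OF ac_deriv_integral_left[OF that]])
    have cI: "continuous_on {0..T} (I g)" if "g absolutely_integrable_on {0..T}" for g
      unfolding I_def by (intro ci absolutely_integrable_continuous_real that)
    define a where "a k t = of_real (q t) * c k t" for k t
    have a: "a k absolutely_integrable_on {0..T}" for k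
      using potential_mult_abs_int[OF q c, of 0 k] by (simp add: a_def[abs_def])
    have cc: "c k absolutely_integrable_on {0..T}" for k
      by (rule absolutely_integrable_continuous_real[OF c])
    \<comment> \<open>Multiplication by \<open>q\<close> keeps the degree, multiplication by
      \<open>w\<close> raises it by one; hence the shifted coefficient
      \<open>c (k - 1)\<close>.\<close>
    define d where "d k = (\<lambda>x. (if k \<le> n then I (a k) x else 0) + (if k = 0 then 0 else I (c (k - 1)) x))" for k
    have "continuous_on {0..T} (d k)" for k
      unfolding d_def by (cases "k \<le> n"; cases "k = 0") (auto intro!: continuous_intros cI a cc)
    moreover have "picard q w u0 u1 (Suc n) x = (\<Sum>k\<le>Suc n. d k x * w ^ k)" if x: "x \<in> {0..T}" for w x
    proof -
      have hi: "((\<lambda>t. (of_real (q t) + w) * picard q w u0 u1 n t) has_integral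
         (\<Sum>k\<le>n. (integral {0..s} (a k) * w ^ k + integral {0..s} (c k) * w ^ Suc k))) {0..s}" if s: "s \<in> {0..T}" for s
      proof (rule has_integral_eq[rotated])
        have ii: "g integrable_on {0..s}" if "g absolutely_integrable_on {0..T}" for g :: "real \<Rightarrow> complex"
          by (rule ac_deriv_integrable[OF ac_deriv_integral_left[OF that]]) (use s in auto)
        show "((\<lambda>t. (\<Sum>k\<le>n. (a k t * w ^ k + c k t * w ^ Suc k))) has_integral
         (\<Sum>k\<le>n. (integral {0..s} (a k) * w ^ k + integral {0..s} (c k) * w ^ Suc k))) {0..s}"
          by (intro has_integral_sum has_integral_add has_integral_mult_left integrable_integral ii a cc) auto
        fix t assume "t \<in> {0..s}"
        then have "t \<in> {0..T}" using s by auto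
        then show "(\<Sum>k\<le>n. (a k t * w ^ k + c k t * w ^ Suc k)) = (of_real (q t) + w) * picard q w u0 u1 n t"
          by (simp add: cp a_def sum_distrib_left sum.distrib algebra_simps)
      qed
      have "((\<lambda>s. integral {0..s} (\<lambda>t. (of_real (q t) + w) * picard q w u0 u1 n t)) has_integral
         (\<Sum>k\<le>n. (I (a k) x * w ^ k + I (c k) x * w ^ Suc k))) {0..x}"
      proof (rule has_integral_eq[rotated])
        have ii: "g integrable_on {0..x}" if "continuous_on {0..T} g" for g :: "real \<Rightarrow> complex"
          by (intro integrable_continuous_real continuous_on_subset[OF that]) (use x in auto)
        show "((\<lambda>s. (\<Sum>k\<le>n. (integral {0..s} (a k) * w ^ k + integral {0..s} (c k) * w ^ Suc k))) has_integral
         (\<Sum>k\<le>n. (I (a k) x * w ^ k + I (c k) x * w ^ Suc k))) {0..x}" unfolding I_def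
          by (intro has_integral_sum has_integral_add has_integral_mult_left integrable_integral ii ci a cc) auto
        fix s assume "s \<in> {0..x}"
        then show "(\<Sum>k\<le>n. (integral {0..s} (a k) * w ^ k + integral {0..s} (c k) * w ^ Suc k))
           = integral {0..s} (\<lambda>t. (of_real (q t) + w) * picard q w u0 u1 n t)"
          by (intro integral_unique[OF hi, symmetric]) (use x in auto)
      qed
      then have "picard q w u0 u1 (Suc n) x = (\<Sum>k\<le>n. I (a k) x * w ^ k) + (\<Sum>k\<le>n. I (c k) x * w ^ Suc k)"
        by (simp add: integral_unique sum.distrib)
      also have "(\<Sum>k\<le>n. I (a k) x * w ^ k) = (\<Sum>k\<le>Suc n. (if k \<le> n then I (a k) x else 0) * w ^ k)"
        by simp
      also have "(\<Sum>k\<le>n. I (c k) x * w ^ Suc k) = (\<Sum>k\<le>Suc n. (if k = 0 then 0 else I (c (k - 1)) x) * w ^ k)"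
        by (simp only: sum.atMost_Suc_shift) simp
      also have "(\<Sum>k\<le>Suc n. (if k \<le> n then I (a k) x else 0) * w ^ k) + \<dots> = (\<Sum>k\<le>Suc n. d k x * w ^ k)"
        unfolding d_def distrib_right by (rule sum.distrib[symmetric])
      finally show ?thesis .
    qed
    ultimately show ?case by blast
  qed
  have hol: "(\<lambda>w. \<Sum>n<N. picard q w u0 u1 n x) holomorphic_on UNIV" for N
  proof (intro holomorphic_on_sum)
    fix n
    obtain c where "\<And>w. picard q w u0 u1 n x = (\<Sum>k\<le>n. c k x * w ^ k)" using poly[of n] x by blast
    then have eq: "(\<lambda>w. picard q w u0 u1 n x) = (\<lambda>w. \<Sum>k\<le>n. c k x * w ^ k)" by blast
    show "(\<lambda>w. picard q w u0 u1 n x) holomorphic_on UNIV" unfolding eq by (intro holomorphic_intros)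
  qed
  show ?thesis
  proof (rule holomorphic_uniform_sequence[OF open_UNIV hol])
    fix z :: complex
    obtain M where M: "0 \<le> M"
      and P: "\<And>n w x. norm w \<le> norm z + 1 \<Longrightarrow> x \<in> {0..T} \<Longrightarrow> norm (picard q w u0 u1 n x) \<le> M * (1 / 2) ^ n"
      using picard_uniform_bound[OF q T, of "norm z + 1" u0 u1] by metis
    have "uniform_limit (cball z 1) (\<lambda>N w. \<Sum>n<N. picard q w u0 u1 n x) (\<lambda>w. \<Sum>n. picard q w u0 u1 n x) sequentially"
    proof (rule Weierstrass_m_test)
      show "summable (\<lambda>n. M * (1 / 2 :: real) ^ n)" by (intro summable_mult summable_geometric) simp
      fix n w assume "w \<in> cball z 1"
      then have "norm w \<le> norm z + 1"
        using norm_triangle_ineq3[of w z] by (simp add: dist_norm norm_minus_commute)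
      then show "norm (picard q w u0 u1 n x) \<le> M * (1 / 2) ^ n" by (rule P[OF _ x])
    qed
    then show "\<exists>d>0. cball z d \<subseteq> UNIV \<and> uniform_limit (cball z d) (\<lambda>N w. \<Sum>n<N. picard q w u0 u1 n x)
        (\<lambda>w. schr_u q w u0 u1 x) sequentially" unfolding schr_u_def by (intro exI[of _ 1]) auto
  qed
qed

section \<open>Estimates for large spectral parameter\<close>

lemma ac_deriv_exp: "ac_deriv l r (\<lambda>x. exp (c * of_real x)) (\<lambda>x. c * exp (c * complex_of_real x))"
proof (rule ac_deriv_C1)
  show "((\<lambda>x. exp (c * of_real x)) has_vector_derivative c * exp (c * of_real x)) (at x within {l..r})" for x
    by (rule has_vector_derivative_real_field) (auto intro!: derivative_eq_intros)
qed (intro continuous_intros)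

text \<open>The combination \<open>p = u' + k * u\<close> satisfies
  \<open>p' = k * p + q * u\<close>, and the exponential is its integrating factor. As the equation
  contains only \<open>k\<^sup>2\<close>, replacing \<open>k\<close> by \<open>- k\<close> gives the
  companion formula for \<open>u' - k * u\<close>.\<close>

lemma variation_of_constants:
  assumes u: "schr_sol q (k\<^sup>2) 0 T u u'" and x: "0 \<le> x" "x \<le> T"
  shows "exp (- k * of_real x) * (u' x + k * u x) =
     u' 0 + k * u 0 + integral {0..x} (\<lambda>t. of_real (q t) * (exp (- k * of_real t) * u t))"
proof -
  have 1: "ac_deriv 0 T u u'" and 2: "ac_deriv 0 T u' (\<lambda>t. (of_real (q t) + k\<^sup>2) * u t)"
    using u unfolding schr_sol_def by auto
  have "ac_deriv 0 T (\<lambda>x. exp (- k * of_real x) * (u' x + k * u x))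
    (\<lambda>t. - k * exp (- k * of_real t) * (u' t + k * u t)
        + exp (- k * of_real t) * ((of_real (q t) + k\<^sup>2) * u t + k * u' t))"
    by (intro ac_deriv_mult ac_deriv_add ac_deriv_exp ac_deriv_linear[OF 1 bounded_linear_mult_right] 2)
  then have "ac_deriv 0 T (\<lambda>x. exp (- k * of_real x) * (u' x + k * u x))
    (\<lambda>t. of_real (q t) * (exp (- k * of_real t) * u t))"
    by (rule ac_deriv_cong) (auto simp: algebra_simps power2_eq_square)
  from ac_deriv_integral[OF this order_refl x] show ?thesis by simp
qed

lemma of_real_abs_int:
  fixes q :: "real \<Rightarrow> real"
  assumes "q absolutely_integrable_on {l..r}"
  shows "(\<lambda>t. complex_of_real (q t)) absolutely_integrable_on {l..r}"
  using potential_abs_int[OF assms, of 0] by simp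

lemma weighted_integral_bound:
  assumes q: "q absolutely_integrable_on {0..T}" and u: "continuous_on {0..T} u"
    and ub: "\<And>t. t \<in> {0..T} \<Longrightarrow> norm (u t) \<le> M * exp (\<sigma> * t)" and "0 \<le> M" "0 \<le> Re c + \<sigma>"
    and x: "0 \<le> x" "x \<le> T"
  shows "norm (integral {0..x} (\<lambda>t. of_real (q t) * (exp (c * of_real t) * u t)))
      \<le> l1_norm q T * M * exp ((Re c + \<sigma>) * x)"
proof (rule integral_norm_mult_exp_le[OF of_real_abs_int[OF q]])
  show "continuous_on {0..T} (\<lambda>t. exp (c * of_real t) * u t)" by (intro continuous_intros u)
  fix t assume t: "t \<in> {0..T}"
  have "norm (exp (c * of_real t) * u t) \<le> exp (Re c * t) * (M * exp (\<sigma> * t))"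
    unfolding norm_mult using ub[OF t] by (auto intro: mult_left_mono)
  then show "norm (exp (c * of_real t) * u t) \<le> M * exp ((Re c + \<sigma>) * t)"
    unfolding distrib_right exp_add by (simp only: mult_ac)
qed (use assms in auto)

text \<open>Let \<open>M\<close> be the maximum of the weighted norm of \<open>u\<close>, attained
  at \<open>m\<close>. The two formulas of variation of constants bound
  \<open>2 * k * u m = p m - s m\<close> by the initial data and \<open>2 * Q * M\<close>, up to the
  exponential. The hypothesis \<open>2 * Q \<le> norm k\<close> allows the last term to be absorbed
  on the left.\<close>

lemma schr_sol_bound:
  assumes u: "schr_sol q (k\<^sup>2) 0 T u u'" and q: "q absolutely_integrable_on {0..T}"
    and k: "k \<noteq> 0" "0 \<le> Re k" "2 * l1_norm q T \<le> norm k"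
    and x: "0 \<le> x" "x \<le> T"
  shows "norm (u x) \<le> 2 * (norm (u 0) + norm (u' 0) / norm k) * exp (Re k * x)"
proof -
  define Q where "Q = l1_norm q T"
  have uc: "continuous_on {0..T} u" by (rule schr_sol_continuous[OF u])
  have "continuous_on {0..T} (\<lambda>t. norm (u t) * exp (- Re k * t))" by (intro continuous_intros uc)
  from continuous_attains_sup[OF compact_Icc _ this]
  obtain m where m: "m \<in> {0..T}" and mm: "\<And>t. t \<in> {0..T} \<Longrightarrow> norm (u t) * exp (- Re k * t) \<le> norm (u m) * exp (- Re k * m)"
    using x by force
  define M where "M = norm (u m) * exp (- Re k * m)"
  have M0: "0 \<le> M" by (simp add: M_def)
  have um: "norm (u m) = M * exp (Re k * m)" unfolding M_def by (simp add: mult.assoc flip: exp_add)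
  have ub: "norm (u t) \<le> M * exp (Re k * t)" if "t \<in> {0..T}" for t
    using mult_right_mono[OF mm[OF that], of "exp (Re k * t)"]
    unfolding M_def[symmetric] by (simp add: mult.assoc flip: exp_add)
  define p where "p t = u' t + k * u t" for t
  define s where "s t = u' t - k * u t" for t
  have "norm (exp (- k * of_real m) * p m) \<le> norm (p 0) + Q * M"
  proof -
    have "norm (integral {0..m} (\<lambda>t. of_real (q t) * (exp (- k * of_real t) * u t))) \<le> Q * M"
      using weighted_integral_bound[OF q uc ub M0, of "- k" m] m by (simp add: Q_def)
    moreover have "exp (- k * of_real m) * p m = p 0 + integral {0..m} (\<lambda>t. of_real (q t) * (exp (- k * of_real t) * u t))"
      unfolding p_def by (rule variation_of_constants[OF u]) (use m in auto)
    ultimately show ?thesis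
      using norm_triangle_ineq[of "p 0" "integral {0..m} (\<lambda>t. of_real (q t) * (exp (- k * of_real t) * u t))"]
      by simp
  qed
  from mult_right_mono[OF this, of "exp (Re k * m)"]
  have "norm (p m) * (exp (- (Re k * m)) * exp (Re k * m)) \<le> (norm (p 0) + Q * M) * exp (Re k * m)"
    by (simp add: norm_mult mult_ac)
  then have P: "norm (p m) \<le> (norm (p 0) + Q * M) * exp (Re k * m)"
    unfolding exp_add[symmetric] by simp
  have "norm (exp (k * of_real m) * s m) \<le> norm (s 0) + Q * M * exp (2 * Re k * m)"
  proof -
    have "norm (integral {0..m} (\<lambda>t. of_real (q t) * (exp (k * of_real t) * u t))) \<le> Q * M * exp (2 * Re k * m)"
      using weighted_integral_bound[OF q uc ub M0, of k m] m k unfolding Q_def mult_2 by simp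
    moreover have "exp (k * of_real m) * s m = s 0 + integral {0..m} (\<lambda>t. of_real (q t) * (exp (k * of_real t) * u t))"
      using variation_of_constants[of q "- k" T u u' m] u m unfolding s_def by simp
    ultimately show ?thesis
      using norm_triangle_ineq[of "s 0" "integral {0..m} (\<lambda>t. of_real (q t) * (exp (k * of_real t) * u t))"]
      by simp
  qed
  also have "\<dots> \<le> (norm (s 0) + Q * M) * exp (2 * Re k * m)"
    using mult_left_mono[of 1 "exp (2 * Re k * m)" "norm (s 0)"] m k by (simp add: distrib_right)
  also have "2 * Re k * m = Re k * m + Re k * m" by simp
  also have "norm (exp (k * of_real m) * s m) = norm (s m) * exp (Re k * m)"
    by (simp add: norm_mult)
  finally have "norm (s m) * exp (Re k * m) \<le> (norm (s 0) + Q * M) * exp (Re k * m) * exp (Re k * m)"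
    unfolding exp_add by (simp only: mult.assoc)
  then have S: "norm (s m) \<le> (norm (s 0) + Q * M) * exp (Re k * m)"
    by (rule mult_right_le_imp_le) simp
  have "2 * k * u m = p m - s m" by (simp add: p_def s_def)
  then have "2 * norm k * norm (u m) \<le> norm (p m) + norm (s m)"
    by (metis norm_mult norm_numeral norm_triangle_ineq4)
  also have "\<dots> \<le> (norm (p 0) + norm (s 0) + 2 * (Q * M)) * exp (Re k * m)"
    using P S by (simp add: algebra_simps)
  also have "norm (p 0) + norm (s 0) + 2 * (Q * M) \<le> 2 * norm (u' 0) + 2 * norm k * norm (u 0) + norm k * M"
    using norm_triangle_ineq[of "u' 0" "k * u 0"] norm_triangle_ineq4[of "u' 0" "k * u 0"]
      mult_right_mono[OF k(3) M0] unfolding p_def s_def norm_mult Q_def[symmetric] by simp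
  finally have "2 * norm k * M * exp (Re k * m) \<le> (2 * norm (u' 0) + 2 * norm k * norm (u 0) + norm k * M) * exp (Re k * m)"
    by (simp add: um mult.assoc)
  then have "2 * norm k * M \<le> 2 * norm (u' 0) + 2 * norm k * norm (u 0) + norm k * M"
    by (rule mult_right_le_imp_le) simp
  then have "M \<le> 2 * (norm (u 0) + norm (u' 0) / norm k)" using k(1) by (simp add: field_simps)
  then have "M * exp (Re k * x) \<le> 2 * (norm (u 0) + norm (u' 0) / norm k) * exp (Re k * x)"
    by (rule mult_right_mono) simp
  with ub[of x] x show ?thesis by (metis atLeastAtMost_iff order_trans)
qed

section \<open>Asymptotics along the positive real axis\<close>

lemma exp_weighted_integral_tendsto_0:
  fixes q :: "real \<Rightarrow> real"
  assumes q: "q absolutely_integrable_on {0..T}"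
  shows "((\<lambda>k. integral {0..T} (\<lambda>t. \<bar>q t\<bar> * exp (- 2 * k * (T - t)))) \<longlongrightarrow> 0) at_top"
proof (rule tendsto_at_topI_sequentially)
  fix X :: "nat \<Rightarrow> real" assume X: "filterlim X at_top sequentially"
  \<comment> \<open>Early members of \<open>X\<close> may be negative; clipping at 0 keeps
    \<open>f n\<close> dominated by the absolute value of \<open>q\<close>. Pointwise convergence to
    0 fails only at \<open>t = T\<close>.\<close>
  define f where "f n t = \<bar>q t\<bar> * exp (- 2 * max 0 (X n) * (T - t))" for n t
  have qn: "(\<lambda>t. \<bar>q t\<bar>) integrable_on {0..T}" using q unfolding absolutely_integrable_on_def by simp
  have fi: "f n integrable_on {0..T}" for n
  proof -
    have "(\<lambda>t. norm (complex_of_real (q t)) * exp (- 2 * max 0 (X n) * (T - t))) integrable_on {0..T}"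
      by (intro integrable_continuous_mult_norm of_real_abs_int q continuous_intros)
    then show ?thesis by (simp add: f_def[abs_def])
  qed
  have fl: "norm (f n t) \<le> \<bar>q t\<bar>" if "t \<in> {0..T}" for n t
    using that by (auto simp: f_def abs_mult intro!: mult_left_le)
  have "(\<lambda>n. integral {0..T} (f n)) \<longlonglongrightarrow> integral {0..T} (\<lambda>t. if t = T then \<bar>q t\<bar> else 0)"
  proof (rule dominated_convergence(2)[OF fi qn fl])
    fix t assume t: "t \<in> {0..T}"
    show "(\<lambda>n. f n t) \<longlonglongrightarrow> (if t = T then \<bar>q t\<bar> else 0)"
    proof (cases "t = T")
      case True
      then show ?thesis by (simp add: f_def)
    next
      case False
      with t have "0 < T - t" by simp
      then have "((\<lambda>k. \<bar>q t\<bar> * exp (- 2 * max 0 k * (T - t))) \<longlongrightarrow> 0) at_top" by real_asymp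
      from filterlim_compose[OF this X] False show ?thesis by (simp add: f_def)
    qed
  qed auto
  moreover have "integral {0..T} (\<lambda>t. if t = T then \<bar>q t\<bar> else 0) = integral {0..T} (\<lambda>t. 0)"
    by (rule integral_spike[of "{T}"]) auto
  ultimately have "(\<lambda>n. integral {0..T} (f n)) \<longlonglongrightarrow> 0" by simp
  moreover have "\<forall>\<^sub>F n in sequentially. integral {0..T} (f n) = integral {0..T} (\<lambda>t. \<bar>q t\<bar> * exp (- 2 * X n * (T - t)))"
    using filterlim_at_top_dense[THEN iffD1, OF X, rule_format, of 0]
    by eventually_elim (simp add: f_def[abs_def])
  ultimately show "(\<lambda>n. integral {0..T} (\<lambda>t. \<bar>q t\<bar> * exp (- 2 * X n * (T - t)))) \<longlonglongrightarrow> 0"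
    by (rule Lim_transform_eventually)
qed

text \<open>After removal of \<open>exp (k * T)\<close>, the dominant combination
  \<open>u' + k * u\<close> is preserved up to an error independent of \<open>k\<close>, small
  against its size \<open>k\<close>. The combination \<open>u' - k * u\<close> forgets its initial
  value, and its source at \<open>t\<close> is discounted by
  \<open>exp (- 2 * k * (T - t))\<close>.\<close>

lemma schr_sol_real_estimates:
  fixes k :: real
  assumes u: "schr_sol q ((of_real k)\<^sup>2) 0 T u u'" and q: "q absolutely_integrable_on {0..T}"
    and k: "0 < k" "2 * l1_norm q T \<le> k" and T: "0 \<le> T"
    and N: "norm (u 0) + norm (u' 0) / k \<le> N"
  shows "norm (exp (- of_real k * of_real T) * (u' T + of_real k * u T) - (u' 0 + of_real k * u 0))
           \<le> l1_norm q T * (2 * N)"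
    and "norm (exp (- of_real k * of_real T) * (u' T - of_real k * u T))
           \<le> exp (- 2 * k * T) * (k * N) + 2 * N * integral {0..T} (\<lambda>t. \<bar>q t\<bar> * exp (- 2 * k * (T - t)))"
proof -
  have N0: "0 \<le> N" using N k by (smt (verit) divide_nonneg_pos norm_ge_zero)
  have ub: "norm (u t) \<le> 2 * N * exp (k * t)" if "t \<in> {0..T}" for t
  proof -
    have "norm (u t) \<le> 2 * (norm (u 0) + norm (u' 0) / norm (complex_of_real k)) * exp (Re (of_real k) * t)"
      by (rule schr_sol_bound[OF u q]) (use k that in auto)
    also have "\<dots> \<le> 2 * N * exp (k * t)" using N k by (auto intro!: mult_right_mono)
    finally show ?thesis .
  qed
  have uc: "continuous_on {0..T} u" by (rule schr_sol_continuous[OF u])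
  show "norm (exp (- of_real k * of_real T) * (u' T + of_real k * u T) - (u' 0 + of_real k * u 0))
           \<le> l1_norm q T * (2 * N)"
  proof -
    have "norm (integral {0..T} (\<lambda>t. of_real (q t) * (exp (- of_real k * of_real t) * u t)))
      \<le> l1_norm q T * (2 * N)"
      using weighted_integral_bound[OF q uc ub _ _ T order_refl, of "- of_real k"] N0 by simp
    with variation_of_constants[OF u T order_refl] show ?thesis by simp
  qed
  show "norm (exp (- of_real k * of_real T) * (u' T - of_real k * u T))
           \<le> exp (- 2 * k * T) * (k * N) + 2 * N * integral {0..T} (\<lambda>t. \<bar>q t\<bar> * exp (- 2 * k * (T - t)))"
  proof -
    let ?I = "integral {0..T} (\<lambda>t. of_real (q t) * (exp (of_real k * of_real t) * u t))"
    let ?J = "\<lambda>t. \<bar>q t\<bar> * exp (- 2 * k * (T - t))"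
    have V: "exp (of_real k * of_real T) * (u' T - of_real k * u T) = u' 0 - of_real k * u 0 + ?I"
      using variation_of_constants[of q "- of_real k" T u u' T] u T by simp
    have Ji: "?J integrable_on {0..T}"
    proof -
      have "(\<lambda>t. norm (complex_of_real (q t)) * exp (- 2 * k * (T - t))) integrable_on {0..T}"
        by (intro integrable_continuous_mult_norm of_real_abs_int q continuous_intros)
      then show ?thesis by simp
    qed
    have "norm ?I \<le> integral {0..T} (\<lambda>t. (2 * N * exp (2 * k * T)) * ?J t)"
    proof (rule integral_norm_bound_integral)
      have "continuous_on {0..T} (\<lambda>t. exp (of_real k * of_real t) * u t)"
        by (intro continuous_intros uc)
      from absolutely_integrable_continuous_mult[OF this of_real_abs_int[OF q]]
      show "(\<lambda>t. of_real (q t) * (exp (of_real k * of_real t) * u t)) integrable_on {0..T}"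
        by (auto dest: set_lebesgue_integral_eq_integral(1) simp: mult.commute)
      show "(\<lambda>t. (2 * N * exp (2 * k * T)) * ?J t) integrable_on {0..T}"
        by (rule integrable_on_mult_right[OF Ji])
      fix t assume t: "t \<in> {0..T}"
      have "norm (of_real (q t) * (exp (of_real k * of_real t) * u t)) = \<bar>q t\<bar> * exp (k * t) * norm (u t)"
        by (simp add: norm_mult)
      also have "\<dots> \<le> \<bar>q t\<bar> * exp (k * t) * (2 * N * exp (k * t))"
        by (rule mult_left_mono[OF ub[OF t]]) simp
      also have "\<dots> = 2 * N * \<bar>q t\<bar> * exp (k * t + k * t)" unfolding exp_add by (simp add: mult_ac)
      also have "k * t + k * t = 2 * k * T + - 2 * k * (T - t)" by (simp add: algebra_simps)
      also have "2 * N * \<bar>q t\<bar> * exp \<dots> = (2 * N * exp (2 * k * T)) * ?J t"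
        unfolding exp_add by (simp add: mult_ac)
      finally show "norm (of_real (q t) * (exp (of_real k * of_real t) * u t)) \<le> (2 * N * exp (2 * k * T)) * ?J t" .
    qed
    then have I: "norm ?I \<le> 2 * N * exp (2 * k * T) * integral {0..T} ?J" by simp
    have "norm (u' 0 - of_real k * u 0) \<le> norm (u' 0) + k * norm (u 0)"
      using norm_triangle_ineq4[of "u' 0" "of_real k * u 0"] k by (simp add: norm_mult)
    also have "\<dots> \<le> k * N" using mult_left_mono[OF N, of k] k by (simp add: distrib_left)
    finally have "norm (exp (of_real k * of_real T) * (u' T - of_real k * u T))
        \<le> k * N + 2 * N * exp (2 * k * T) * integral {0..T} ?J"
      unfolding V using I norm_triangle_ineq[of "u' 0 - of_real k * u 0" ?I] by linarith
    then have "exp (- 2 * k * T) * norm (exp (of_real k * of_real T) * (u' T - of_real k * u T))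
        \<le> exp (- 2 * k * T) * (k * N + 2 * N * exp (2 * k * T) * integral {0..T} ?J)"
      by (rule mult_left_mono) simp
    also have "exp (- 2 * k * T) * norm (exp (of_real k * of_real T) * (u' T - of_real k * u T))
      = (exp (- 2 * k * T) * exp (k * T)) * norm (u' T - of_real k * u T)" by (simp add: norm_mult)
    also have "\<dots> = norm (exp (- of_real k * of_real T) * (u' T - of_real k * u T))"
      unfolding exp_add[symmetric] by (simp add: norm_mult)
    also have "exp (- 2 * k * T) * (k * N + 2 * N * exp (2 * k * T) * integral {0..T} ?J)
       = exp (- 2 * k * T) * (k * N) + 2 * N * (exp (- 2 * k * T) * exp (2 * k * T)) * integral {0..T} ?J"
      by (simp add: algebra_simps)
    also have "\<dots> = exp (- 2 * k * T) * (k * N) + 2 * N * integral {0..T} ?J"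
      unfolding exp_add[symmetric] by simp
    finally show ?thesis .
  qed
qed

text \<open>Of the data, only the limit \<open>c\<close> of the dominant combination over
  \<open>k\<close> enters; the rest merely has to stay bounded, with \<open>v'\<close> allowed to
  grow like \<open>k\<close>. The \<open>1 / 2\<close> comes from
  \<open>2 * k * v = (v' + k * v) - (v' - k * v)\<close>.\<close>

lemma schr_sol_asymptotics:
  fixes v v' :: "real \<Rightarrow> real \<Rightarrow> complex"
  assumes q: "q absolutely_integrable_on {0..T}" and T: "0 < T"
    and sol: "\<forall>\<^sub>F k in at_top. schr_sol q ((of_real k)\<^sup>2) 0 T (v k) (v' k)"
    and bnd: "\<forall>\<^sub>F k in at_top. norm (v k 0) + norm (v' k 0) / k \<le> N"
    and lim: "((\<lambda>k. v k 0 + v' k 0 / of_real k) \<longlongrightarrow> c) at_top"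
  shows "((\<lambda>k. exp (- of_real k * of_real T) * v k T) \<longlongrightarrow> c / 2) at_top" (is ?A)
    and "((\<lambda>k. exp (- of_real k * of_real T) * (v' k T - of_real k * v k T)) \<longlongrightarrow> 0) at_top" (is ?B)
proof -
  let ?Q = "l1_norm q T"
  have large: "\<forall>\<^sub>F k in at_top. 2 * ?Q \<le> k \<and> 0 < k"
    by (intro eventually_conj eventually_ge_at_top eventually_gt_at_top)
  have S: "\<forall>\<^sub>F k in at_top. norm (exp (- of_real k * of_real T) * (v' k T - of_real k * v k T))
       \<le> exp (- 2 * k * T) * (k * N) + 2 * N * integral {0..T} (\<lambda>t. \<bar>q t\<bar> * exp (- 2 * k * (T - t)))"
    using large sol bnd by eventually_elim (rule schr_sol_real_estimates(2); use q T in auto)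
  have "((\<lambda>k. exp (- 2 * k * T) * (k * N)) \<longlongrightarrow> 0) at_top" using T by real_asymp
  from tendsto_add[OF this tendsto_mult_right_zero[OF exp_weighted_integral_tendsto_0[OF q], of "2 * N"]]
  have "((\<lambda>k. exp (- 2 * k * T) * (k * N) + 2 * N * integral {0..T} (\<lambda>t. \<bar>q t\<bar> * exp (- 2 * k * (T - t)))) \<longlongrightarrow> 0) at_top"
    by simp
  from Lim_null_comparison[OF S this] show B: ?B .
  have "((\<lambda>k. exp (- of_real k * of_real T) * (v' k T + of_real k * v k T) / of_real k
            - (v k 0 + v' k 0 / of_real k)) \<longlongrightarrow> 0) at_top"
  proof (rule Lim_null_comparison)
    show "\<forall>\<^sub>F k in at_top. norm (exp (- of_real k * of_real T) * (v' k T + of_real k * v k T) / of_real k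
            - (v k 0 + v' k 0 / of_real k)) \<le> ?Q * (2 * N) / k" using large sol bnd
    proof eventually_elim
      case (elim k)
      have "norm (exp (- of_real k * of_real T) * (v' k T + of_real k * v k T) - (v' k 0 + of_real k * v k 0)) / k
         \<le> ?Q * (2 * N) / k"
        by (intro divide_right_mono schr_sol_real_estimates(1)) (use q T elim in auto)
      also have "norm (exp (- of_real k * of_real T) * (v' k T + of_real k * v k T) - (v' k 0 + of_real k * v k 0)) / k
        = norm ((exp (- of_real k * of_real T) * (v' k T + of_real k * v k T) - (v' k 0 + of_real k * v k 0)) / of_real k)"
        using elim by (simp add: norm_divide)
      finally show ?case using elim by (simp add: diff_divide_distrib add_divide_distrib add.commute)
    qed
    show "((\<lambda>k. ?Q * (2 * N) / k) \<longlongrightarrow> 0) at_top"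
      by (intro tendsto_divide_0[OF tendsto_const] filterlim_at_top_imp_at_infinity filterlim_ident)
  qed
  from tendsto_add[OF this lim]
  have P: "((\<lambda>k. exp (- of_real k * of_real T) * (v' k T + of_real k * v k T) / of_real k) \<longlongrightarrow> c) at_top"
    by simp
  have "((\<lambda>k. exp (- of_real k * of_real T) * (v' k T - of_real k * v k T) * of_real (1 / k)) \<longlongrightarrow> 0 * of_real 0) at_top"
    by (intro tendsto_mult B tendsto_of_real) real_asymp
  from tendsto_divide[OF tendsto_diff[OF P this] tendsto_const[of 2]]
  have "((\<lambda>k. (exp (- of_real k * of_real T) * (v' k T + of_real k * v k T) / of_real k
     - exp (- of_real k * of_real T) * (v' k T - of_real k * v k T) * of_real (1 / k)) / 2) \<longlongrightarrow> c / 2) at_top"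
    by simp
  moreover have "\<forall>\<^sub>F k in at_top. (exp (- of_real k * of_real T) * (v' k T + of_real k * v k T) / of_real k
     - exp (- of_real k * of_real T) * (v' k T - of_real k * v k T) * of_real (1 / k)) / 2
     = exp (- of_real k * of_real T) * v k T" using eventually_gt_at_top[of 0]
  proof eventually_elim
    case (elim k)
    then have "complex_of_real k \<noteq> 0" by simp
    then show ?case by (simp add: field_simps)
  qed
  ultimately show ?A by (rule Lim_transform_eventually)
qed


section \<open>Growing and decaying solutions on the half-line\<close>

text \<open>The bounded function \<open>H\<close> absorbs the negative part of \<open>q\<close>: as long as \<open>y \<ge> 0\<close>, the function
  \<open>(y' - (H + 1) y) E\<close> with \<open>E' = (H + 1) E\<close> is increasing.\<close>

lemma positive_growth:
  fixes y y' q H A :: "real \<Rightarrow> real"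
  assumes y: "ac_deriv a r y y'" and y': "ac_deriv a r y' (\<lambda>t. (q t + k) * y t)"
    and H: "ac_deriv a r H (\<lambda>x. A x - max (- q x) 0)"
    and HK: "\<And>x. a \<le> x \<Longrightarrow> A x \<le> K" "\<And>x. a \<le> x \<Longrightarrow> 0 \<le> H x" "\<And>x. a \<le> x \<Longrightarrow> H x \<le> K"
    and k: "K + (K + 1)\<^sup>2 \<le> k" and ya: "0 < y a" "(H a + 1) * y a \<le> y' a"
    and x: "a \<le> x" "x \<le> r"
  shows "0 < y x" "y x \<le> y' x"
proof -
  have yc: "continuous_on {a..r} y" and Hc: "continuous_on {a..r} H"
    by (rule ac_deriv_continuous[OF y], rule ac_deriv_continuous[OF H])
  define P where "P x = integral {a..x} (\<lambda>t. H t + 1)" for x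
  define E where "E x = exp (P x)" for x
  define F where "F x = y' x - (H x + 1) * y x" for x
  have P: "(P has_real_derivative H x + 1) (at x within {a..r})" if "x \<in> {a..r}" for x
    unfolding P_def has_real_derivative_iff_has_vector_derivative
    by (intro integral_has_vector_derivative continuous_intros Hc that)
  have Pc: "continuous_on {a..r} P" using P by (intro DERIV_continuous_on)
  have E: "ac_deriv a r E (\<lambda>x. E x * (H x + 1))"
  proof (rule ac_deriv_C1)
    fix x assume x: "x \<in> {a..r}"
    show "(E has_vector_derivative E x * (H x + 1)) (at x within {a..r})"
      unfolding E_def has_real_derivative_iff_has_vector_derivative[symmetric]
      by (rule DERIV_chain2[OF DERIV_exp P[OF x]])
  next
    show "continuous_on {a..r} (\<lambda>x. E x * (H x + 1))"
      unfolding E_def by (intro continuous_intros Pc Hc)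
  qed
  have H1: "ac_deriv a r (\<lambda>x. H x + 1) (\<lambda>x. A x - max (- q x) 0)"
    using ac_deriv_add[OF H ac_deriv_const[of a r 1]] by simp
  \<comment> \<open>In the bracket \<open>q + max (- q) 0\<close> is nonnegative and
    \<open>A + (H + 1)\<^sup>2\<close> is at most \<open>K + (K + 1)\<^sup>2\<close>; this is the
    origin of the lower bound on \<open>k\<close>.\<close>
  have FE: "ac_deriv a r (\<lambda>x. F x * E x)
     (\<lambda>x. E x * y x * (q x + max (- q x) 0 + k - A x - (H x + 1)\<^sup>2))" unfolding F_def
    by (rule ac_deriv_cong[OF ac_deriv_mult[OF ac_deriv_diff[OF y' ac_deriv_mult[OF H1 y]] E]])
       (auto simp: algebra_simps power2_eq_square)
  have grow: "y z \<le> y' z" if z: "a \<le> z" "z \<le> r" and pos: "\<And>t. a \<le> t \<Longrightarrow> t \<le> z \<Longrightarrow> 0 \<le> y t" for z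
  proof -
    have "F a * E a \<le> F z * E z"
    proof (rule ac_deriv_mono[OF ac_deriv_subinterval[OF FE order_refl z(2)]])
      fix t assume t: "a \<le> t" "t \<le> z"
      have "(H t + 1)\<^sup>2 \<le> (K + 1)\<^sup>2" using HK[OF t(1)] by (intro power_mono) auto
      then have "0 \<le> q t + max (- q t) 0 + k - A t - (H t + 1)\<^sup>2" using k HK(1)[OF t(1)] by linarith
      then show "0 \<le> E t * y t * (q t + max (- q t) 0 + k - A t - (H t + 1)\<^sup>2)"
        using pos[OF t] by (simp add: E_def)
    qed (use z in auto)
    moreover have "0 \<le> F a * E a" using ya by (simp add: F_def E_def)
    ultimately have "0 \<le> F z * E z" by linarith
    then have "0 \<le> F z" by (simp add: E_def zero_le_mult_iff)
    moreover have "1 * y z \<le> (H z + 1) * y z"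
      using HK[OF z(1)] pos[of z] z by (intro mult_right_mono) auto
    ultimately show ?thesis by (simp add: F_def)
  qed
  have pos: "0 < y z" if z: "a \<le> z" "z \<le> r" for z
  proof (rule ccontr)
    assume "\<not> 0 < y z"
    \<comment> \<open>Up to the first zero \<open>m\<close> of \<open>y\<close> the function is
      nonnegative, so \<open>grow\<close> gives \<open>y' \<ge> y \<ge> 0\<close> there and
      \<open>y\<close> cannot have come down from \<open>y a > 0\<close> to 0.\<close>
    define Z where "Z = {t \<in> {a..z}. y t = 0}"
    have ycz: "continuous_on {a..z} y" by (rule continuous_on_subset[OF yc]) (use z in auto)
    have "\<exists>t. a \<le> t \<and> t \<le> z \<and> y t = 0"
      by (rule IVT2'[of y z 0 a]) (use \<open>\<not> 0 < y z\<close> ya z ycz in auto)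
    then have "Z \<noteq> {}" by (auto simp: Z_def)
    moreover have "closed Z"
      unfolding Z_def by (rule continuous_closed_preimage_constant[OF ycz]) simp
    then have "compact (Z \<inter> {a..z})" by (rule closed_Int_compact[OF _ compact_Icc])
    moreover have "Z \<inter> {a..z} = Z" by (auto simp: Z_def)
    ultimately have "compact Z" "Z \<noteq> {}" by simp_all
    from compact_attains_inf[OF this]
    obtain m where m: "m \<in> Z" and mm: "\<And>t. t \<in> Z \<Longrightarrow> m \<le> t" by blast
    have mz: "a \<le> m" "m \<le> z" "y m = 0" using m by (auto simp: Z_def)
    have nn: "0 \<le> y t" if t: "a \<le> t" "t \<le> m" for t
    proof (rule ccontr)
      assume "\<not> 0 \<le> y t"
      then have "\<exists>s. a \<le> s \<and> s \<le> t \<and> y s = 0"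
        by (intro IVT2'[of y t 0 a]) (use ya t mz continuous_on_subset[OF ycz, of "{a..t}"] in auto)
      then obtain s where s: "a \<le> s" "s \<le> t" "y s = 0" by blast
      then have "m \<le> s" using mm[of s] t mz by (auto simp: Z_def)
      with s t have "s = t" by simp
      with s \<open>\<not> 0 \<le> y t\<close> show False by simp
    qed
    have "y a \<le> y m"
    proof (rule ac_deriv_mono[OF ac_deriv_subinterval[OF y order_refl, of m]])
      fix t assume t: "a \<le> t" "t \<le> m"
      then show "0 \<le> y' t" using grow[of t] nn[of t] nn mz z by force
    qed (use mz z in auto)
    with mz ya show False by simp
  qed
  show "0 < y x" using pos x by simp
  show "y x \<le> y' x" by (rule grow[OF x]) (use pos x in \<open>auto intro: less_imp_le\<close>)
qed

lemma growth_exp: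
  fixes y y' :: "real \<Rightarrow> real"
  assumes y: "ac_deriv a r y y'" and ge: "\<And>t. a \<le> t \<Longrightarrow> t \<le> r \<Longrightarrow> y t \<le> y' t" and "a \<le> r"
  shows "y a * exp (r - a) \<le> y r"
proof -
  have e: "ac_deriv a r (\<lambda>x. exp (- x)) (\<lambda>x. - exp (- x :: real))"
  proof (rule ac_deriv_C1)
    show "((\<lambda>x. exp (- x)) has_vector_derivative - exp (- x)) (at x within {a..r})" for x :: real
      unfolding has_real_derivative_iff_has_vector_derivative[symmetric] by (auto intro!: derivative_eq_intros)
  qed (intro continuous_intros)
  have "y a * exp (- a) \<le> y r * exp (- r)"
  proof (rule ac_deriv_mono[OF ac_deriv_mult[OF y e]])
    fix t assume "a \<le> t" "t \<le> r"
    then have "0 \<le> (y' t - y t) * exp (- t)" using ge by simp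
    then show "0 \<le> y' t * exp (- t) + y t * - exp (- t)" by (simp add: algebra_simps)
  qed (use assms in auto)
  from mult_right_mono[OF this, of "exp r"] show ?thesis by (simp add: mult.assoc flip: exp_add)
qed


text \<open>Reduction of order: \<open>\<psi>(x)\<close> is \<open>y(x)\<close> times the integral of \<open>1 / y\<^sup>2\<close> over \<open>(x, \<infinity>)\<close> for a growing solution
  \<open>y\<close>. The bound on \<open>\<psi>'\<close> holds since otherwise \<open>\<psi>\<close> would grow as well.\<close>

lemma decaying_solution:
  fixes q H A :: "real \<Rightarrow> real"
  assumes q: "\<And>R. q absolutely_integrable_on {0..R}"
    and H: "\<And>a r. 0 \<le> a \<Longrightarrow> ac_deriv a r H (\<lambda>x. A x - max (- q x) 0)"
    and HK: "\<And>x. 0 \<le> x \<Longrightarrow> A x \<le> K" "\<And>x. 0 \<le> x \<Longrightarrow> 0 \<le> H x" "\<And>x. 0 \<le> x \<Longrightarrow> H x \<le> K"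
    and k: "K + (K + 1)\<^sup>2 \<le> k"
  obtains y y' \<psi> \<psi>' where
    "\<And>R. ac_deriv 0 R y y'" "\<And>R. ac_deriv 0 R y' (\<lambda>t. (q t + k) * y t)"
    "\<And>R. ac_deriv 0 R \<psi> \<psi>'" "\<And>R. ac_deriv 0 R \<psi>' (\<lambda>t. (q t + k) * \<psi> t)"
    "\<And>x. 0 \<le> x \<Longrightarrow> exp x \<le> y x" "\<And>x. 0 \<le> x \<Longrightarrow> 0 < \<psi> x"
    "\<And>x. 0 \<le> x \<Longrightarrow> \<psi> x \<le> exp (- x)" "\<And>x. 0 \<le> x \<Longrightarrow> \<psi>' x \<le> (K + 1) * \<psi> x"
    "y 0 * \<psi>' 0 - y' 0 * \<psi> 0 = - 1"
proof -
  \<comment> \<open>The slope \<open>K + 1\<close> at 0 is at least \<open>H 0 + 1\<close>, as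
    \<open>positive_growth\<close> demands of the data. Real parts are taken since
    \<open>schr_u\<close> is complex-valued.\<close>
  define y where "y x = Re (schr_u q (of_real k) 1 (of_real (K + 1)) x)" for x
  define y' where "y' x = Re (schr_u' q (of_real k) 1 (of_real (K + 1)) x)" for x
  have y0: "y 0 = 1" "y' 0 = K + 1" by (simp_all add: y_def y'_def)
  have yy: "ac_deriv 0 R y y'" and yy': "ac_deriv 0 R y' (\<lambda>t. (q t + k) * y t)" for R
  proof -
    have "schr_sol q (of_real k) 0 (max 0 R) (schr_u q (of_real k) 1 (of_real (K + 1))) (schr_u' q (of_real k) 1 (of_real (K + 1)))"
      by (rule schr_u_sol[OF q]) simp
    then have "schr_sol q (of_real k) 0 R (schr_u q (of_real k) 1 (of_real (K + 1))) (schr_u' q (of_real k) 1 (of_real (K + 1)))"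
      by (rule schr_sol_subinterval) auto
    then have L: "ac_deriv 0 R (schr_u q (of_real k) 1 (of_real (K + 1))) (schr_u' q (of_real k) 1 (of_real (K + 1)))"
      "ac_deriv 0 R (schr_u' q (of_real k) 1 (of_real (K + 1)))
        (\<lambda>t. (of_real (q t) + of_real k) * schr_u q (of_real k) 1 (of_real (K + 1)) t)"
      unfolding schr_sol_def by auto
    from ac_deriv_linear[OF L(1) bounded_linear_Re] show "ac_deriv 0 R y y'"
      by (simp add: y_def[abs_def] y'_def[abs_def])
    from ac_deriv_linear[OF L(2) bounded_linear_Re] show "ac_deriv 0 R y' (\<lambda>t. (q t + k) * y t)"
      by (simp add: y_def[abs_def] y'_def[abs_def])
  qed
  have y: "0 < y x" "y x \<le> y' x" if "0 \<le> x" for x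
    using positive_growth[OF yy yy' H[OF order_refl] HK(1-3) k, of x x] that y0 HK(3)[of 0] by auto
  have yexp: "y a * exp (b - a) \<le> y b" if "0 \<le> a" "a \<le> b" for a b
    by (rule growth_exp[OF ac_deriv_subinterval[OF yy[of b] that(1) order_refl]]) (use y that in auto)
  have ymono: "y a \<le> y b" if "0 \<le> a" "a \<le> b" for a b
  proof -
    have "y a * 1 \<le> y a * exp (b - a)" using y(1)[OF that(1)] that by (intro mult_left_mono) auto
    with yexp[OF that] show ?thesis by linarith
  qed
  have yge: "exp x \<le> y x" if "0 \<le> x" for x using yexp[of 0 x] that y0 by simp
  have yc: "continuous_on {0..R} y" and y'c: "continuous_on {0..R} y'" for R
    by (rule ac_deriv_continuous[OF yy], rule ac_deriv_continuous[OF yy'])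
  have yd: "(y has_real_derivative y' x) (at x within {0..R})" if "x \<in> {0..R}" for x R
    unfolding has_real_derivative_iff_has_vector_derivative
    by (rule ac_deriv_vector_derivative[OF yy y'c that])
  have nz: "y x \<noteq> 0" if "0 \<le> x" for x using y(1)[OF that] by simp
  have inv1: "ac_deriv 0 R (\<lambda>x. inverse (y x)) (\<lambda>x. - (y' x / (y x)\<^sup>2))" for R
  proof (rule ac_deriv_C1)
    fix x assume x: "x \<in> {0..R}"
    then show "((\<lambda>x. inverse (y x)) has_vector_derivative - (y' x / (y x)\<^sup>2)) (at x within {0..R})"
      unfolding has_real_derivative_iff_has_vector_derivative[symmetric]
      using nz by (auto intro!: derivative_eq_intros yd simp: power2_eq_square divide_simps)
  next
    show "continuous_on {0..R} (\<lambda>x. - (y' x / (y x)\<^sup>2))"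
      using nz by (intro continuous_intros yc y'c) auto
  qed
  define J where "J x = integral {0..x} (\<lambda>t. inverse (y t) ^ 2)" for x
  have J: "ac_deriv 0 R J (\<lambda>t. inverse (y t) ^ 2)" for R unfolding J_def using nz
    by (intro ac_deriv_integral_left absolutely_integrable_continuous_real continuous_intros yc) auto
  have inv2: "ac_deriv 0 R (\<lambda>x. inverse (y x) ^ 2) (\<lambda>x. - 2 * y' x * inverse (y x) ^ 3)" for R
    unfolding power2_eq_square by (rule ac_deriv_cong[OF ac_deriv_mult[OF inv1 inv1]])
       (use nz in \<open>auto simp: power2_eq_square power3_eq_cube divide_simps\<close>)
  \<comment> \<open>From \<open>y' \<ge> y\<close> the derivative of
    \<open>inverse (y x) ^ 2 / 2\<close> is at most \<open>- (inverse (y x) ^ 2)\<close>, so this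
    function plus \<open>J\<close> decreases.\<close>
  have Jbound: "J b - J a \<le> inverse (y a) ^ 2 / 2" if ab: "0 \<le> a" "a \<le> b" for a b
  proof -
    have "ac_deriv 0 b (\<lambda>x. - (J x) - inverse (y x) ^ 2 * (1 / 2)) (\<lambda>x. - (inverse (y x) ^ 2) - (- 2 * y' x * inverse (y x) ^ 3) * (1 / 2))"
      by (intro ac_deriv_diff ac_deriv_minus J ac_deriv_linear[OF inv2 bounded_linear_mult_left])
    then have "- (J a) - inverse (y a) ^ 2 * (1 / 2) \<le> - (J b) - inverse (y b) ^ 2 * (1 / 2)"
    proof (rule ac_deriv_mono)
      fix x assume x: "0 \<le> x" "x \<le> b"
      have "inverse (y x) ^ 3 * y x \<le> inverse (y x) ^ 3 * y' x"
        using y[OF x(1)] by (intro mult_left_mono) auto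
      also have "inverse (y x) ^ 3 * y x = inverse (y x) ^ 2"
        using nz[OF x(1)] by (simp add: power2_eq_square power3_eq_cube)
      finally show "0 \<le> - (inverse (y x) ^ 2) - (- 2 * y' x * inverse (y x) ^ 3) * (1 / 2)"
        by (simp add: mult_ac)
    qed (use ab in auto)
    moreover have "0 \<le> inverse (y b) ^ 2" by simp
    ultimately show ?thesis by linarith
  qed
  \<comment> \<open>A quantitative increase of \<open>J\<close> is needed for the strict positivity
    of the tail integral \<open>I\<close>, hence of \<open>\<psi>\<close>.\<close>
  have Jlow: "inverse (y (a + 1)) ^ 2 \<le> J (a + 1) - J a" if a: "0 \<le> a" for a
  proof -
    have "((\<lambda>t. inverse (y (a + 1)) ^ 2) has_integral inverse (y (a + 1)) ^ 2) {a..a + 1}"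
      using has_integral_const_real[of "inverse (y (a + 1)) ^ 2" a "a + 1"] by simp
    then show ?thesis
    proof (rule has_integral_le)
      show "((\<lambda>t. inverse (y t) ^ 2) has_integral J (a + 1) - J a) {a..a + 1}"
        by (rule ac_deriv_has_integral[OF J[of "a + 1"]]) (use a in auto)
      show "inverse (y (a + 1)) ^ 2 \<le> inverse (y t) ^ 2" if "t \<in> {a..a + 1}" for t
        using that a y(1)[of t] y(1)[of "a + 1"] ymono[of t "a + 1"]
        by (intro power_mono le_imp_inverse_le) auto
    qed
  qed
  have Jmono: "J a \<le> J b" if "0 \<le> a" "a \<le> b" for a b
    by (rule ac_deriv_mono[OF J[of b]]) (use that in auto)
  have bdd: "bdd_above (J ` {0..})"
  proof (rule bdd_aboveI2)
    show "J x \<le> J 0 + inverse (y 0) ^ 2 / 2" if "x \<in> {0..}" for x using Jbound[of 0 x] that by simp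
  qed
  \<comment> \<open>The integral of \<open>1 / y\<^sup>2\<close> over
    \<open>(x, \<infinity>)\<close>, written as the supremum of a bounded increasing function minus
    its value.\<close>
  define I where "I x = Sup (J ` {0..}) - J x" for x
  have Ipos: "0 < I x" if "0 \<le> x" for x
  proof -
    have "0 < inverse (y (x + 1)) ^ 2" using y(1)[of "x + 1"] that by simp
    also have "\<dots> \<le> J (x + 1) - J x" by (rule Jlow[OF that])
    also have "J (x + 1) \<le> Sup (J ` {0..})" by (rule cSUP_upper[OF _ bdd]) (use that in auto)
    finally show ?thesis by (simp add: I_def)
  qed
  have Ile: "I x \<le> inverse (y x) ^ 2 / 2" if "0 \<le> x" for x
  proof -
    have "Sup (J ` {0..}) \<le> J x + inverse (y x) ^ 2 / 2"
    proof (rule cSUP_least)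
      fix t :: real assume "t \<in> {0..}"
      then show "J t \<le> J x + inverse (y x) ^ 2 / 2"
        using Jbound[of x t] Jmono[of t x] that by (cases "x \<le> t") (auto simp: add_increasing2)
    qed auto
    then show ?thesis by (simp add: I_def)
  qed
  have I: "ac_deriv 0 R I (\<lambda>t. - (inverse (y t) ^ 2))" for R
    unfolding I_def using ac_deriv_diff[OF ac_deriv_const[of 0 R "Sup (J ` {0..})"] J[of R]] by simp
  define \<psi> where "\<psi> x = y x * I x" for x
  define \<psi>' where "\<psi>' x = y' x * I x - inverse (y x)" for x
  have \<psi>: "ac_deriv 0 R \<psi> \<psi>'" for R unfolding \<psi>_def \<psi>'_def
    by (rule ac_deriv_cong[OF ac_deriv_mult[OF yy I]]) (use nz in \<open>auto simp: power2_eq_square\<close>)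
  have \<psi>': "ac_deriv 0 R \<psi>' (\<lambda>t. (q t + k) * \<psi> t)" for R unfolding \<psi>_def \<psi>'_def
    by (rule ac_deriv_cong[OF ac_deriv_diff[OF ac_deriv_mult[OF yy' I] inv1]])
       (use nz in \<open>auto simp: power2_eq_square divide_simps\<close>)
  have \<psi>pos: "0 < \<psi> x" if "0 \<le> x" for x using y(1) Ipos that by (simp add: \<psi>_def)
  have \<psi>le: "\<psi> x \<le> exp (- x)" if x: "0 \<le> x" for x
  proof -
    have "\<psi> x \<le> y x * (inverse (y x) ^ 2 / 2)"
      unfolding \<psi>_def using Ile[OF x] y(1)[OF x] by (intro mult_left_mono) auto
    also have "\<dots> = inverse (y x) / 2" using nz[OF x] by (simp add: power2_eq_square)
    also have "\<dots> \<le> inverse (y x)" using y(1)[OF x] by simp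
    also have "\<dots> \<le> inverse (exp x)" using yge[OF x] by (intro le_imp_inverse_le) auto
    finally show ?thesis by (simp add: exp_minus)
  qed
  have \<psi>'le: "\<psi>' x \<le> (K + 1) * \<psi> x" if x: "0 \<le> x" for x
  proof (rule ccontr)
    assume "\<not> \<psi>' x \<le> (K + 1) * \<psi> x"
    moreover have "(H x + 1) * \<psi> x \<le> (K + 1) * \<psi> x"
      using HK(3)[OF x] \<psi>pos[OF x] by (intro mult_right_mono) auto
    ultimately have st: "(H x + 1) * \<psi> x \<le> \<psi>' x" by simp
    have "\<psi> x \<le> exp (- R)" if R: "x \<le> R" for R
    proof -
      have G: "\<psi> t \<le> \<psi>' t" if "x \<le> t" "t \<le> R" for t
        using positive_growth(2)[OF ac_deriv_subinterval[OF \<psi>[of R] x order_refl]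
            ac_deriv_subinterval[OF \<psi>'[of R] x order_refl] H[OF x] HK(1-3) k \<psi>pos[OF x] st, of t]
          that x by simp
      have "\<psi> x * exp (R - x) \<le> \<psi> R"
        by (rule growth_exp[OF ac_deriv_subinterval[OF \<psi>[of R] x order_refl] G R])
      moreover have "\<psi> x * 1 \<le> \<psi> x * exp (R - x)" using R \<psi>pos[OF x] by (intro mult_left_mono) auto
      ultimately show ?thesis using \<psi>le[of R] x R by simp
    qed
    then have "\<forall>\<^sub>F R in at_top. \<psi> x \<le> exp (- R)" by (rule eventually_at_top_linorderI)
    moreover have "((\<lambda>R::real. exp (- R)) \<longlongrightarrow> 0) at_top" by real_asymp
    ultimately have "\<psi> x \<le> 0" by (intro tendsto_lowerbound[of "\<lambda>R. exp (- R)"]) auto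
    with \<psi>pos[OF x] show False by simp
  qed
  show ?thesis
    by (rule that[OF yy yy' \<psi> \<psi>' yge \<psi>pos \<psi>le \<psi>'le]) (use y0 in \<open>auto simp: \<psi>_def \<psi>'_def\<close>)
qed

section \<open>Weyl solutions\<close>

lemma is_potential_abs_int:
  assumes "is_potential q b h" "ereal R \<le> b"
  shows "q absolutely_integrable_on {0..R}"
proof (cases b)
  case (real B)
  then have "q absolutely_integrable_on {0<..<B}" using assms(1) by (simp add: is_potential_def)
  moreover have "negligible {x \<in> {0<..<B} - {0..B}. q x \<noteq> 0}"
    by (rule negligible_subset[of "{}"]) auto
  moreover have "negligible {x \<in> {0..B} - {0<..<B}. q x \<noteq> 0}"
    by (rule negligible_subset[of "{0, B}"]) auto
  ultimately have "q absolutely_integrable_on {0..B}"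
    using absolutely_integrable_spike_set_eq by blast
  then show ?thesis by (rule absolutely_integrable_on_subinterval) (use assms(2) real in auto)
next
  case PInf
  then have 1: "q absolutely_integrable_on {y..y + 1}" if "0 \<le> y" for y
    using assms(1) that by (simp add: is_potential_def)
  have *: "q absolutely_integrable_on {0..real n}" for n
  proof (induction n)
    case 0
    show ?case using integrable_on_refl[of q 0] integrable_on_refl[of "\<lambda>x. norm (q x)" 0]
      by (simp add: absolutely_integrable_on_def)
  next
    case (Suc n)
    show ?case
      using absolutely_integrable_on_combine[OF Suc 1[of "real n"]] by (simp add: add.commute)
  qed
  obtain n where n: "R \<le> real n" using real_arch_simple by blast
  show ?thesis by (rule absolutely_integrable_on_subinterval[OF *[of n]]) (use n in auto)
next
  case MInf
  then show ?thesis using assms(1) by (simp add: is_potential_def)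
qed

text \<open>\<open>solves_schroedinger\<close> speaks of gauge integrals only. Absolute
  integrability of \<open>(q - z) * u\<close> is recovered from that of \<open>q\<close> and the
  continuity of \<open>u\<close>.\<close>

lemma solves_imp_schr_sol:
  assumes q: "is_potential q b h" and s: "solves_schroedinger q b z u u'" and R: "ereal R \<le> b"
  shows "schr_sol q (- z) 0 R u u'"
proof -
  define I where "I = {x. 0 \<le> x \<and> ereal x \<le> b}"
  have sub: "{0..R} \<subseteq> I" using R by (auto simp: I_def intro: order_trans[of _ "ereal R"])
  have d: "(u has_vector_derivative u' x) (at x within {0..R})" if "x \<in> {0..R}" for x
    using s sub that unfolding solves_schroedinger_def Let_def I_def[symmetric]
    by (blast intro: has_vector_derivative_within_subset)
  have h: "((\<lambda>t. (of_real (q t) - z) * u t) has_integral (u' y - u' x)) {x..y}"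
    if "0 \<le> x" "x \<le> y" "y \<le> R" for x y
    using s sub that unfolding solves_schroedinger_def Let_def I_def[symmetric]
    by (simp add: subset_eq)
  have uc: "continuous_on {0..R} u" unfolding continuous_on_eq_continuous_within
    using has_vector_derivative_continuous[OF d] by blast
  have "(\<lambda>t. (of_real (q t) + - z) * u t) absolutely_integrable_on {0..R}"
    by (rule potential_mult_abs_int[OF is_potential_abs_int[OF q R] uc])
  then have 1: "ac_deriv 0 R u' (\<lambda>t. (of_real (q t) + - z) * u t)"
    by (rule ac_derivI) (use h in simp)
  have "ac_deriv 0 R u u'" by (rule ac_deriv_C1[OF d ac_deriv_continuous[OF 1]])
  with 1 show ?thesis unfolding schr_sol_def by simp
qed

lemma schr_sol_imp_solves_finite:
  assumes "schr_sol q (- z) 0 b u u'"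
  shows "solves_schroedinger q (ereal b) z u u'"
proof -
  have I: "{x. 0 \<le> x \<and> ereal x \<le> ereal b} = {0..b}" by auto
  have 1: "ac_deriv 0 b u u'" and 2: "ac_deriv 0 b u' (\<lambda>t. (of_real (q t) - z) * u t)"
    using assms by (auto simp: schr_sol_def)
  show ?thesis unfolding solves_schroedinger_def Let_def I
    using ac_deriv_vector_derivative[OF 1 ac_deriv_continuous[OF 2]] ac_deriv_has_integral[OF 2]
    by simp
qed

lemma schr_sol_imp_solves_infinite:
  assumes "\<And>R. schr_sol q (- z) 0 R u u'"
  shows "solves_schroedinger q \<infinity> z u u'"
proof -
  have I: "{x. 0 \<le> x \<and> ereal x \<le> \<infinity>} = {0..}" by auto
  have 1: "ac_deriv 0 R u u'" and 2: "ac_deriv 0 R u' (\<lambda>t. (of_real (q t) - z) * u t)" for R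
    using assms by (auto simp: schr_sol_def)
  have "(u has_vector_derivative u' x) (at x within {0..})" if "0 \<le> x" for x
  proof -
    have "at x within {0..} = at x within {0..x + 1}"
      by (rule at_within_nhd[of _ "{..<x + 1}"]) auto
    then show ?thesis
      using ac_deriv_vector_derivative[OF 1 ac_deriv_continuous[OF 2], of x "x + 1"] that by simp
  qed
  moreover have "((\<lambda>t. (of_real (q t) - z) * u t) has_integral (u' y - u' x)) {x..y}" if "0 \<le> x" "x \<le> y" for x y
    by (rule ac_deriv_has_integral[OF 2]) (use that in auto)
  ultimately show ?thesis unfolding solves_schroedinger_def Let_def I by simp
qed

section \<open>Identification of the m-function\<close>

lemma m_function_eqI:
  assumes "weyl_solution q b h z u u'"
    and "\<And>v v'. weyl_solution q b h z v v' \<Longrightarrow> v' 0 / v 0 = u' 0 / u 0"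
  shows "m_function q b h z = u' 0 / u 0" unfolding m_function_def
proof (rule the_equality)
  show "\<exists>v v'. weyl_solution q b h z v v' \<and> u' 0 / u 0 = v' 0 / v 0" using assms(1) by blast
  show "m = u' 0 / u 0" if "\<exists>v v'. weyl_solution q b h z v v' \<and> m = v' 0 / v 0" for m
    using that assms(2) by blast
qed

text \<open>Two solutions with the same boundary condition have Wronskian 0 at \<open>b\<close>,
  hence at 0. One of them with \<open>u 0 \<noteq> 0\<close> thus fixes the quotient for all: a
  competitor with \<open>v 0 = 0\<close> would also have \<open>v' 0 = 0\<close> and vanish.
  Uniqueness is obtained at this \<open>z\<close> without spectral theory.\<close>

lemma m_function_finite_eq:
  assumes q: "is_potential q (ereal b) h" and u: "schr_sol q (- z) 0 b u u'" and u0: "u 0 \<noteq> 0"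
    and bc: "right_condition (ereal b) h u u'"
  shows "m_function q (ereal b) h z = u' 0 / u 0"
proof (rule m_function_eqI)
  have b: "0 < b" using q by (simp add: is_potential_def)
  show "weyl_solution q (ereal b) h z u u'"
    unfolding weyl_solution_def using schr_sol_imp_solves_finite[OF u] bc u0 b by auto
  fix v v' assume v: "weyl_solution q (ereal b) h z v v'"
  then have vs: "schr_sol q (- z) 0 b v v'"
    unfolding weyl_solution_def using solves_imp_schr_sol[OF q] by auto
  have "right_condition (ereal b) h v v'" using v by (simp add: weyl_solution_def)
  then have "u b * v' b - u' b * v b = 0"
    using bc by (auto simp: right_condition_def eq_neg_iff_add_eq_0[symmetric] split: if_splits)
  then have W: "u 0 * v' 0 = u' 0 * v 0" using schr_sol_wronskian[OF u vs, of b] b by simp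
  have "v 0 \<noteq> 0"
  proof
    assume v0: "v 0 = 0"
    with W u0 have "v' 0 = 0" by simp
    then have "v x = 0" if "0 \<le> x" "x \<le> b" for x
      using schr_sol_zero[OF vs is_potential_abs_int[OF q order_refl] v0 _ that] by simp
    moreover obtain x where "0 \<le> x" "ereal x \<le> ereal b" "v x \<noteq> 0"
      using v unfolding weyl_solution_def by blast
    ultimately show False by simp
  qed
  with W u0 show "v' 0 / v 0 = u' 0 / u 0" by (simp add: field_simps)
qed

text \<open>If \<open>G\<close> is a primitive of the negative part of \<open>q\<close>, then \<open>H\<close> is the mean of \<open>G\<close> over \<open>[x, x + 1]\<close>
  minus \<open>G(x)\<close>.\<close>

lemma negative_part_majorant:
  assumes q: "is_potential q \<infinity> h"
  obtains K H A where "\<And>a r. 0 \<le> a \<Longrightarrow> ac_deriv a r H (\<lambda>x. A x - max (- q x) (0::real))"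
    "\<And>x. 0 \<le> x \<Longrightarrow> A x \<le> K" "\<And>x. 0 \<le> x \<Longrightarrow> 0 \<le> H x" "\<And>x. 0 \<le> x \<Longrightarrow> H x \<le> K"
proof -
  define n where "n x = max (- q x) 0" for x
  have n: "n absolutely_integrable_on {0..R}" for R
  proof -
    have "(\<lambda>x. - q x) absolutely_integrable_on {0..R}"
      using absolutely_integrable_linear[OF is_potential_abs_int[OF q, of R]
          bounded_linear_minus[OF bounded_linear_ident]] by (simp add: o_def)
    then show ?thesis unfolding n_def[abs_def] by (intro absolutely_integrable_max_1) auto
  qed
  define G where "G x = integral {0..x} n" for x
  have G: "ac_deriv 0 R G n" for R unfolding G_def by (rule ac_deriv_integral_left[OF n])
  have Gm: "G x \<le> G y" if "0 \<le> x" "x \<le> y" for x y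
    by (rule ac_deriv_mono[OF G[of y]]) (use that in \<open>auto simp: n_def\<close>)
  obtain K0 where K0: "\<And>y. 0 < y \<Longrightarrow> integral {y..y + 1} n \<le> K0"
  proof -
    have "bdd_above ((\<lambda>y. integral {y..y + 1} n) ` {0<..})"
      using q by (simp add: is_potential_def n_def[abs_def])
    then obtain K0 where "\<And>z. z \<in> (\<lambda>y. integral {y..y + 1} n) ` {0<..} \<Longrightarrow> z \<le> K0"
      unfolding bdd_above_def by blast
    then show ?thesis by (intro that[of K0]) auto
  qed
  \<comment> \<open>The supremum in \<open>is_potential\<close> runs over \<open>y > 0\<close> only,
    so the interval \<open>{0..1}\<close> is added by hand.\<close>
  define K where "K = max K0 (integral {0..1} n)"
  define A where "A x = G (x + 1) - G x" for x
  have A: "A x \<le> K" if "0 \<le> x" for x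
  proof -
    have "A x = integral {x..x + 1} n"
      unfolding A_def by (rule ac_deriv_integral[OF G[of "x + 1"], symmetric]) (use that in auto)
    then show ?thesis using K0[of x] that by (cases "x = 0") (auto simp: K_def)
  qed
  define L where "L x = integral {0..x} G" for x
  have L: "ac_deriv 0 R L G" for R
    unfolding L_def by (intro ac_deriv_integral_left absolutely_integrable_continuous_real ac_deriv_continuous[OF G])
  define H where "H x = L (x + 1) - L x - G x" for x
  have Hd: "ac_deriv 0 r H (\<lambda>x. A x - n x)" for r
  proof -
    have "ac_deriv 0 r (\<lambda>x. L (x + 1)) (\<lambda>x. G (x + 1))"
    proof (rule ac_deriv_C1)
      fix x assume x: "x \<in> {0..r}"
      have "(L has_vector_derivative G (x + 1)) (at (x + 1) within {0..r + 1})"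
        by (rule ac_deriv_vector_derivative[OF L ac_deriv_continuous[OF G]]) (use x in auto)
      then show "((\<lambda>x. L (x + 1)) has_vector_derivative G (x + 1)) (at x within {0..r})"
      proof -
        assume L1: "(L has_vector_derivative G (x + 1)) (at (x + 1) within {0..r + 1})"
        have "((\<lambda>x. x + 1) has_vector_derivative 1) (at x within {0..r})"
          unfolding has_real_derivative_iff_has_vector_derivative[symmetric]
          by (auto intro!: derivative_eq_intros)
        moreover have "(L has_vector_derivative G (x + 1)) (at (x + 1) within (\<lambda>x. x + 1) ` {0..r})"
          by (rule has_vector_derivative_within_subset[OF L1]) auto
        ultimately show ?thesis
          using vector_diff_chain_within[of "\<lambda>x. x + 1" 1 x "{0..r}" L "G (x + 1)"] by (simp add: o_def)
      qed
    next
      show "continuous_on {0..r} (\<lambda>x. G (x + 1))"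
        by (rule continuous_on_compose2[OF ac_deriv_continuous[OF G[of "r + 1"]]]) (auto intro!: continuous_intros)
    qed
    from ac_deriv_diff[OF ac_deriv_diff[OF this L] G] show ?thesis unfolding H_def A_def by simp
  qed
  have HI: "((\<lambda>t. G t - G x) has_integral H x) {x..x + 1}" if "0 \<le> x" for x
  proof -
    have "(G has_integral (L (x + 1) - L x)) {x..x + 1}"
      by (rule ac_deriv_has_integral[OF L[of "x + 1"]]) (use that in auto)
    from has_integral_diff[OF this has_integral_const_real[of "G x" x "x + 1"]]
    show ?thesis by (simp add: H_def)
  qed
  show ?thesis
  proof (rule that)
    show "ac_deriv a r H (\<lambda>x. A x - max (- q x) 0)" if "0 \<le> a" for a r
      using ac_deriv_subinterval[OF Hd that order_refl] unfolding n_def .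
    show "A x \<le> K" if "0 \<le> x" for x by (rule A[OF that])
    show "0 \<le> H x" if "0 \<le> x" for x
      by (rule has_integral_nonneg[OF HI[OF that]]) (use Gm that in auto)
    show "H x \<le> K" if "0 \<le> x" for x
    proof -
      have "((\<lambda>t. A x) has_integral A x) {x..x + 1}"
        using has_integral_const_real[of "A x" x "x + 1"] by simp
      from has_integral_le[OF HI[OF that] this] have "H x \<le> A x" using Gm that by (auto simp: A_def)
      with A[OF that] show ?thesis by simp
    qed
  qed
qed

text \<open>Every solution is a combination \<open>a * y + c * \<psi>\<close>, and
  \<open>y x \<ge> exp x\<close> excludes \<open>a \<noteq> 0\<close> for square-integrable ones.
  The constant \<open>C\<close> does not depend on \<open>k\<close>, which later makes
  \<open>u' / k\<close> small against \<open>u\<close> from above.\<close>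

lemma weyl_solution_infinite:
  assumes q: "is_potential q \<infinity> h"
  shows "\<exists>C k0. \<forall>k\<ge>k0. \<exists>u u'. (\<forall>R. schr_sol q ((of_real k)\<^sup>2) 0 R u u')
      \<and> m_function q \<infinity> h (of_real (- (k\<^sup>2))) = u' 0 / u 0
      \<and> (\<forall>x\<ge>0. \<exists>u0 u1. u x = of_real u0 \<and> u' x = of_real u1 \<and> 0 < u0 \<and> u1 \<le> C * u0)"
proof (rule negative_part_majorant[OF q])
  fix K H A assume H: "\<And>a r. 0 \<le> a \<Longrightarrow> ac_deriv a r H (\<lambda>x. A x - max (- q x) (0::real))"
    and HK: "\<And>x. 0 \<le> x \<Longrightarrow> A x \<le> K" "\<And>x. 0 \<le> x \<Longrightarrow> 0 \<le> H x" "\<And>x. 0 \<le> x \<Longrightarrow> H x \<le> K"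
  have qi: "q absolutely_integrable_on {0..R}" for R by (rule is_potential_abs_int[OF q]) simp
  show ?thesis
  proof (rule exI[of _ "K + 1"], rule exI[of _ "K + (K + 1)\<^sup>2 + 1"], intro allI impI)
    fix k :: real assume k: "K + (K + 1)\<^sup>2 + 1 \<le> k"
    have "0 \<le> K" using HK(2,3)[of 0] by simp
    moreover have "0 \<le> (K + 1)\<^sup>2" by simp
    ultimately have "1 \<le> k" using k by linarith
    then have "k \<le> k\<^sup>2" by (simp add: power2_eq_square)
    then have kK: "K + (K + 1)\<^sup>2 \<le> k\<^sup>2" using k by simp
    show "\<exists>u u'. (\<forall>R. schr_sol q ((of_real k)\<^sup>2) 0 R u u')
      \<and> m_function q \<infinity> h (of_real (- (k\<^sup>2))) = u' 0 / u 0
      \<and> (\<forall>x\<ge>0. \<exists>u0 u1. u x = of_real u0 \<and> u' x = of_real u1 \<and> 0 < u0 \<and> u1 \<le> (K + 1) * u0)"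
    proof (rule decaying_solution[OF qi H HK kK])
    fix y y' \<psi> \<psi>' assume y: "\<And>R. ac_deriv 0 R y y'" "\<And>R. ac_deriv 0 R y' (\<lambda>t. (q t + k\<^sup>2) * y t)"
      and p: "\<And>R. ac_deriv 0 R \<psi> \<psi>'" "\<And>R. ac_deriv 0 R \<psi>' (\<lambda>t. (q t + k\<^sup>2) * \<psi> t)"
      and ye: "\<And>x. 0 \<le> x \<Longrightarrow> exp x \<le> y x" and pp: "\<And>x. 0 \<le> x \<Longrightarrow> 0 < \<psi> x"
      and pe: "\<And>x. 0 \<le> x \<Longrightarrow> \<psi> x \<le> exp (- x)" and p'e: "\<And>x. 0 \<le> x \<Longrightarrow> \<psi>' x \<le> (K + 1) * \<psi> x"
      and W: "y 0 * \<psi>' 0 - y' 0 * \<psi> 0 = - 1"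
    have cs: "schr_sol q ((of_real k)\<^sup>2) 0 R (\<lambda>x. of_real (f x)) (\<lambda>x. of_real (f' x))"
      if "\<And>R. ac_deriv 0 R f f'" "\<And>R. ac_deriv 0 R f' (\<lambda>t. (q t + k\<^sup>2) * f t)" for f f' R
      using ac_deriv_linear[OF that(1)[of R] bounded_linear_of_real[where 'a=complex]]
        ac_deriv_linear[OF that(2)[of R] bounded_linear_of_real[where 'a=complex]]
      unfolding schr_sol_def by simp
    have ps: "schr_sol q ((of_real k)\<^sup>2) 0 R (\<lambda>x. of_real (\<psi> x)) (\<lambda>x. of_real (\<psi>' x))" for R
      by (rule cs[OF p])
    have ys: "schr_sol q ((of_real k)\<^sup>2) 0 R (\<lambda>x. of_real (y x)) (\<lambda>x. of_real (y' x))" for R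
      by (rule cs[OF y])
    have z: "- complex_of_real (- (k\<^sup>2)) = (of_real k)\<^sup>2" by simp
    have "m_function q \<infinity> h (of_real (- (k\<^sup>2))) = of_real (\<psi>' 0) / of_real (\<psi> 0)"
    proof (rule m_function_eqI[where u = "\<lambda>x. complex_of_real (\<psi> x)" and u' = "\<lambda>x. of_real (\<psi>' x)"])
      have "solves_schroedinger q \<infinity> (of_real (- (k\<^sup>2))) (\<lambda>x. of_real (\<psi> x)) (\<lambda>x. of_real (\<psi>' x))"
        by (rule schr_sol_imp_solves_infinite) (unfold z, rule ps)
      moreover have "(\<lambda>x. (cmod (of_real (\<psi> x)))\<^sup>2) absolutely_integrable_on {0..}"
      proof (rule measurable_bounded_by_integrable_imp_absolutely_integrable)
        have "continuous_on {0..} \<psi>" unfolding continuous_on_eq_continuous_within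
        proof
          fix x :: real assume "x \<in> {0..}"
          then have "continuous (at x within {0..x + 1}) \<psi>"
            using ac_deriv_continuous[OF p(1)[of "x + 1"]] by (simp add: continuous_on_eq_continuous_within)
          moreover have "at x within {0..} = at x within {0..x + 1}"
            by (rule at_within_nhd[of _ "{..<x + 1}"]) auto
          ultimately show "continuous (at x within {0..}) \<psi>" by simp
        qed
        then have "continuous_on {0..} (\<lambda>x. (cmod (of_real (\<psi> x)))\<^sup>2)" by (intro continuous_intros)
        then show "(\<lambda>x. (cmod (of_real (\<psi> x)))\<^sup>2) \<in> borel_measurable (lebesgue_on {0..})"
          by (rule continuous_imp_measurable_on_sets_lebesgue) auto
        show "(\<lambda>x. exp (- 2 * x)) integrable_on {0 :: real..}"
          by (rule integrable_on_exp_minus_to_infinity) simp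
        fix x :: real assume "x \<in> {0..}"
        then have "\<psi> x ^ 2 \<le> exp (- x) ^ 2" using pe[of x] pp[of x] by (intro power_mono) auto
        then show "norm ((cmod (of_real (\<psi> x)))\<^sup>2) \<le> exp (- 2 * x)"
          by (simp add: exp_double[symmetric] flip: exp_of_nat_mult)
      qed auto
      then have "right_condition \<infinity> h (\<lambda>x. of_real (\<psi> x)) (\<lambda>x. of_real (\<psi>' x))"
        unfolding right_condition_def by auto
      ultimately show "weyl_solution q \<infinity> h (of_real (- (k\<^sup>2))) (\<lambda>x. of_real (\<psi> x)) (\<lambda>x. of_real (\<psi>' x))"
        unfolding weyl_solution_def using pp[of 0] by auto
    next
      fix v v' assume v: "weyl_solution q \<infinity> h (of_real (- (k\<^sup>2))) v v'"
      have vs: "schr_sol q ((of_real k)\<^sup>2) 0 R v v'" for R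
        using solves_imp_schr_sol[OF q, of "of_real (- (k\<^sup>2))" v v' R] v unfolding weyl_solution_def z by simp
      \<comment> \<open>Cramer's rule in the basis \<open>y\<close>, \<open>\<psi>\<close>, whose
        Wronskian is \<open>- 1\<close> by \<open>W\<close>.\<close>
      define a where "a = v' 0 * of_real (\<psi> 0) - v 0 * of_real (\<psi>' 0)"
      define c where "c = of_real (y' 0) * v 0 - of_real (y 0) * v' 0"
      have W': "complex_of_real (y 0) * of_real (\<psi>' 0) - of_real (y' 0) * of_real (\<psi> 0) = - 1"
        unfolding of_real_mult[symmetric] of_real_diff[symmetric] W by simp
      have "a * of_real (y 0) + c * of_real (\<psi> 0)
          = - (complex_of_real (y 0) * of_real (\<psi>' 0) - of_real (y' 0) * of_real (\<psi> 0)) * v 0"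
        by (simp add: a_def c_def algebra_simps)
      then have v0: "v 0 = a * of_real (y 0) + c * of_real (\<psi> 0)" unfolding W' by simp
      have "a * of_real (y' 0) + c * of_real (\<psi>' 0)
          = - (complex_of_real (y 0) * of_real (\<psi>' 0) - of_real (y' 0) * of_real (\<psi> 0)) * v' 0"
        by (simp add: a_def c_def algebra_simps)
      then have v'0: "v' 0 = a * of_real (y' 0) + c * of_real (\<psi>' 0)" unfolding W' by simp
      have vrep: "v x = a * of_real (y x) + c * of_real (\<psi> x)" if "0 \<le> x" for x
      proof -
        have "schr_sol q ((of_real k)\<^sup>2) 0 x
           (\<lambda>x. v x + ((- a) * of_real (y x) + (- c) * of_real (\<psi> x)))
           (\<lambda>x. v' x + ((- a) * of_real (y' x) + (- c) * of_real (\<psi>' x)))"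
          by (intro schr_sol_add schr_sol_cmult vs ys ps)
        from schr_sol_zero[OF this qi _ _ that order_refl]
        have "v x + ((- a) * of_real (y x) + (- c) * of_real (\<psi> x)) = 0" using v0 v'0 by simp
        then show ?thesis by (simp add: algebra_simps)
      qed
      have a0: "a = 0"
      proof (rule ccontr)
        assume "a \<noteq> 0"
        obtain R where R: "0 \<le> R" and L2: "(\<lambda>x. (cmod (v x))\<^sup>2) absolutely_integrable_on {R..}"
          using v unfolding weyl_solution_def right_condition_def by auto
        then have i: "(\<lambda>x. (cmod (v x))\<^sup>2) integrable_on {R..}"
          by (auto dest: set_lebesgue_integral_eq_integral(1))
        \<comment> \<open>Beyond some point the growing part exceeds the bounded one by at least 1,
          so the integral of the squared norm would exceed every natural number.\<close>
        have "\<forall>\<^sub>F x in at_top. 1 \<le> norm a * exp x - norm c" using \<open>a \<noteq> 0\<close> by real_asymp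
        then obtain X0 where X0: "\<And>x. X0 \<le> x \<Longrightarrow> 1 \<le> norm a * exp x - norm c"
          unfolding eventually_at_top_linorder by blast
        define X where "X = max X0 R"
        have one: "1 \<le> (cmod (v x))\<^sup>2" if "X \<le> x" for x
        proof -
          have x0: "0 \<le> x" using that R by (simp add: X_def)
          have "norm (a * of_real (y x)) \<ge> norm a * exp x"
            using ye[OF x0] by (auto simp: norm_mult intro!: mult_left_mono)
          moreover have "norm (c * of_real (\<psi> x)) \<le> norm c * 1"
            unfolding norm_mult using pe[OF x0] pp[OF x0] x0 order_trans[OF pe[OF x0], of 1]
            by (intro mult_left_mono) auto
          moreover have "1 \<le> norm a * exp x - norm c" by (rule X0) (use that in \<open>simp add: X_def\<close>)
          ultimately have "1 \<le> norm (v x)"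
            unfolding vrep[OF x0] using norm_diff_ineq[of "a * of_real (y x)" "c * of_real (\<psi> x)"] by simp
          then show ?thesis by simp
        qed
        have "real n \<le> integral {R..} (\<lambda>x. (cmod (v x))\<^sup>2)" for n
        proof -
          have i': "(\<lambda>x. (cmod (v x))\<^sup>2) integrable_on {X..X + real n}"
            by (rule integrable_on_subinterval[OF i]) (auto simp: X_def)
          have "real n = integral {X..X + real n} (\<lambda>x. 1)" by simp
          also have "\<dots> \<le> integral {X..X + real n} (\<lambda>x. (cmod (v x))\<^sup>2)"
            by (rule integral_le[OF _ i']) (use one in auto)
          also have "\<dots> \<le> integral {R..} (\<lambda>x. (cmod (v x))\<^sup>2)"
            by (rule integral_subset_le[OF _ i' i]) (auto simp: X_def)
          finally show ?thesis .
        qed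
        then show False using reals_Archimedean2 by (meson not_less)
      qed
      have "c \<noteq> 0"
      proof
        assume "c = 0"
        obtain x where "0 \<le> x" "v x \<noteq> 0" using v unfolding weyl_solution_def by blast
        with vrep[of x] a0 \<open>c = 0\<close> show False by simp
      qed
      then show "v' 0 / v 0 = of_real (\<psi>' 0) / of_real (\<psi> 0)" unfolding v0 v'0 a0 by simp
    qed
    moreover have "\<exists>u0 u1. complex_of_real (\<psi> x) = of_real u0 \<and> complex_of_real (\<psi>' x) = of_real u1
        \<and> 0 < u0 \<and> u1 \<le> (K + 1) * u0" if "0 \<le> x" for x using pp[OF that] p'e[OF that] by blast
    ultimately show "\<exists>u u'. (\<forall>R. schr_sol q ((of_real k)\<^sup>2) 0 R u u')
      \<and> m_function q \<infinity> h (of_real (- (k\<^sup>2))) = u' 0 / u 0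
      \<and> (\<forall>x\<ge>0. \<exists>u0 u1. u x = of_real u0 \<and> u' x = of_real u1 \<and> 0 < u0 \<and> u1 \<le> (K + 1) * u0)"
      using ps by (intro exI[of _ "\<lambda>x. complex_of_real (\<psi> x)"] exI[of _ "\<lambda>x. complex_of_real (\<psi>' x)"]) simp
    qed
  qed
qed

section \<open>Asymptotics of Weyl solutions\<close>

text \<open>Read from \<open>d\<close> towards 0 a decaying solution grows, so the asymptotics from
  initial data apply to the reflected equation. Reflection changes the sign of the derivative, hence
  \<open>u k d - u' k d / k\<close> in \<open>lim\<close>.\<close>

lemma reversed_asymptotics:
  fixes u u' :: "real \<Rightarrow> real \<Rightarrow> complex"
  assumes q: "q absolutely_integrable_on {0..d}"
    and sol: "\<forall>\<^sub>F k in at_top. schr_sol q ((of_real k)\<^sup>2) 0 d (u k) (u' k)"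
    and bnd: "\<forall>\<^sub>F k in at_top. norm (u k d) + norm (u' k d) / k \<le> N"
    and lim: "((\<lambda>k. u k d - u' k d / of_real k) \<longlongrightarrow> c) at_top"
    and x: "0 \<le> x" "x < d"
  shows "((\<lambda>k. exp (- of_real k * of_real (d - x)) * u k x) \<longlongrightarrow> c / 2) at_top"
    and "((\<lambda>k. exp (- of_real k * of_real (d - x)) * (u' k x + of_real k * u k x)) \<longlongrightarrow> 0) at_top"
proof -
  define v where "v k t = u k (d - t)" for k t
  define v' where "v' k t = - u' k (d - t)" for k t
  have "(\<lambda>t. q (d - t)) absolutely_integrable_on {d - d..d - 0}"
    by (rule absolutely_integrable_reflect_about[OF q])
  then have qr: "(\<lambda>t. q (d - t)) absolutely_integrable_on {0..d - x}"
    by (rule absolutely_integrable_on_subinterval) (use x in auto)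
  have solr: "\<forall>\<^sub>F k in at_top. schr_sol (\<lambda>t. q (d - t)) ((of_real k)\<^sup>2) 0 (d - x) (v k) (v' k)"
    using sol
  proof eventually_elim
    case (elim k)
    from schr_sol_reflect[OF schr_sol_subinterval[OF elim x(1) order_refl], of d] x
    show ?case unfolding v_def v'_def by simp
  qed
  have bndr: "\<forall>\<^sub>F k in at_top. norm (v k 0) + norm (v' k 0) / k \<le> N"
    using bnd by (simp add: v_def v'_def)
  have limr: "((\<lambda>k. v k 0 + v' k 0 / of_real k) \<longlongrightarrow> c) at_top" using lim by (simp add: v_def v'_def)
  have "0 < d - x" using x by simp
  note A = schr_sol_asymptotics[OF qr this solr bndr limr]
  from A(1) show "((\<lambda>k. exp (- of_real k * of_real (d - x)) * u k x) \<longlongrightarrow> c / 2) at_top"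
    by (simp add: v_def)
  have "exp (- of_real k * of_real (d - x)) * (u' k x + of_real k * u k x)
      = - (exp (- of_real k * of_real (d - x)) * (v' k (d - x) - of_real k * v k (d - x)))" for k
    by (simp add: v_def v'_def algebra_simps)
  with tendsto_minus[OF A(2)]
  show "((\<lambda>k. exp (- of_real k * of_real (d - x)) * (u' k x + of_real k * u k x)) \<longlongrightarrow> 0) at_top"
    by simp
qed

text \<open>Dividing the asymptotics at \<open>x\<close> by those at 0 cancels the factor
  \<open>1 / 2\<close> and turns \<open>exp (- k * (d - x))\<close> into \<open>exp (k * x)\<close>.
  The limit 2 in the second claim compares with the data at \<open>d\<close> itself, which have not
  yet split into exponentials.\<close>

lemma ratio_asymptotics:
  fixes u u' :: "real \<Rightarrow> real \<Rightarrow> complex"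
  assumes q: "q absolutely_integrable_on {0..d}"
    and sol: "\<forall>\<^sub>F k in at_top. schr_sol q ((of_real k)\<^sup>2) 0 d (u k) (u' k)"
    and bnd: "\<forall>\<^sub>F k in at_top. norm (u k d) + norm (u' k d) / k \<le> N"
    and lim: "((\<lambda>k. u k d - u' k d / of_real k) \<longlongrightarrow> 1) at_top"
    and d: "0 < d"
  shows "\<forall>\<^sub>F k in at_top. u k 0 \<noteq> 0"
    and "((\<lambda>k. exp (of_real k * of_real d) / u k 0) \<longlongrightarrow> 2) at_top"
    and "0 \<le> x \<Longrightarrow> x < d \<Longrightarrow> ((\<lambda>k. exp (of_real k * of_real x) * (u k x / u k 0)) \<longlongrightarrow> 1) at_top"
    and "0 \<le> x \<Longrightarrow> x < d \<Longrightarrow> ((\<lambda>k. exp (of_real k * of_real x) *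
           ((u' k x + of_real k * u k x) / u k 0)) \<longlongrightarrow> 0) at_top"
proof -
  note R = reversed_asymptotics[OF q sol bnd lim]
  have 0: "((\<lambda>k. exp (- of_real k * of_real d) * u k 0) \<longlongrightarrow> 1 / 2) at_top" using R(1)[of 0] d by simp
  have "\<forall>\<^sub>F k in at_top. exp (- of_real k * of_real d) * u k 0 \<noteq> 0"
    by (rule tendsto_imp_eventually_ne[OF 0]) simp
  then show "\<forall>\<^sub>F k in at_top. u k 0 \<noteq> 0" by eventually_elim auto
  have e: "exp (of_real k * of_real x) * (a / u k 0)
      = exp (- of_real k * of_real (d - x)) * a / (exp (- of_real k * of_real d) * u k 0)" for k x a
  proof -
    have "exp (- complex_of_real k * of_real (d - x)) = exp (of_real k * of_real x) * exp (- of_real k * of_real d)"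
      unfolding exp_add[symmetric] by (simp add: algebra_simps)
    then show ?thesis by simp
  qed
  have "exp (of_real k * of_real d) / u k 0 = 1 / (exp (- of_real k * of_real d) * u k 0)" for k
    using e[of k d 1] by simp
  with tendsto_divide[OF tendsto_const[of 1] 0]
  show "((\<lambda>k. exp (of_real k * of_real d) / u k 0) \<longlongrightarrow> 2) at_top" by simp
  show "((\<lambda>k. exp (of_real k * of_real x) * (u k x / u k 0)) \<longlongrightarrow> 1) at_top" if "0 \<le> x" "x < d"
    unfolding e using tendsto_divide[OF R(1)[OF that] 0] by simp
  show "((\<lambda>k. exp (of_real k * of_real x) *
           ((u' k x + of_real k * u k x) / u k 0)) \<longlongrightarrow> 0) at_top" if "0 \<le> x" "x < d"
    unfolding e using tendsto_divide[OF R(2)[OF that] 0] by simp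
qed

text \<open>Collects all that the rest needs about Weyl solutions at
  \<open>z = - (k\<^sup>2)\<close>. Everything holds only eventually, since
  \<open>m_function\<close> may be unspecified for small \<open>k\<close>. At a finite end the
  growing and decaying parts reinforce each other in \<open>u\<close> for finite \<open>h\<close>
  and in \<open>u'\<close> for \<open>h = \<infinity>\<close>, whence \<open>2\<close> and
  \<open>- 2\<close>.\<close>

definition weyl_family ::
    "(real \<Rightarrow> real) \<Rightarrow> ereal \<Rightarrow> ereal \<Rightarrow> (real \<Rightarrow> real \<Rightarrow> complex) \<Rightarrow> (real \<Rightarrow> real \<Rightarrow> complex) \<Rightarrow> bool" where
  "weyl_family q b h u u' \<longleftrightarrow>
     (\<forall>\<^sub>F k in at_top. u k 0 \<noteq> 0 \<and> m_function q b h (of_real (- (k\<^sup>2))) = u' k 0 / u k 0) \<and>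
     (\<forall>R. ereal R \<le> b \<longrightarrow> (\<forall>\<^sub>F k in at_top. schr_sol q ((of_real k)\<^sup>2) 0 R (u k) (u' k))) \<and>
     (\<forall>x\<ge>0. ereal x < b \<longrightarrow>
        ((\<lambda>k. exp (of_real k * of_real x) * (u k x / u k 0)) \<longlongrightarrow> 1) at_top \<and>
        ((\<lambda>k. exp (of_real k * of_real x) * ((u' k x + of_real k * u k x) / u k 0)) \<longlongrightarrow> 0) at_top) \<and>
     (\<forall>B. b = ereal B \<longrightarrow> (if h = \<infinity>
        then (\<forall>\<^sub>F k in at_top. u k B = 0) \<and>
          ((\<lambda>k. exp (of_real k * of_real B) * (u' k B / u k 0) / of_real k) \<longlongrightarrow> - 2) at_top
        else (\<forall>\<^sub>F k in at_top. u' k B = - of_real (real_of_ereal h) * u k B) \<and>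
          ((\<lambda>k. exp (of_real k * of_real B) * (u k B / u k 0)) \<longlongrightarrow> 2) at_top))"

lemma weyl_family_finite:
  assumes q: "is_potential q (ereal B) h"
  shows "\<exists>u u'. weyl_family q (ereal B) h u u'"
proof -
  have B: "0 < B" using q by (simp add: is_potential_def)
  have qi: "q absolutely_integrable_on {0..B}" by (rule is_potential_abs_int[OF q order_refl])
  have qr: "(\<lambda>t. q (B - t)) absolutely_integrable_on {0..B}"
    using absolutely_integrable_reflect_about[OF qi, of B] by simp
  define \<eta> where "\<eta> = real_of_ereal h"
  \<comment> \<open>The data at \<open>B\<close> are scaled so that \<open>u - u' / k\<close> tends
    to 1 in both cases: \<open>u = 1\<close>, \<open>u' = - h\<close> for finite \<open>h\<close>,
    but \<open>u = 0\<close>, \<open>u' = - k\<close> for the Dirichlet condition.\<close>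
  define u0 where "u0 = (if h = \<infinity> then 0 else 1 :: complex)"
  define u1 where "u1 k = complex_of_real (if h = \<infinity> then k else real_of_ereal h)" for k
  define u where "u k x = schr_u (\<lambda>t. q (B - t)) ((of_real k)\<^sup>2) u0 (u1 k) (B - x)" for k x
  define u' where "u' k x = - schr_u' (\<lambda>t. q (B - t)) ((of_real k)\<^sup>2) u0 (u1 k) (B - x)" for k x
  have uB: "u k B = u0" "u' k B = - u1 k" for k by (simp_all add: u_def u'_def)
  have sol: "schr_sol q ((of_real k)\<^sup>2) 0 B (u k) (u' k)" for k
    using schr_sol_reflect[OF schr_u_sol[OF qr less_imp_le[OF B], of "(of_real k)\<^sup>2" u0 "u1 k"] less_imp_le[OF B], of B]
    unfolding u_def u'_def by simp
  have bnd: "\<forall>\<^sub>F k in at_top. norm (u k B) + norm (u' k B) / k \<le> 1 + \<bar>\<eta>\<bar>"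
    using eventually_ge_at_top[of 1]
  proof eventually_elim
    case (elim k)
    have "\<bar>\<eta>\<bar> / k \<le> \<bar>\<eta>\<bar> / 1" using elim by (intro divide_left_mono) auto
    then show ?case using elim by (simp add: uB u0_def u1_def flip: \<eta>_def)
  qed
  have lim: "((\<lambda>k. u k B - u' k B / of_real k) \<longlongrightarrow> 1) at_top"
  proof (cases "h = \<infinity>")
    case True
    have "\<forall>\<^sub>F k in at_top. u k B - u' k B / of_real k = 1"
      using eventually_gt_at_top[of 0] by eventually_elim (simp add: uB u0_def u1_def True)
    then show ?thesis by (rule tendsto_eventually)
  next
    case False
    have "((\<lambda>k. complex_of_real (1 + real_of_ereal h / k)) \<longlongrightarrow> of_real (1 + 0)) at_top"
      by (intro tendsto_of_real tendsto_add tendsto_const tendsto_divide_0[OF tendsto_const]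
          filterlim_at_top_imp_at_infinity filterlim_ident)
    then show ?thesis by (simp add: uB u0_def u1_def False)
  qed
  note R = ratio_asymptotics[OF qi always_eventually[OF allI[OF sol]] bnd lim B]
  have rc: "right_condition (ereal B) h (u k) (u' k)" for k
    unfolding right_condition_def by (simp add: uB u0_def u1_def)
  have "\<forall>\<^sub>F k in at_top. u k 0 \<noteq> 0 \<and> m_function q (ereal B) h (of_real (- (k\<^sup>2))) = u' k 0 / u k 0"
    using R(1)
  proof eventually_elim
    case (elim k)
    have "m_function q (ereal B) h (of_real (- (k\<^sup>2))) = u' k 0 / u k 0"
      by (rule m_function_finite_eq[OF q _ elim rc]) (use sol in simp)
    with elim show ?case by simp
  qed
  moreover have "schr_sol q ((of_real k)\<^sup>2) 0 R (u k) (u' k)" if "R \<le> B" for k R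
    by (rule schr_sol_subinterval[OF sol order_refl that])
  moreover have "((\<lambda>k. exp (of_real k * of_real B) * (u' k B / u k 0) / of_real k) \<longlongrightarrow> - 2) at_top" if "h = \<infinity>"
  proof (rule Lim_transform_eventually[OF tendsto_minus[OF R(2)]])
    show "\<forall>\<^sub>F k in at_top. - (exp (of_real k * of_real B) / u k 0)
        = exp (of_real k * of_real B) * (u' k B / u k 0) / of_real k"
      using eventually_gt_at_top[of 0] by eventually_elim (simp add: uB u1_def that)
  qed
  moreover have "((\<lambda>k. exp (of_real k * of_real B) * (u k B / u k 0)) \<longlongrightarrow> 2) at_top" if "h \<noteq> \<infinity>"
    using R(2) by (simp add: uB u0_def that)
  ultimately have "weyl_family q (ereal B) h u u'"
    unfolding weyl_family_def using R(3,4) by (simp add: uB u0_def u1_def)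
  then show ?thesis by blast
qed

text \<open>With \<open>u' \<le> C * u\<close> and \<open>k\<close> at least
  \<open>2 * \<bar>C\<bar> + 1\<close>, the quantity \<open>s = u - u' / k\<close> is at least
  \<open>u / 2\<close> and positive. Dividing by it gives data bounded uniformly in
  \<open>k\<close>, although \<open>u' / u\<close> may be very negative.\<close>

lemma weyl_family_infinite:
  assumes q: "is_potential q \<infinity> h"
  shows "\<exists>u u'. weyl_family q \<infinity> h u u'"
proof -
  have qi: "q absolutely_integrable_on {0..R}" for R by (rule is_potential_abs_int[OF q]) simp
  define good where "good C k p \<longleftrightarrow> (\<forall>R. schr_sol q ((of_real k)\<^sup>2) 0 R (fst p) (snd p))
      \<and> m_function q \<infinity> h (of_real (- (k\<^sup>2))) = snd p 0 / fst p 0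
      \<and> (\<forall>x\<ge>0. \<exists>u0 u1. fst p x = of_real u0 \<and> snd p x = of_real u1 \<and> 0 < u0 \<and> u1 \<le> C * u0)" for C k p
  have "\<exists>C k0. \<forall>k\<ge>k0. \<exists>u u'. good C k (u, u')"
    using weyl_solution_infinite[OF q] unfolding good_def fst_conv snd_conv .
  then obtain C k0 where *: "\<And>k. k0 \<le> k \<Longrightarrow> \<exists>p. good C k p" by metis
  \<comment> \<open>Makes one choice of solution for each \<open>k\<close>, with the same
    \<open>C\<close> throughout; the asymptotics at different \<open>x\<close> then concern the same
    family.\<close>
  define p where "p k = (SOME p. good C k p)" for k
  have p: "good C k (p k)" if "k0 \<le> k" for k unfolding p_def by (rule someI_ex[OF *[OF that]])
  define u where "u k = fst (p k)" for k
  define u' where "u' k = snd (p k)" for k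
  have sol: "schr_sol q ((of_real k)\<^sup>2) 0 R (u k) (u' k)" if "k0 \<le> k" for k R
    using p[OF that] by (simp add: good_def u_def u'_def)
  have m: "m_function q \<infinity> h (of_real (- (k\<^sup>2))) = u' k 0 / u k 0" if "k0 \<le> k" for k
    using p[OF that] by (simp add: good_def u_def u'_def)
  have pos: "\<exists>u0 u1. u k x = of_real u0 \<and> u' k x = of_real u1 \<and> 0 < u0 \<and> u1 \<le> C * u0" if "k0 \<le> k" "0 \<le> x" for k x
    using p[OF that(1)] that(2) unfolding good_def u_def u'_def by blast
  have A: "((\<lambda>k. exp (of_real k * of_real x) * (u k x / u k 0)) \<longlongrightarrow> 1) at_top \<and>
        ((\<lambda>k. exp (of_real k * of_real x) * ((u' k x + of_real k * u k x) / u k 0)) \<longlongrightarrow> 0) at_top"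
    if x: "0 \<le> x" for x
  proof -
    define d where "d = x + 1"
    define s where "s k = u k d - u' k d / of_real k" for k
    have ev: "\<forall>\<^sub>F k in at_top. k0 \<le> k \<and> 2 * \<bar>C\<bar> + 1 \<le> k"
      by (intro eventually_conj eventually_ge_at_top)
    have key: "\<forall>\<^sub>F k in at_top. s k \<noteq> 0 \<and> norm (u k d / s k) + norm (u' k d / s k) / k \<le> 5" using ev
    proof eventually_elim
      case (elim k)
      obtain u0 u1 where ab: "u k d = of_real u0" "u' k d = of_real u1" "0 < u0" "u1 \<le> C * u0"
        using pos[of k d] elim x d_def by auto
      define t where "t = u1 / k"
      define \<sigma> where "\<sigma> = u0 - t"
      have k: "0 < k" using elim abs_ge_zero[of C] by linarith
      have "C * u0 \<le> \<bar>C\<bar> * u0" using ab by (intro mult_right_mono) auto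
      also have "\<dots> \<le> (k / 2) * u0" using ab elim by (intro mult_right_mono) auto
      also have "\<dots> = u0 / 2 * k" by simp
      finally have "u1 \<le> u0 / 2 * k" using ab(4) by (rule order_trans[rotated])
      then have t: "t \<le> u0 / 2" using k unfolding t_def by (simp only: pos_divide_le_eq)
      then have \<sigma>: "u0 \<le> 2 * \<sigma>" by (simp add: \<sigma>_def)
      then have \<sigma>0: "0 < \<sigma>" using ab by simp
      have s: "s k = of_real \<sigma>" by (simp add: s_def \<sigma>_def t_def ab)
      have n1: "norm (u k d / s k) = u0 / \<sigma>"
        unfolding s ab(1) of_real_divide[symmetric] norm_of_real using ab \<sigma>0 by simp
      have n2: "norm (u' k d / s k) / k = \<bar>t\<bar> / \<sigma>"
        unfolding s ab(2) of_real_divide[symmetric] norm_of_real t_def using k \<sigma>0 by simp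
      have "\<bar>t\<bar> \<le> 3 * \<sigma>" using \<sigma> ab(3) \<sigma>_def t by linarith
      then have "\<bar>t\<bar> / \<sigma> \<le> 3" using \<sigma>0 by (simp add: pos_divide_le_eq)
      moreover have "u0 / \<sigma> \<le> 2" using \<sigma> \<sigma>0 by (simp add: pos_divide_le_eq)
      ultimately have "norm (u k d / s k) + norm (u' k d / s k) / k \<le> 5" unfolding n1 n2 by linarith
      then show ?case using s \<sigma>0 by simp
    qed
    define v where "v k t = u k t / s k" for k t
    define v' where "v' k t = u' k t / s k" for k t
    have 1: "\<forall>\<^sub>F k in at_top. schr_sol q ((of_real k)\<^sup>2) 0 d (v k) (v' k)" using ev
    proof eventually_elim
      case (elim k)
      show ?case using schr_sol_cmult[OF sol[of k d], of "inverse (s k)"] elim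
        by (simp add: v_def[abs_def] v'_def[abs_def] divide_inverse mult.commute)
    qed
    have 2: "\<forall>\<^sub>F k in at_top. norm (v k d) + norm (v' k d) / k \<le> 5"
      using key by eventually_elim (simp add: v_def v'_def)
    have "\<forall>\<^sub>F k in at_top. v k d - v' k d / of_real k = 1" using key
    proof eventually_elim
      case (elim k)
      have "v k d - v' k d / of_real k = (u k d - u' k d / of_real k) / s k"
        by (simp add: v_def v'_def diff_divide_distrib mult.commute)
      also have "\<dots> = s k / s k" by (simp add: s_def)
      finally have "v k d - v' k d / of_real k = s k / s k" .
      then show ?case using elim by simp
    qed
    then have 3: "((\<lambda>k. v k d - v' k d / of_real k) \<longlongrightarrow> 1) at_top" by (rule tendsto_eventually)
    have d: "0 < d" "x < d" using x by (auto simp: d_def)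
    note R = ratio_asymptotics(3,4)[OF qi 1 2 3 d(1) x d(2)]
    have e: "\<forall>\<^sub>F k in at_top. v k x / v k 0 = u k x / u k 0 \<and>
        (v' k x + of_real k * v k x) / v k 0 = (u' k x + of_real k * u k x) / u k 0" using key
    proof eventually_elim
      case (elim k)
      have "v' k x + of_real k * v k x = (u' k x + of_real k * u k x) / s k"
        by (simp add: v_def v'_def add_divide_distrib)
      with elim show ?case by (simp add: v_def)
    qed
    have "((\<lambda>k. exp (of_real k * of_real x) * (u k x / u k 0)) \<longlongrightarrow> 1) at_top"
      by (rule Lim_transform_eventually[OF R(1)]) (use e in eventually_elim, simp)
    moreover have "((\<lambda>k. exp (of_real k * of_real x) * ((u' k x + of_real k * u k x) / u k 0)) \<longlongrightarrow> 0) at_top"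
      by (rule Lim_transform_eventually[OF R(2)]) (use e in eventually_elim, simp)
    ultimately show ?thesis by blast
  qed
  have "\<forall>\<^sub>F k in at_top. u k 0 \<noteq> 0 \<and> m_function q \<infinity> h (of_real (- (k\<^sup>2))) = u' k 0 / u k 0"
    using eventually_ge_at_top[of k0]
  proof eventually_elim
    case (elim k)
    then show ?case using m pos[of k 0] by auto
  qed
  moreover have "\<forall>\<^sub>F k in at_top. schr_sol q ((of_real k)\<^sup>2) 0 R (u k) (u' k)" for R
    using eventually_ge_at_top[of k0] by eventually_elim (rule sol)
  ultimately have "weyl_family q \<infinity> h u u'" unfolding weyl_family_def using A by simp
  then show ?thesis by blast
qed

lemma weyl_family_exists:
  assumes "is_potential q b h"
  shows "\<exists>u u'. weyl_family q b h u u'"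
proof (cases b)
  case (real B)
  then show ?thesis using weyl_family_finite assms by simp
next
  case PInf
  then show ?thesis using weyl_family_infinite assms by simp
next
  case MInf
  then show ?thesis using assms by (simp add: is_potential_def)
qed

section \<open>The local Borg-Marchenko theorem\<close>

text \<open>The substitution \<open>z = exp w\<close> turns the quadrant into a strip, where the convergence factor
  \<open>exp (- \<epsilon> exp (3 / 2 (w - \<i> \<pi> / 4)))\<close> beats growth of order \<open>1 < 3 / 2\<close>; its exponent has positive
  real part as \<open>3 / 2 \<cdot> \<pi> / 4 < \<pi> / 2\<close>.\<close>

lemma phragmen_lindelof_quadrant:
  assumes f: "f holomorphic_on UNIV"
    and growth: "\<And>z. norm (f z) \<le> C * exp (A * norm z)"
    and re: "\<And>x. 0 \<le> x \<Longrightarrow> norm (f (of_real x)) \<le> M"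
    and im: "\<And>y. 0 \<le> y \<Longrightarrow> norm (f (\<i> * of_real y)) \<le> M"
    and disc: "\<And>z. norm z \<le> 1 \<Longrightarrow> norm (f z) \<le> M"
    and "0 < A" "1 \<le> M" and z: "0 \<le> Re z" "0 \<le> Im z"
  shows "norm (f z) \<le> M"
proof (cases "norm z \<le> 1")
  case True
  then show ?thesis by (rule disc)
next
  case False
  then have z0: "z \<noteq> 0" by auto
  define w0 where "w0 = Ln z"
  have w0: "exp w0 = z" using z0 by (simp add: w0_def)
  have Rew0: "Re w0 = ln (norm z)" using z0 by (simp add: w0_def)
  have Re0: "0 < Re w0" using False Rew0 ln_gt_zero[of "norm z"] by simp
  have Im0: "0 \<le> Im w0" "Im w0 \<le> pi / 2"
    using z z0 Im_Ln_pos_le[OF z0] Re_Ln_pos_le[OF z0] by (auto simp: w0_def)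
  define S where "S w = exp (3 / 2 * (w - \<i> * of_real (pi / 4)))" for w :: complex
  \<comment> \<open>The minimum of the cosine of the argument of \<open>S w\<close> over the strip,
    attained on its two edges.\<close>
  define c where "c = cos (3 * pi / 8)"
  have c0: "0 < c" unfolding c_def by (rule cos_gt_zero) (use pi_gt_zero in linarith)+
  have ReS: "c * exp (3 / 2 * Re w) \<le> Re (S w)" if "0 \<le> Im w" "Im w \<le> pi / 2" for w
  proof -
    have "c \<le> cos (3 / 2 * (Im w - pi / 4))"
    proof -
      have "cos (3 / 2 * (Im w - pi / 4)) = cos \<bar>3 / 2 * (Im w - pi / 4)\<bar>"
        by (rule cos_abs_real[symmetric])
      moreover have "cos (3 * pi / 8) \<le> cos \<bar>3 / 2 * (Im w - pi / 4)\<bar>"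
        by (rule cos_monotone_0_pi_le) (use that pi_gt_zero in \<open>auto simp: abs_if field_simps\<close>)
      ultimately show ?thesis by (simp add: c_def)
    qed
    then have "c * exp (3 / 2 * Re w) \<le> cos (3 / 2 * (Im w - pi / 4)) * exp (3 / 2 * Re w)"
      by (rule mult_right_mono) simp
    also have "\<dots> = Re (S w)" by (simp add: S_def Re_exp mult.commute)
    finally show ?thesis .
  qed
  have bound: "norm (f z) \<le> M * exp (\<epsilon> * Re (S w0))" if e: "0 < \<epsilon>" for \<epsilon>
  proof -
    define g where "g w = f (exp w) * exp (- of_real \<epsilon> * S w)" for w
    have ng: "norm (g w) = norm (f (exp w)) * exp (- \<epsilon> * Re (S w))" for w
      by (simp add: g_def norm_mult)
    have ec: "0 < \<epsilon> * c" using e c0 by simp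
    \<comment> \<open>On the far side \<open>Re w = R\<close> the convergence factor is at most
      \<open>exp (- \<epsilon> * c * exp (3 / 2 * R))\<close>, which beats
      \<open>C * exp (A * exp R)\<close>. So \<open>R\<close> can be chosen with product below 1,
      and \<open>1 \<le> M\<close> suffices there.\<close>
    have "((\<lambda>R. exp (A * exp R - e * exp (3 / 2 * R))) \<longlongrightarrow> 0) at_top" if "0 < e" for e
      using that \<open>0 < A\<close> by real_asymp
    from tendsto_mult_right_zero[OF this[OF ec], of C]
    have "((\<lambda>R. C * exp (A * exp R - (\<epsilon> * c) * exp (3 / 2 * R))) \<longlongrightarrow> 0) at_top" .
    then have "\<forall>\<^sub>F R in at_top. C * exp (A * exp R - (\<epsilon> * c) * exp (3 / 2 * R)) < 1"
      by (rule order_tendstoD) simp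
    from eventually_happens'[OF trivial_limit_at_top_linorder eventually_conj[OF eventually_ge_at_top[of "Re w0"] this]]
    obtain R where R: "Re w0 \<le> R" and RC: "C * exp (A * exp R - (\<epsilon> * c) * exp (3 / 2 * R)) < 1"
      by (elim exE conjE)
    have fac: "exp (- \<epsilon> * Re (S w)) \<le> 1" if "0 \<le> Im w" "Im w \<le> pi / 2" for w
    proof -
      have "0 \<le> c * exp (3 / 2 * Re w)" using c0 by simp
      then show ?thesis using ReS[OF that] e by simp
    qed
    have "norm (g w0) \<le> M"
    proof (rule maximum_modulus_frontier[where f = g and S = "cbox 0 (Complex R (pi / 2))"])
      have hol: "g holomorphic_on UNIV" unfolding g_def S_def
        by (intro holomorphic_intros holomorphic_on_compose_gen[OF _ f, unfolded o_def]) auto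
      then show "g holomorphic_on interior (cbox 0 (Complex R (pi / 2)))"
        by (rule holomorphic_on_subset) simp
      show "continuous_on (closure (cbox 0 (Complex R (pi / 2)))) g"
        using holomorphic_on_imp_continuous_on[OF hol] continuous_on_subset by blast
      fix w assume "w \<in> frontier (cbox 0 (Complex R (pi / 2)))"
      then have w: "0 \<le> Re w" "Re w \<le> R" "0 \<le> Im w" "Im w \<le> pi / 2"
        and side: "Re w = 0 \<or> Re w = R \<or> Im w = 0 \<or> Im w = pi / 2"
        by (auto simp: frontier_cbox in_cbox_complex_iff in_box_complex_iff)
      have le: "norm (g w) \<le> M" if "norm (f (exp w)) \<le> M"
        unfolding ng using mult_mono[OF that fac[OF w(3,4)]] \<open>1 \<le> M\<close> by simp
      from side consider "Re w = 0" | "Re w = R" | "Im w = 0" | "Im w = pi / 2" by blast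
      then show "norm (g w) \<le> M"
      proof cases
        \<comment> \<open>This side is mapped to an arc of the unit circle, for which the bound on
          the disc is assumed.\<close>
        case 1
        show ?thesis by (intro le disc) (simp add: 1)
      next
        case 2
        have "norm (g w) \<le> (C * exp (A * exp R)) * exp (- \<epsilon> * Re (S w))"
          unfolding ng using growth[of "exp w"] 2 by (intro mult_right_mono) auto
        also have "\<dots> \<le> (C * exp (A * exp R)) * exp (- (\<epsilon> * c) * exp (3 / 2 * R))"
        proof (rule mult_left_mono)
          have "\<epsilon> * (c * exp (3 / 2 * R)) \<le> \<epsilon> * Re (S w)"
            using ReS[OF w(3,4)] 2 e by (intro mult_left_mono) auto
          then show "exp (- \<epsilon> * Re (S w)) \<le> exp (- (\<epsilon> * c) * exp (3 / 2 * R))" by (simp add: mult.assoc)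
          show "0 \<le> C * exp (A * exp R)"
            using order_trans[OF norm_ge_zero growth[of "exp w"]] unfolding norm_exp_eq_Re 2 .
        qed
        also have "\<dots> = C * exp (A * exp R - (\<epsilon> * c) * exp (3 / 2 * R))"
          unfolding mult.assoc exp_add[symmetric] by simp
        finally show ?thesis using RC \<open>1 \<le> M\<close> by simp
      next
        case 3
        then have "exp w = of_real (exp (Re w))" by (simp add: complex_eq_iff Re_exp Im_exp)
        then show ?thesis by (intro le) (simp add: re)
      next
        case 4
        have "cos (Im w) = 0" "sin (Im w) = 1" unfolding 4 by simp_all
        then have "exp w = \<i> * of_real (exp (Re w))" by (simp add: complex_eq_iff Re_exp Im_exp)
        then show ?thesis by (intro le) (simp add: im)
      qed
    next
      show "w0 \<in> cbox 0 (Complex R (pi / 2))" using Re0 Im0 R by (auto simp: in_cbox_complex_iff)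
    qed simp
    then have "norm (f z) * exp (- \<epsilon> * Re (S w0)) \<le> M" unfolding ng w0 .
    from mult_right_mono[OF this, of "exp (\<epsilon> * Re (S w0))"] show ?thesis
      by (simp add: mult.assoc flip: exp_add)
  qed
  have "((\<lambda>\<epsilon>. M * exp (\<epsilon> * Re (S w0))) \<longlongrightarrow> M * exp (0 * Re (S w0))) (at_right 0)"
    by (intro tendsto_intros)
  moreover have "\<forall>\<^sub>F \<epsilon> in at_right 0. norm (f z) \<le> M * exp (\<epsilon> * Re (S w0))"
    using eventually_at_right_less[of 0] by eventually_elim (rule bound)
  ultimately have "norm (f z) \<le> M * exp (0 * Re (S w0))" by (rule tendsto_lowerbound) simp
  then show ?thesis by simp
qed

text \<open>For exponential type a half-plane is the critical opening, whereas a quadrant is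
  strictly below it; hence bounds on both axes are used. The four quadrants follow from the first by
  multiplication with powers of \<open>\<i>\<close>.\<close>

lemma exponential_type_bounded_on_axes:
  assumes f: "f holomorphic_on UNIV"
    and growth: "\<And>z. norm (f z) \<le> C * exp (A * norm z)" and A: "0 < A"
    and re: "\<And>x. norm (f (of_real x)) \<le> M" and im: "\<And>y. norm (f (\<i> * of_real y)) \<le> M"
    and lim: "((\<lambda>x. f (of_real x)) \<longlongrightarrow> 0) at_top"
  shows "f z = 0"
proof -
  have fc: "continuous_on UNIV f" by (rule holomorphic_on_imp_continuous_on[OF f])
  have "bounded (f ` cball 0 1)"
    by (intro compact_imp_bounded compact_continuous_image continuous_on_subset[OF fc]) auto
  then obtain M1 where M1: "\<And>z. norm z \<le> 1 \<Longrightarrow> norm (f z) \<le> M1"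
  proof -
    assume M1: "\<And>M1. (\<And>z. norm z \<le> 1 \<Longrightarrow> norm (f z) \<le> M1) \<Longrightarrow> thesis"
    obtain a where "\<forall>y\<in>f ` cball 0 1. norm y \<le> a"
      using \<open>bounded (f ` cball 0 1)\<close> unfolding bounded_iff by (elim exE)
    then show thesis by (intro M1[of a]) auto
  qed
  define B where "B = max 1 (max M M1)"
  have rot: "norm (f (a * z)) \<le> B" if a: "a \<in> {1, \<i>, - 1, - \<i>}" and z: "0 \<le> Re z" "0 \<le> Im z" for a z
  proof (rule phragmen_lindelof_quadrant[where f = "\<lambda>z. f (a * z)", OF _ _ _ _ _ A _ z])
    have na: "norm a = 1" using a by auto
    show "(\<lambda>z. f (a * z)) holomorphic_on UNIV"
      by (intro holomorphic_intros holomorphic_on_compose_gen[OF _ f, unfolded o_def]) auto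
    show "norm (f (a * z)) \<le> C * exp (A * norm z)" for z
      using growth[of "a * z"] na by (simp add: norm_mult)
    show "norm (f (a * of_real x)) \<le> B" for x
      using a re[of x] re[of "- x"] im[of x] im[of "- x"] by (auto simp: B_def)
    show "norm (f (a * (\<i> * of_real y))) \<le> B" for y
      using a re[of y] re[of "- y"] im[of y] im[of "- y"]
      by (auto simp: B_def simp flip: mult.assoc)
    show "norm (f (a * z)) \<le> B" if "norm z \<le> 1" for z
      using M1[of "a * z"] that na by (auto simp: B_def norm_mult)
  qed (simp add: B_def)
  have "norm (f z) \<le> B" for z
  proof -
    consider "0 \<le> Re z" "0 \<le> Im z" | "Re z \<le> 0" "0 \<le> Im z" | "Re z \<le> 0" "Im z \<le> 0" | "0 \<le> Re z" "Im z \<le> 0"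
      by linarith
    then show ?thesis
    proof cases
      case 1 then show ?thesis using rot[of 1 z] by simp
    next
      case 2 then show ?thesis using rot[of "\<i>" "- \<i> * z"] by (simp flip: mult.assoc)
    next
      case 3 then show ?thesis using rot[of "- 1" "- z"] by simp
    next
      case 4 then show ?thesis using rot[of "- \<i>" "\<i> * z"] by (simp flip: mult.assoc)
    qed
  qed
  then have "bounded (range f)" unfolding bounded_iff by blast
  from Liouville_theorem[OF f this] obtain c where c: "\<And>z. f z = c"
    unfolding constant_on_def by blast
  with lim have "c = 0" by (simp add: tendsto_const_iff)
  with c show ?thesis by simp
qed

section \<open>From equal quotients of solutions to equal potentials\<close>

lemma schr_sol_rep:
  assumes u: "schr_sol q w 0 T u u'" and q: "q absolutely_integrable_on {0..T}" and x: "0 \<le> x" "x \<le> T"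
  shows "u x = u 0 * schr_u q w 1 0 x + u' 0 * schr_u q w 0 1 x"
proof -
  have T: "0 \<le> T" using x by simp
  have "schr_sol q w 0 T
      (\<lambda>x. u x + (- u 0 * schr_u q w 1 0 x + - u' 0 * schr_u q w 0 1 x))
      (\<lambda>x. u' x + (- u 0 * schr_u' q w 1 0 x + - u' 0 * schr_u' q w 0 1 x))"
    by (intro schr_sol_add schr_sol_cmult u schr_u_sol[OF q T])
  from schr_sol_zero[OF this q _ _ x]
  have "u x + (- u 0 * schr_u q w 1 0 x + - u' 0 * schr_u q w 0 1 x) = 0" by simp
  then show ?thesis by (simp add: algebra_simps add_eq_0_iff)
qed

text \<open>Self-adjointness: \<open>Im (u cnj u')\<close> is a primitive of \<open>\<bar>u\<bar>\<^sup>2\<close> when \<open>Im w = - 1\<close>.\<close>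

lemma schr_u_nonzero:
  assumes q: "q absolutely_integrable_on {0..T}" and x: "0 < x" "x \<le> T" and w: "Im w = - 1"
  shows "schr_u q w 0 1 x \<noteq> 0"
proof
  assume ux: "schr_u q w 0 1 x = 0"
  define u where "u = schr_u q w 0 1"
  define u' where "u' = schr_u' q w 0 1"
  have sol: "schr_sol q w 0 x u u'"
    unfolding u_def u'_def by (rule schr_sol_subinterval[OF schr_u_sol[OF q]]) (use x in auto)
  have 1: "ac_deriv 0 x u u'" and 2: "ac_deriv 0 x u' (\<lambda>t. (of_real (q t) + w) * u t)"
    using sol unfolding schr_sol_def by auto
  have uc: "continuous_on {0..x} u" by (rule schr_sol_continuous[OF sol])
  have "ac_deriv 0 x (\<lambda>t. Im (u t * cnj (u' t)))
     (\<lambda>t. Im (u' t * cnj (u' t) + u t * cnj ((of_real (q t) + w) * u t)))"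
    by (intro ac_deriv_linear[OF _ bounded_linear_Im] ac_deriv_mult 1 ac_deriv_linear[OF 2 bounded_linear_cnj])
  then have "ac_deriv 0 x (\<lambda>t. Im (u t * cnj (u' t))) (\<lambda>t. (norm (u t))\<^sup>2)"
  proof (rule ac_deriv_cong)
    fix t
    show "Im (u' t * cnj (u' t) + u t * cnj ((of_real (q t) + w) * u t)) = (norm (u t))\<^sup>2"
      unfolding cmod_power2 using w by (simp add: power2_eq_square algebra_simps)
  qed simp
  from ac_deriv_integral[OF this order_refl _ order_refl] x
  have "integral {0..x} (\<lambda>t. (norm (u t))\<^sup>2) = 0" using ux by (simp add: u_def)
  then have "\<forall>t\<in>{0..x}. (norm (u t))\<^sup>2 = 0"
    by (subst (asm) integral_eq_0_iff) (use x in \<open>auto intro!: continuous_intros uc\<close>)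
  then have u0: "u t = 0" if "t \<in> {0..x}" for t using that by simp
  \<comment> \<open>With \<open>u\<close> identically 0 the derivative keeps its initial value 1, so
    \<open>u\<close> would also be the identity.\<close>
  have u'1: "u' t = 1" if "t \<in> {0..x}" for t
  proof -
    have "((\<lambda>s. (of_real (q s) + w) * u s) has_integral (u' t - u' 0)) {0..t}"
      by (rule ac_deriv_has_integral[OF 2]) (use that in auto)
    moreover have "((\<lambda>s. (of_real (q s) + w) * u s) has_integral 0) {0..t}"
      by (rule has_integral_is_0) (use u0 that in auto)
    ultimately have "u' t - u' 0 = 0" by (rule has_integral_unique)
    then show ?thesis by (simp add: u'_def)
  qed
  have "(u' has_integral (u x - u 0)) {0..x}" by (rule ac_deriv_has_integral[OF 1]) (use x in auto)
  moreover have "(u' has_integral of_real x) {0..x}"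
  proof (rule has_integral_eq)
    show "((\<lambda>t. 1 :: complex) has_integral of_real x) {0..x}"
      using has_integral_const_real[of "1 :: complex" 0 x] x by (simp add: scaleR_conv_of_real)
  qed (use u'1 in auto)
  ultimately have "u x - u 0 = of_real x" by (rule has_integral_unique)
  with u0 x show False by simp
qed

lemma ac_deriv_const_imp_zero:
  fixes f g :: "real \<Rightarrow> complex"
  assumes "ac_deriv 0 r f g" "continuous_on {0..r} g" "\<And>x. x \<in> {0..r} \<Longrightarrow> f x = 0" "0 < r" "x \<in> {0..r}"
  shows "g x = 0"
proof -
  have 1: "(f has_vector_derivative g x) (at x within cbox 0 r)"
    using ac_deriv_vector_derivative[OF assms(1,2,5)] by simp
  have 2: "(f has_vector_derivative 0) (at x within cbox 0 r)"
    by (rule has_vector_derivative_transform[OF _ _ has_vector_derivative_const[of 0]]) (use assms in auto)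
  show ?thesis
    by (rule vector_derivative_unique_within_closed_interval[OF assms(4) _ 1 2]) (use assms(5) in simp)
qed

text \<open>A single \<open>w\<close> is enough. A nonreal one is taken because then
  \<open>schr_u q1 w 0 1\<close> has no zero in \<open>{0<..r}\<close> and may be divided
  out.\<close>

lemma potentials_eq_if_quotients_eq:
  assumes q1: "q1 absolutely_integrable_on {0..r}" and q2: "q2 absolutely_integrable_on {0..r}" and r: "0 < r"
    and w: "Im w = - 1"
    and eq: "\<And>x. x \<in> {0..r} \<Longrightarrow> schr_u q1 w 0 1 x * schr_u q2 w 1 0 x = schr_u q2 w 0 1 x * schr_u q1 w 1 0 x"
  shows "AE x in lebesgue. x \<in> {0<..r} \<longrightarrow> q1 x = q2 x"
proof -
  define \<phi>1 where "\<phi>1 = schr_u q1 w 0 1"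
  define \<phi>2 where "\<phi>2 = schr_u q2 w 0 1"
  define \<theta>1 where "\<theta>1 = schr_u q1 w 1 0"
  define \<theta>2 where "\<theta>2 = schr_u q2 w 1 0"
  define \<phi>1' where "\<phi>1' = schr_u' q1 w 0 1"
  define \<phi>2' where "\<phi>2' = schr_u' q2 w 0 1"
  define \<theta>1' where "\<theta>1' = schr_u' q1 w 1 0"
  define \<theta>2' where "\<theta>2' = schr_u' q2 w 1 0"
  note defs = \<phi>1_def \<phi>2_def \<theta>1_def \<theta>2_def \<phi>1'_def \<phi>2'_def \<theta>1'_def \<theta>2'_def
  have s: "schr_sol q1 w 0 r \<phi>1 \<phi>1'" "schr_sol q2 w 0 r \<phi>2 \<phi>2'"
    "schr_sol q1 w 0 r \<theta>1 \<theta>1'" "schr_sol q2 w 0 r \<theta>2 \<theta>2'"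
    unfolding defs using r by (intro schr_u_sol q1 q2; simp)+
  note ac = s[unfolded schr_sol_def, THEN conjunct1]
  note ac' = s[unfolded schr_sol_def, THEN conjunct2]
  note cont = s[THEN schr_sol_continuous(1)] s[THEN schr_sol_continuous(2)]
  have W1: "\<theta>1 x * \<phi>1' x - \<theta>1' x * \<phi>1 x = 1" if "x \<in> {0..r}" for x
    unfolding defs by (rule schr_u_wronskian[OF q1]) (use that in auto)
  have W2: "\<theta>2 x * \<phi>2' x - \<theta>2' x * \<phi>2 x = 1" if "x \<in> {0..r}" for x
    unfolding defs by (rule schr_u_wronskian[OF q2]) (use that in auto)
  have e0: "\<phi>1 x * \<theta>2 x - \<phi>2 x * \<theta>1 x = 0" if "x \<in> {0..r}" for x
    using eq[OF that] by (simp add: defs)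
  have e1: "(\<phi>1' x * \<theta>2 x + \<phi>1 x * \<theta>2' x) - (\<phi>2' x * \<theta>1 x + \<phi>2 x * \<theta>1' x) = 0" if "x \<in> {0..r}" for x
    by (rule ac_deriv_const_imp_zero[OF ac_deriv_diff[OF ac_deriv_mult[OF ac(1) ac(4)] ac_deriv_mult[OF ac(2) ac(3)]]])
       (use e0 r that in \<open>auto intro!: continuous_intros cont\<close>)
  \<comment> \<open>Division-free form of
    \<open>(\<theta> / \<phi>)' = - 1 / \<phi>\<^sup>2\<close>, which follows from the Wronskian; it
    remains valid at the zero \<open>x = 0\<close> of \<open>\<phi>1\<close>.\<close>
  have sq: "(\<phi>1 x)\<^sup>2 = (\<phi>2 x)\<^sup>2" if x: "x \<in> {0..r}" for x
    using e0[OF x] e1[OF x] W1[OF x] W2[OF x] by algebra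
  have e2: "2 * (\<phi>1' x * \<phi>1 x) - 2 * (\<phi>2' x * \<phi>2 x) = 0" if "x \<in> {0..r}" for x
  proof -
    have "ac_deriv 0 r (\<lambda>x. \<phi>1 x * \<phi>1 x - \<phi>2 x * \<phi>2 x)
       (\<lambda>x. (\<phi>1' x * \<phi>1 x + \<phi>1 x * \<phi>1' x) - (\<phi>2' x * \<phi>2 x + \<phi>2 x * \<phi>2' x))"
      by (intro ac_deriv_diff ac_deriv_mult ac)
    moreover have "continuous_on {0..r} (\<lambda>x. (\<phi>1' x * \<phi>1 x + \<phi>1 x * \<phi>1' x) - (\<phi>2' x * \<phi>2 x + \<phi>2 x * \<phi>2' x))"
      by (intro continuous_intros cont)
    ultimately have "(\<phi>1' x * \<phi>1 x + \<phi>1 x * \<phi>1' x) - (\<phi>2' x * \<phi>2 x + \<phi>2 x * \<phi>2' x) = 0"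
      by (rule ac_deriv_const_imp_zero[OF _ _ _ r that]) (use sq in \<open>simp add: power2_eq_square\<close>)
    then show ?thesis by (simp add: mult.commute)
  qed
  \<comment> \<open>The derivative of \<open>\<phi>1' * \<phi>1 - \<phi>2' * \<phi>2\<close>, which
    vanishes by \<open>e2\<close>; since it contains \<open>q1\<close> and \<open>q2\<close>, it can
    be 0 only almost everywhere.\<close>
  define G where "G x = (of_real (q1 x) + w) * \<phi>1 x * \<phi>1 x + \<phi>1' x * \<phi>1' x
      - ((of_real (q2 x) + w) * \<phi>2 x * \<phi>2 x + \<phi>2' x * \<phi>2' x)" for x
  have G: "ac_deriv 0 r (\<lambda>x. 0) G" unfolding G_def
    by (rule ac_deriv_cong[OF ac_deriv_diff[OF ac_deriv_mult[OF ac'(1) ac(1)] ac_deriv_mult[OF ac'(2) ac(2)]]])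
       (use e2 in auto)
  have "AE x in lebesgue. x \<in> {0..r} \<longrightarrow> Re (G x) = 0"
    by (rule ac_deriv_zero_AE[where c = 0]) (use ac_deriv_linear[OF G bounded_linear_Re] in simp)
  moreover have "AE x in lebesgue. x \<in> {0..r} \<longrightarrow> Im (G x) = 0"
    by (rule ac_deriv_zero_AE[where c = 0]) (use ac_deriv_linear[OF G bounded_linear_Im] in simp)
  ultimately show ?thesis
  proof eventually_elim
    case (elim x)
    show ?case
    proof
      assume x: "x \<in> {0<..r}"
      then have x': "x \<in> {0..r}" by simp
      with elim have "G x = 0" by (simp add: complex_eq_iff)
      then have G0: "(of_real (q1 x) + w) * \<phi>1 x * \<phi>1 x + \<phi>1' x * \<phi>1' x
          - ((of_real (q2 x) + w) * \<phi>2 x * \<phi>2 x + \<phi>2' x * \<phi>2' x) = 0" by (simp add: G_def)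
      \<comment> \<open>Multiply \<open>G0\<close> by \<open>(\<phi>1 x)\<^sup>2\<close>: by
        \<open>sq\<close> and \<open>e2\<close> the terms with derivatives are the squares of
        \<open>\<phi>1' * \<phi>1\<close> and \<open>\<phi>2' * \<phi>2\<close> and cancel.\<close>
      have "(of_real (q1 x) - of_real (q2 x)) * (\<phi>1 x) ^ 4 = 0"
        using G0 sq[OF x'] e2[OF x'] by algebra
      moreover have "\<phi>1 x \<noteq> 0"
        unfolding \<phi>1_def by (rule schr_u_nonzero[OF q1 _ _ w]) (use x in auto)
      ultimately show "q1 x = q2 x" by simp
    qed
  qed
qed


section \<open>The entire function of the uniqueness theorem\<close>

lemma schr_u_bound:
  assumes q: "q absolutely_integrable_on {0..x}" and x: "0 \<le> x"
    and k: "1 \<le> norm k" "2 * l1_norm q x \<le> norm k"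
  shows "norm (schr_u q (k\<^sup>2) u0 u1 x) \<le> 2 * (norm u0 + norm u1 / norm k) * exp (\<bar>Re k\<bar> * x)"
proof -
  have *: "norm (schr_u q (k\<^sup>2) u0 u1 x) \<le> 2 * (norm u0 + norm u1 / norm k) * exp (Re k * x)"
    if "0 \<le> Re k" "1 \<le> norm k" "2 * l1_norm q x \<le> norm k" for k
  proof -
    have "k \<noteq> 0" using that by auto
    from schr_sol_bound[OF schr_u_sol[OF q x, of "k\<^sup>2" u0 u1] q this that(1,3) x order_refl]
    show ?thesis by simp
  qed
  show ?thesis
  proof (cases "0 \<le> Re k")
    case True
    then show ?thesis using *[of k] k by simp
  next
    case False
    then show ?thesis using *[of "- k"] k by simp
  qed
qed

lemma schr_u_normalized_tendsto_0:
  assumes q: "q absolutely_integrable_on {0..x}" and x: "0 \<le> x"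
  shows "((\<lambda>k. exp (- (of_real k * of_real x)) * schr_u q ((of_real k)\<^sup>2) 0 1 x) \<longlongrightarrow> 0) at_top"
proof (rule Lim_null_comparison)
  show "((\<lambda>k::real. 2 / k) \<longlongrightarrow> 0) at_top" by real_asymp
  show "\<forall>\<^sub>F k in at_top. norm (exp (- (of_real k * of_real x)) * schr_u q ((of_real k)\<^sup>2) 0 1 x) \<le> 2 / k"
    using eventually_conj[OF eventually_ge_at_top[of 1] eventually_ge_at_top[of "2 * l1_norm q x"]]
  proof eventually_elim
    case (elim k)
    have "norm (schr_u q ((of_real k)\<^sup>2) 0 1 x) \<le> 2 / k * exp (k * x)"
      using schr_u_bound[OF q x, of "of_real k" 0 1] elim by simp
    then have "exp (- (k * x)) * norm (schr_u q ((of_real k)\<^sup>2) 0 1 x) \<le> exp (- (k * x)) * (2 / k * exp (k * x))"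
      by (rule mult_left_mono) simp
    also have "exp (- (k * x)) * (2 / k * exp (k * x)) = 2 / k" by (simp add: exp_minus)
    finally show ?case by (simp add: norm_mult)
  qed
qed

lemma quotients_eq:
  assumes q1: "q1 absolutely_integrable_on {0..x}" and q2: "q2 absolutely_integrable_on {0..x}" and x: "0 < x"
    and lim: "((\<lambda>k. schr_u q1 ((of_real k)\<^sup>2) 0 1 x * schr_u q2 ((of_real k)\<^sup>2) 1 0 x
              - schr_u q2 ((of_real k)\<^sup>2) 0 1 x * schr_u q1 ((of_real k)\<^sup>2) 1 0 x) \<longlongrightarrow> 0) at_top"
  shows "schr_u q1 w 0 1 x * schr_u q2 w 1 0 x = schr_u q2 w 0 1 x * schr_u q1 w 1 0 x"
proof -
  define f where "f k = schr_u q1 (k\<^sup>2) 0 1 x * schr_u q2 (k\<^sup>2) 1 0 x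
      - schr_u q2 (k\<^sup>2) 0 1 x * schr_u q1 (k\<^sup>2) 1 0 x" for k
  have x0: "0 \<le> x" using x by simp
  have hol: "(\<lambda>k. schr_u q (k\<^sup>2) u0 u1 x) holomorphic_on UNIV"
    if "q absolutely_integrable_on {0..x}" for q u0 u1
    by (rule holomorphic_on_compose_gen[of "\<lambda>k. k\<^sup>2" UNIV "\<lambda>w. schr_u q w u0 u1 x" UNIV, unfolded o_def])
       (use schr_u_holomorphic[OF that] x0 in \<open>auto intro!: holomorphic_intros\<close>)
  have fhol: "f holomorphic_on UNIV" unfolding f_def by (intro holomorphic_intros hol q1 q2)
  have fc: "continuous_on UNIV f" by (rule holomorphic_on_imp_continuous_on[OF fhol])
  have cpt: "\<exists>M\<ge>0. \<forall>k. norm k \<le> R \<longrightarrow> norm (f k) \<le> M" for R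
  proof -
    have "bounded (f ` cball 0 R)"
      by (intro compact_imp_bounded compact_continuous_image continuous_on_subset[OF fc]) auto
    then obtain a where a: "\<forall>y\<in>f ` cball 0 R. norm y \<le> a" unfolding bounded_iff by (elim exE)
    show ?thesis by (rule exI[of _ "max 0 a"]) (use a in \<open>auto simp: le_max_iff_disj\<close>)
  qed
  define R where "R = max 1 (max (2 * l1_norm q1 x) (2 * l1_norm q2 x))"
  \<comment> \<open>Only the real part of \<open>k\<close> enters the exponent, so this one bound
    yields both the exponential type and boundedness on the imaginary axis.\<close>
  have big: "norm (f k) \<le> 8 * exp (2 * x * \<bar>Re k\<bar>)" if "R \<le> norm k" for k
  proof -
    have k: "1 \<le> norm k" "2 * l1_norm q1 x \<le> norm k" "2 * l1_norm q2 x \<le> norm k"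
      using that by (auto simp: R_def)
    let ?E = "exp (\<bar>Re k\<bar> * x)"
    have inv: "1 / norm k \<le> 1" using k(1) by (simp add: divide_le_eq)
    have p: "norm (schr_u q (k\<^sup>2) 0 1 x) \<le> 2 * ?E" "norm (schr_u q (k\<^sup>2) 1 0 x) \<le> 2 * ?E"
      if "q absolutely_integrable_on {0..x}" "2 * l1_norm q x \<le> norm k" for q
    proof -
      have "norm (schr_u q (k\<^sup>2) 0 1 x) \<le> 2 * (1 / norm k) * ?E"
        using schr_u_bound[OF that(1) x0 k(1) that(2), of 0 1] by simp
      also have "\<dots> \<le> 2 * 1 * ?E" by (intro mult_right_mono mult_left_mono inv) auto
      finally show "norm (schr_u q (k\<^sup>2) 0 1 x) \<le> 2 * ?E" by simp
      show "norm (schr_u q (k\<^sup>2) 1 0 x) \<le> 2 * ?E"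
        using schr_u_bound[OF that(1) x0 k(1) that(2), of 1 0] by simp
    qed
    have "norm (f k) \<le> norm (schr_u q1 (k\<^sup>2) 0 1 x * schr_u q2 (k\<^sup>2) 1 0 x)
      + norm (schr_u q2 (k\<^sup>2) 0 1 x * schr_u q1 (k\<^sup>2) 1 0 x)"
      unfolding f_def by (rule norm_triangle_ineq4)
    also have "\<dots> \<le> (2 * ?E) * (2 * ?E) + (2 * ?E) * (2 * ?E)"
      unfolding norm_mult by (intro add_mono mult_mono p q1 q2 k) auto
    also have "\<dots> = 8 * (?E * ?E)" by simp
    also have "\<dots> = 8 * exp (2 * x * \<bar>Re k\<bar>)"
      unfolding exp_add[symmetric] by (simp add: mult.commute)
    finally show ?thesis .
  qed
  obtain M0 where M0: "0 \<le> M0" "\<And>k. norm k \<le> R \<Longrightarrow> norm (f k) \<le> M0" using cpt[of R] by blast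
  have flim: "((\<lambda>k. f (of_real k)) \<longlongrightarrow> 0) at_top" using lim by (simp add: f_def)
  have "\<forall>\<^sub>F k in at_top. norm (f (of_real k)) < 1"
    using order_tendstoD(2)[OF tendsto_norm[OF flim], of 1] by simp
  then obtain X where X: "\<And>k. X \<le> k \<Longrightarrow> norm (f (of_real k)) < 1"
    unfolding eventually_at_top_linorder by blast
  obtain M1 where M1: "0 \<le> M1" "\<And>k. norm k \<le> X \<Longrightarrow> norm (f k) \<le> M1" using cpt[of X] by blast
  define M where "M = 8 + M0 + M1"
  have Mpos: "0 \<le> M" using M0 M1 by (simp add: M_def)
  \<comment> \<open>The limit controls \<open>f\<close> on the positive axis; evenness carries the
    bound to the negative one.\<close>
  have even: "f (- k) = f k" for k by (simp add: f_def)
  have "f k = 0" for k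
  proof (rule exponential_type_bounded_on_axes[OF fhol, where C = M and A = "2 * x" and M = M])
    show "norm (f z) \<le> M * exp (2 * x * norm z)" for z
    proof (cases "R \<le> norm z")
      case True
      have "norm (f z) \<le> 8 * exp (2 * x * \<bar>Re z\<bar>)" by (rule big[OF True])
      also have "\<dots> \<le> M * exp (2 * x * norm z)"
        using M0 M1 x abs_Re_le_cmod[of z] by (intro mult_mono) (auto simp: M_def)
      finally show ?thesis .
    next
      case False
      then have "norm (f z) \<le> M * 1" using M0(2)[of z] M1(1) by (simp add: M_def)
      also have "\<dots> \<le> M * exp (2 * x * norm z)" using x Mpos by (intro mult_left_mono) auto
      finally show ?thesis .
    qed
    show "0 < 2 * x" using x by simp
    have pos: "norm (f (of_real t)) \<le> M" if "0 \<le> t" for t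
    proof (cases "X \<le> t")
      case True
      then show ?thesis using X[OF True] M0(1) M1(1) by (simp add: M_def)
    next
      case False
      then show ?thesis using M1(2)[of "of_real t"] that M0(1) by (simp add: M_def)
    qed
    show "norm (f (of_real t)) \<le> M" for t
      using pos[of t] pos[of "- t"] even[of "of_real t"] by (cases "0 \<le> t") auto
    show "norm (f (\<i> * of_real t)) \<le> M" for t
    proof (cases "R \<le> \<bar>t\<bar>")
      case True
      then show ?thesis using big[of "\<i> * of_real t"] M0(1) M1(1) by (simp add: norm_mult M_def)
    next
      case False
      then show ?thesis using M0(2)[of "\<i> * of_real t"] M1(1) by (simp add: norm_mult M_def)
    qed
  qed (rule flim)
  \<comment> \<open>Every \<open>w\<close> is a square, so the identity found for
    \<open>k\<^sup>2\<close> reaches nonreal parameters too.\<close>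
  then have "f (csqrt w) = 0" .
  then show ?thesis by (simp add: f_def)
qed

lemma weyl_family_rep:
  assumes q: "is_potential q b h" and F: "weyl_family q b h u u'" and x: "0 \<le> x" "ereal x \<le> b"
  shows "\<forall>\<^sub>F k in at_top. u k x / u k 0 = schr_u q ((of_real k)\<^sup>2) 1 0 x
      + m_function q b h (of_real (- (k\<^sup>2))) * schr_u q ((of_real k)\<^sup>2) 0 1 x"
proof -
  have "\<forall>\<^sub>F k in at_top. u k 0 \<noteq> 0 \<and> m_function q b h (of_real (- (k\<^sup>2))) = u' k 0 / u k 0"
    "\<forall>\<^sub>F k in at_top. schr_sol q ((of_real k)\<^sup>2) 0 x (u k) (u' k)"
    using F x(2) unfolding weyl_family_def by blast+
  then show ?thesis
  proof eventually_elim
    case (elim k)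
    have m: "m_function q b h (of_real (- (k\<^sup>2))) = u' k 0 / u k 0" and n: "u k 0 \<noteq> 0"
      using elim(1) by auto
    show ?case
      unfolding m using schr_sol_rep[OF elim(2) is_potential_abs_int[OF q x(2)] x(1) order_refl] n
      by (simp add: field_simps)
  qed
qed

text \<open>With \<open>\<psi> = \<theta> + m * \<phi>\<close> for each potential,
  \<open>\<phi>1 * \<theta>2 - \<phi>2 * \<theta>1\<close> equals \<open>\<phi>1 * \<psi>2 - \<phi>2
  * \<psi>1 + (m1 - m2) * \<phi>1 * \<phi>2\<close>. As \<open>\<phi>\<close> is at most of order
  \<open>exp (k * x) / k\<close> and \<open>\<psi>\<close> of order \<open>exp (- k * x)\<close>,
  all terms tend to 0 once \<open>exp (2 * a * k)\<close> times the difference is bounded.\<close>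

lemma local_borg_marchenko:
  assumes P1: "is_potential q1 b1 h1" and P2: "is_potential q2 b2 h2"
    and a: "0 < a" "ereal a \<le> b1" "ereal a \<le> b2"
    and bnd: "\<forall>\<^sub>F k in at_top. exp (2 * a * k) *
      cmod (m_function q1 b1 h1 (of_real (- (k\<^sup>2))) - m_function q2 b2 h2 (of_real (- (k\<^sup>2)))) \<le> K"
  shows "AE x in lebesgue. x \<in> {0<..<a} \<longrightarrow> q1 x = q2 x"
proof -
  obtain u1 u1' where F1: "weyl_family q1 b1 h1 u1 u1'" using weyl_family_exists[OF P1] by blast
  obtain u2 u2' where F2: "weyl_family q2 b2 h2 u2 u2'" using weyl_family_exists[OF P2] by blast
  define m1 where "m1 k = m_function q1 b1 h1 (of_real (- (k\<^sup>2)))" for k :: real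
  define m2 where "m2 k = m_function q2 b2 h2 (of_real (- (k\<^sup>2)))" for k :: real
  have qi: "q1 absolutely_integrable_on {0..x}" "q2 absolutely_integrable_on {0..x}" if "x \<le> a" for x
    using is_potential_abs_int[OF P1, of x] is_potential_abs_int[OF P2, of x] a that
    by (meson ereal_less_eq(3) order_trans)+
  have eq: "schr_u q1 w 0 1 x * schr_u q2 w 1 0 x = schr_u q2 w 0 1 x * schr_u q1 w 1 0 x"
    if x: "0 < x" "x < a" for x w
  proof (rule quotients_eq[OF qi(1) qi(2) x(1)])
    have xb: "ereal x < b1" "ereal x < b2" "ereal x \<le> b1" "ereal x \<le> b2"
      using x a by (auto intro: less_le_trans[of _ "ereal a"] order_trans[of _ "ereal a"])
    define A where "A q k = exp (- (of_real k * of_real x)) * schr_u q ((of_real k)\<^sup>2) 0 1 x" for q and k :: real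
    have A1: "((\<lambda>k. A q1 k) \<longlongrightarrow> 0) at_top" and A2: "((\<lambda>k. A q2 k) \<longlongrightarrow> 0) at_top"
      unfolding A_def using x by (intro schr_u_normalized_tendsto_0 qi; simp)+
    define \<psi>1 where "\<psi>1 k = exp (of_real k * of_real x) * (u1 k x / u1 k 0)" for k :: real
    define \<psi>2 where "\<psi>2 k = exp (of_real k * of_real x) * (u2 k x / u2 k 0)" for k :: real
    have \<psi>1: "(\<psi>1 \<longlongrightarrow> 1) at_top"
      unfolding \<psi>1_def[abs_def] using F1 xb x unfolding weyl_family_def by simp
    have \<psi>2: "(\<psi>2 \<longlongrightarrow> 1) at_top"
      unfolding \<psi>2_def[abs_def] using F2 xb x unfolding weyl_family_def by simp
    define D where "D k = exp (of_real k * of_real x) ^ 2 * (m1 k - m2 k)" for k :: real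
    have D: "\<forall>\<^sub>F k in at_top. norm (D k) \<le> K" using bnd eventually_ge_at_top[of 0]
    proof eventually_elim
      case (elim k)
      have "norm (D k) = exp (2 * x * k) * norm (m1 k - m2 k)"
        by (simp add: D_def norm_mult norm_power mult_ac flip: exp_of_nat_mult)
      also have "\<dots> \<le> exp (2 * a * k) * norm (m1 k - m2 k)"
        using x elim by (intro mult_right_mono) (auto intro: mult_right_mono)
      finally show ?case using elim by (simp add: m1_def m2_def)
    qed
    have "((\<lambda>k. D k * (A q1 k * A q2 k)) \<longlongrightarrow> 0) at_top"
    proof (rule Lim_null_comparison)
      show "\<forall>\<^sub>F k in at_top. norm (D k * (A q1 k * A q2 k)) \<le> K * norm (A q1 k * A q2 k)"
        using D by eventually_elim (simp add: norm_mult mult_right_mono)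
      show "((\<lambda>k. K * norm (A q1 k * A q2 k)) \<longlongrightarrow> 0) at_top"
        using tendsto_mult_right_zero[OF tendsto_norm_zero[OF tendsto_mult_zero[OF A1 A2]], of K] .
    qed
    from tendsto_add[OF tendsto_diff[OF tendsto_mult[OF A1 \<psi>2] tendsto_mult[OF A2 \<psi>1]] this]
    have L: "((\<lambda>k. A q1 k * \<psi>2 k - A q2 k * \<psi>1 k + D k * (A q1 k * A q2 k)) \<longlongrightarrow> 0) at_top" by simp
    note r1 = weyl_family_rep[OF P1 F1 less_imp_le[OF x(1)] xb(3), folded m1_def]
      and r2 = weyl_family_rep[OF P2 F2 less_imp_le[OF x(1)] xb(4), folded m2_def]
    show "((\<lambda>k. schr_u q1 ((of_real k)\<^sup>2) 0 1 x * schr_u q2 ((of_real k)\<^sup>2) 1 0 x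
              - schr_u q2 ((of_real k)\<^sup>2) 0 1 x * schr_u q1 ((of_real k)\<^sup>2) 1 0 x) \<longlongrightarrow> 0) at_top"
    proof (rule Lim_transform_eventually[OF L])
      show "\<forall>\<^sub>F k in at_top. A q1 k * \<psi>2 k - A q2 k * \<psi>1 k + D k * (A q1 k * A q2 k) =
         schr_u q1 ((of_real k)\<^sup>2) 0 1 x * schr_u q2 ((of_real k)\<^sup>2) 1 0 x
              - schr_u q2 ((of_real k)\<^sup>2) 0 1 x * schr_u q1 ((of_real k)\<^sup>2) 1 0 x" using r1 r2
      proof eventually_elim
        case (elim k)
        define e where "e = exp (complex_of_real k * of_real x)"
        define e' where "e' = exp (- (complex_of_real k * of_real x))"
        have ee: "e' * e = 1" by (simp add: e_def e'_def flip: exp_add)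
        show ?case unfolding A_def \<psi>1_def \<psi>2_def D_def elim e_def[symmetric] e'_def[symmetric]
          using ee by algebra
      qed
    qed
  qed (use x in auto)
  have part: "AE x in lebesgue. x \<in> {0<..r} \<longrightarrow> q1 x = q2 x" if r: "0 < r" "r < a" for r
  proof (rule potentials_eq_if_quotients_eq[where w = "- \<i>"])
    show "schr_u q1 (- \<i>) 0 1 x * schr_u q2 (- \<i>) 1 0 x = schr_u q2 (- \<i>) 0 1 x * schr_u q1 (- \<i>) 1 0 x"
      if "x \<in> {0..r}" for x using eq[of x "- \<i>"] that r by (cases "x = 0") auto
  qed (use r qi in auto)
  \<comment> \<open>The asymptotics of \<open>\<psi>\<close> are used only at \<open>x < a\<close>,
    so \<open>(0,a)\<close> is exhausted by countably many intervals; \<open>n + 2\<close> keeps all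
    right ends strictly between 0 and \<open>a\<close>.\<close>
  have "AE x in lebesgue. \<forall>n. x \<in> {0<..a * (1 - 1 / real (n + 2))} \<longrightarrow> q1 x = q2 x"
    unfolding AE_all_countable
  proof
    fix n
    have "0 < a * (1 - 1 / real (n + 2))" "a * (1 - 1 / real (n + 2)) < a"
      using a by (auto intro!: mult_pos_pos)
    then show "AE x in lebesgue. x \<in> {0<..a * (1 - 1 / real (n + 2))} \<longrightarrow> q1 x = q2 x" by (rule part)
  qed
  then show ?thesis
  proof eventually_elim
    case (elim x)
    show ?case
    proof
      assume x: "x \<in> {0<..<a}"
      then have "0 < 1 - x / a" using a by simp
      then obtain n where n: "1 / real (Suc n) < 1 - x / a" using nat_approx_posE by blast
      have "1 / real (n + 2) \<le> 1 / real (Suc n)" by (intro divide_left_mono) auto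
      then have "x / a \<le> 1 - 1 / real (n + 2)" using n by linarith
      then have "x \<le> a * (1 - 1 / real (n + 2))"
        using a by (simp only: pos_divide_le_eq mult.commute)
      then show "q1 x = q2 x" using elim x by auto
    qed
  qed
qed

section \<open>Comparison of the m-functions\<close>

text \<open>Here \<open>P\<close> and \<open>Q\<close> are \<open>exp (k a) u(a) / u(0)\<close> and \<open>exp (k a) u'(a) / u(0)\<close> for a Weyl solution \<open>u\<close>
  at \<open>z = - k\<^sup>2\<close>. The three cases are \<open>a < b\<close>, and \<open>a = b\<close> with \<open>h\<close> finite or infinite.\<close>

definition interior_end :: "(real \<Rightarrow> complex) \<Rightarrow> (real \<Rightarrow> complex) \<Rightarrow> bool" where
  "interior_end P Q \<longleftrightarrow> (P \<longlongrightarrow> 1) at_top \<and> ((\<lambda>k. Q k + of_real k * P k) \<longlongrightarrow> 0) at_top"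

definition robin_end :: "real \<Rightarrow> (real \<Rightarrow> complex) \<Rightarrow> (real \<Rightarrow> complex) \<Rightarrow> bool" where
  "robin_end \<eta> P Q \<longleftrightarrow> (P \<longlongrightarrow> 2) at_top \<and> (\<forall>\<^sub>F k in at_top. Q k = - of_real \<eta> * P k)"

definition dirichlet_end :: "(real \<Rightarrow> complex) \<Rightarrow> (real \<Rightarrow> complex) \<Rightarrow> bool" where
  "dirichlet_end P Q \<longleftrightarrow> (\<forall>\<^sub>F k in at_top. P k = 0) \<and> ((\<lambda>k. Q k / of_real k) \<longlongrightarrow> - 2) at_top"

lemma end_cases:
  assumes q: "is_potential q b h" and F: "weyl_family q b h u u'" and a: "0 < a" "ereal a \<le> b"
  defines "P \<equiv> \<lambda>k. exp (of_real k * of_real a) * (u k a / u k 0)"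
    and "Q \<equiv> \<lambda>k. exp (of_real k * of_real a) * (u' k a / u k 0)"
  obtains (interior) "ereal a < b" "interior_end P Q"
    | (robin) "b = ereal a" "\<bar>h\<bar> < \<infinity>" "robin_end (real_of_ereal h) P Q"
    | (dirichlet) "b = ereal a" "h = \<infinity>" "dirichlet_end P Q"
proof (cases "ereal a < b")
  case True
  have "Q k + of_real k * P k = exp (of_real k * of_real a) * ((u' k a + of_real k * u k a) / u k 0)" for k
    unfolding P_def Q_def by (simp add: add_divide_distrib algebra_simps)
  then have "interior_end P Q"
    using F True a unfolding interior_end_def weyl_family_def P_def by simp
  then show ?thesis by (rule interior[OF True])
next
  case False
  then have b: "b = ereal a" using a by simp
  have hm: "h \<noteq> - \<infinity>" using q b by (simp add: is_potential_def)
  show ?thesis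
  proof (cases "h = \<infinity>")
    case True
    have "(\<forall>\<^sub>F k in at_top. u k a = 0)"
      "((\<lambda>k. exp (of_real k * of_real a) * (u' k a / u k 0) / of_real k) \<longlongrightarrow> - 2) at_top"
      using F b True unfolding weyl_family_def by auto
    then have "dirichlet_end P Q"
      unfolding dirichlet_end_def P_def Q_def by (auto elim: eventually_mono)
    then show ?thesis by (rule dirichlet[OF b True])
  next
    case False
    have 1: "\<forall>\<^sub>F k in at_top. u' k a = - of_real (real_of_ereal h) * u k a"
      and 2: "((\<lambda>k. exp (of_real k * of_real a) * (u k a / u k 0)) \<longlongrightarrow> 2) at_top"
      using F b False unfolding weyl_family_def by auto
    have "\<forall>\<^sub>F k in at_top. Q k = - of_real (real_of_ereal h) * P k"
      using 1 unfolding P_def Q_def by eventually_elim simp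
    then have "robin_end (real_of_ereal h) P Q" using 2 unfolding robin_end_def P_def by simp
    moreover have "\<bar>h\<bar> < \<infinity>" using False hm by (cases h) auto
    ultimately show ?thesis by (intro robin[OF b])
  qed
qed

section \<open>Wronskian limits in the various cases\<close>

text \<open>Each product diverges like \<open>k\<close>; adding and subtracting
  \<open>k * P1 * P2\<close> cancels the divergence.\<close>

lemma interior_interior:
  assumes "interior_end P1 Q1" "interior_end P2 Q2"
  shows "((\<lambda>k. P1 k * Q2 k - Q1 k * P2 k) \<longlongrightarrow> 0) at_top"
proof -
  have "((\<lambda>k. P1 k * (Q2 k + of_real k * P2 k) - (Q1 k + of_real k * P1 k) * P2 k) \<longlongrightarrow> 1 * 0 - 0 * 1) at_top"
    using assms unfolding interior_end_def by (intro tendsto_intros) auto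
  then show ?thesis by (simp add: algebra_simps)
qed

lemma tendsto_inverse_of_real: "((\<lambda>k. of_real (1 / k) :: complex) \<longlongrightarrow> 0) at_top"
proof -
  have "((\<lambda>k. complex_of_real (1 / k)) \<longlongrightarrow> of_real 0) at_top"
    by (intro tendsto_of_real) real_asymp
  then show ?thesis by simp
qed

lemma interior_end_limits:
  assumes "interior_end P Q"
  shows "(P \<longlongrightarrow> 1) at_top" "((\<lambda>k. Q k / of_real k) \<longlongrightarrow> - 1) at_top"
proof -
  have P: "(P \<longlongrightarrow> 1) at_top" and Q: "((\<lambda>k. Q k + of_real k * P k) \<longlongrightarrow> 0) at_top"
    using assms by (auto simp: interior_end_def)
  show "(P \<longlongrightarrow> 1) at_top" by (rule P)
  have "((\<lambda>k. (Q k + of_real k * P k) * of_real (1 / k) - P k) \<longlongrightarrow> 0 * 0 - 1) at_top"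
    by (intro tendsto_intros P Q tendsto_inverse_of_real)
  then have "((\<lambda>k. (Q k + of_real k * P k) * of_real (1 / k) - P k) \<longlongrightarrow> - 1) at_top" by simp
  then show "((\<lambda>k. Q k / of_real k) \<longlongrightarrow> - 1) at_top"
  proof (rule Lim_transform_eventually)
    show "\<forall>\<^sub>F k in at_top. (Q k + of_real k * P k) * of_real (1 / k) - P k = Q k / of_real k"
      using eventually_gt_at_top[of 0] by eventually_elim (simp add: field_simps)
  qed
qed

lemma robin_end_limits:
  assumes "robin_end \<eta> P Q"
  shows "(P \<longlongrightarrow> 2) at_top" "((\<lambda>k. Q k / of_real k) \<longlongrightarrow> 0) at_top"
proof -
  have P: "(P \<longlongrightarrow> 2) at_top" and Q: "\<forall>\<^sub>F k in at_top. Q k = - of_real \<eta> * P k"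
    using assms by (auto simp: robin_end_def)
  show "(P \<longlongrightarrow> 2) at_top" by (rule P)
  have "((\<lambda>k. - of_real \<eta> * P k * of_real (1 / k)) \<longlongrightarrow> - of_real \<eta> * 2 * 0) at_top"
    by (intro tendsto_intros P tendsto_inverse_of_real)
  then have "((\<lambda>k. - of_real \<eta> * P k * of_real (1 / k)) \<longlongrightarrow> 0) at_top" by simp
  then show "((\<lambda>k. Q k / of_real k) \<longlongrightarrow> 0) at_top"
    by (rule Lim_transform_eventually) (use Q in eventually_elim, simp)
qed

lemma dirichlet_end_limits:
  assumes "dirichlet_end P Q"
  shows "(P \<longlongrightarrow> 0) at_top" "((\<lambda>k. Q k / of_real k) \<longlongrightarrow> - 2) at_top"
  using assms unfolding dirichlet_end_def by (auto intro: tendsto_eventually)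

text \<open>The second claim is not contained in the first: limit 0 does not survive a larger
  exponential weight, exact vanishing does.\<close>

lemma robin_robin:
  assumes "robin_end \<eta>1 P1 Q1" "robin_end \<eta>2 P2 Q2"
  shows "((\<lambda>k. norm (P1 k * Q2 k - Q1 k * P2 k)) \<longlongrightarrow> 4 * \<bar>\<eta>1 - \<eta>2\<bar>) at_top"
    and "\<eta>1 = \<eta>2 \<Longrightarrow> \<forall>\<^sub>F k in at_top. norm (P1 k * Q2 k - Q1 k * P2 k) = 0"
proof -
  have e: "\<forall>\<^sub>F k in at_top. of_real (\<eta>1 - \<eta>2) * (P1 k * P2 k) = P1 k * Q2 k - Q1 k * P2 k"
  proof -
    have "\<forall>\<^sub>F k in at_top. Q1 k = - of_real \<eta>1 * P1 k" "\<forall>\<^sub>F k in at_top. Q2 k = - of_real \<eta>2 * P2 k"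
      using assms by (simp_all add: robin_end_def)
    then show ?thesis by eventually_elim (simp add: algebra_simps)
  qed
  have "((\<lambda>k. of_real (\<eta>1 - \<eta>2) * (P1 k * P2 k)) \<longlongrightarrow> of_real (\<eta>1 - \<eta>2) * (2 * 2)) at_top"
    using assms unfolding robin_end_def by (intro tendsto_mult tendsto_const) auto
  from tendsto_norm[OF Lim_transform_eventually[OF this e]]
  show "((\<lambda>k. norm (P1 k * Q2 k - Q1 k * P2 k)) \<longlongrightarrow> 4 * \<bar>\<eta>1 - \<eta>2\<bar>) at_top"
    by (simp add: norm_mult mult.commute del: of_real_diff)
  show "\<forall>\<^sub>F k in at_top. norm (P1 k * Q2 k - Q1 k * P2 k) = 0" if "\<eta>1 = \<eta>2"
    using e by eventually_elim (use that in simp)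
qed

lemma filterlim_norm_at_top_if_linear:
  fixes X :: "real \<Rightarrow> complex"
  assumes "((\<lambda>k. X k / of_real k) \<longlongrightarrow> c) at_top" "c \<noteq> 0"
  shows "filterlim (\<lambda>k. norm (X k)) at_top at_top"
proof -
  have "filterlim (\<lambda>k::real. norm (X k / of_real k) * k) at_top at_top"
    by (rule filterlim_tendsto_pos_mult_at_top[OF tendsto_norm[OF assms(1)] _ filterlim_ident])
       (use assms(2) in simp)
  then show ?thesis
  proof (rule filterlim_cong[OF refl refl, THEN iffD1, rotated])
    show "\<forall>\<^sub>F k::real in at_top. norm (X k / of_real k) * k = norm (X k)"
      using eventually_gt_at_top[of 0] by eventually_elim (simp add: norm_divide)
  qed
qed

text \<open>The pair \<open>P\<close>, \<open>Q / k\<close> tends to \<open>(1, - 1)\<close>,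
  \<open>(2, 0)\<close> or \<open>(0, - 2)\<close> according to the type of end. Any two different
  types give linearly independent limits, so in mixed cases the Wronskian grows like
  \<open>k\<close>. For equal types this leading order cancels and a finer argument decides.\<close>

lemma m_function_difference:
  assumes P1: "is_potential q1 b1 h1" and P2: "is_potential q2 b2 h2"
    and a: "0 < a" "ereal a \<le> b1" "ereal a \<le> b2"
    and eq: "AE x in lebesgue. x \<in> {0<..<a} \<longrightarrow> q1 x = q2 x"
  defines "Y \<equiv> \<lambda>k. exp (2 * a * k) *
      cmod (m_function q1 b1 h1 (of_real (- (k\<^sup>2))) - m_function q2 b2 h2 (of_real (- (k\<^sup>2))))"
  obtains (interior) "ereal a < b1" "ereal a < b2" "(Y \<longlongrightarrow> 0) at_top"
    | (robin) "b1 = ereal a" "b2 = ereal a" "\<bar>h1\<bar> < \<infinity>" "\<bar>h2\<bar> < \<infinity>"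
        "(Y \<longlongrightarrow> 4 * \<bar>real_of_ereal h1 - real_of_ereal h2\<bar>) at_top"
        "real_of_ereal h1 = real_of_ereal h2 \<Longrightarrow> \<forall>\<^sub>F k in at_top. Y k = 0"
    | (dirichlet) "h1 = \<infinity>" "\<forall>\<^sub>F k in at_top. Y k = 0"
    | (mixed) "\<not> (b1 = ereal a \<and> b2 = ereal a \<and> \<bar>h1\<bar> < \<infinity> \<and> \<bar>h2\<bar> < \<infinity>)" "filterlim Y at_top at_top"
proof -
  obtain u1 u1' where F1: "weyl_family q1 b1 h1 u1 u1'" using weyl_family_exists[OF P1] by blast
  obtain u2 u2' where F2: "weyl_family q2 b2 h2 u2 u2'" using weyl_family_exists[OF P2] by blast
  define p1 where "p1 = (\<lambda>k. exp (of_real k * of_real a) * (u1 k a / u1 k 0))"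
  define r1 where "r1 = (\<lambda>k. exp (of_real k * of_real a) * (u1' k a / u1 k 0))"
  define p2 where "p2 = (\<lambda>k. exp (of_real k * of_real a) * (u2 k a / u2 k 0))"
  define r2 where "r2 = (\<lambda>k. exp (of_real k * of_real a) * (u2' k a / u2 k 0))"
  define X where "X k = p1 k * r2 k - r1 k * p2 k" for k
  have Y: "\<forall>\<^sub>F k in at_top. norm (X k) = Y k"
  proof -
    have "\<forall>\<^sub>F k in at_top. u1 k 0 \<noteq> 0 \<and> m_function q1 b1 h1 (of_real (- (k\<^sup>2))) = u1' k 0 / u1 k 0"
      "\<forall>\<^sub>F k in at_top. u2 k 0 \<noteq> 0 \<and> m_function q2 b2 h2 (of_real (- (k\<^sup>2))) = u2' k 0 / u2 k 0"
      "\<forall>\<^sub>F k in at_top. schr_sol q1 ((of_real k)\<^sup>2) 0 a (u1 k) (u1' k)"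
      "\<forall>\<^sub>F k in at_top. schr_sol q2 ((of_real k)\<^sup>2) 0 a (u2 k) (u2' k)"
      using F1 F2 a unfolding weyl_family_def by blast+
    then show ?thesis
    proof eventually_elim
      case (elim k)
      have n: "u1 k 0 \<noteq> 0" "u2 k 0 \<noteq> 0" using elim by auto
      \<comment> \<open>By \<open>eq\<close>, \<open>u1\<close> also solves the equation with
        \<open>q2\<close> on \<open>{0..a}\<close>, so the Wronskian across the two problems is
        constant there.\<close>
      have W: "u1 k a * u2' k a - u1' k a * u2 k a = u1 k 0 * u2' k 0 - u1' k 0 * u2 k 0"
        by (rule schr_sol_wronskian[OF schr_sol_AE_cong[OF elim(3) eq] elim(4)]) (use a in auto)
      have "X k = (exp (of_real k * of_real a))\<^sup>2 * ((u1 k a * u2' k a - u1' k a * u2 k a) / (u1 k 0 * u2 k 0))"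
        unfolding X_def p1_def p2_def r1_def r2_def by (simp add: power2_eq_square diff_divide_distrib algebra_simps)
      also have "\<dots> = (exp (of_real k * of_real a))\<^sup>2 * (u2' k 0 / u2 k 0 - u1' k 0 / u1 k 0)"
        unfolding W using n by (simp add: diff_divide_distrib)
      finally have "norm (X k) = (exp (k * a))\<^sup>2 * norm (u2' k 0 / u2 k 0 - u1' k 0 / u1 k 0)"
        by (simp add: norm_mult norm_power)
      also have "(exp (k * a))\<^sup>2 = exp (2 * a * k)" by (simp add: mult_ac flip: exp_of_nat_mult)
      finally show ?case using elim(1,2) unfolding Y_def by (simp add: norm_minus_commute)
    qed
  qed
  have toY: "(Y \<longlongrightarrow> l) at_top" if "((\<lambda>k. norm (X k)) \<longlongrightarrow> l) at_top" for l
    by (rule Lim_transform_eventually[OF that Y])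
  have Ytop: "filterlim Y at_top at_top"
    if "(p1 \<longlongrightarrow> \<alpha>1) at_top" "((\<lambda>k. r1 k / of_real k) \<longlongrightarrow> \<beta>1) at_top"
      "(p2 \<longlongrightarrow> \<alpha>2) at_top" "((\<lambda>k. r2 k / of_real k) \<longlongrightarrow> \<beta>2) at_top"
      "\<alpha>1 * \<beta>2 - \<beta>1 * \<alpha>2 \<noteq> 0" for \<alpha>1 \<beta>1 \<alpha>2 \<beta>2
  proof -
    have "((\<lambda>k. p1 k * (r2 k / of_real k) - r1 k / of_real k * p2 k) \<longlongrightarrow> \<alpha>1 * \<beta>2 - \<beta>1 * \<alpha>2) at_top"
      by (intro tendsto_intros that)
    then have "((\<lambda>k. X k / of_real k) \<longlongrightarrow> \<alpha>1 * \<beta>2 - \<beta>1 * \<alpha>2) at_top"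
      by (simp add: X_def diff_divide_distrib)
    from filterlim_norm_at_top_if_linear[OF this that(5)]
    show ?thesis by (rule filterlim_cong[OF refl refl Y, THEN iffD1])
  qed
  note E1 = end_cases[OF P1 F1 a(1,2), folded p1_def r1_def]
  note E2 = end_cases[OF P2 F2 a(1,3), folded p2_def r2_def]
  show ?thesis
  proof (rule E1)
    assume A: "ereal a < b1" "interior_end p1 r1"
    show thesis
    proof (rule E2)
      assume B: "ereal a < b2" "interior_end p2 r2"
      have "((\<lambda>k. norm (X k)) \<longlongrightarrow> 0) at_top"
        unfolding X_def by (rule tendsto_norm_zero[OF interior_interior[OF A(2) B(2)]])
      then show thesis by (intro interior[OF A(1) B(1)] toY)
    next
      assume B: "robin_end (real_of_ereal h2) p2 r2"
      show thesis
        by (rule mixed[OF _ Ytop[OF interior_end_limits[OF A(2)] robin_end_limits[OF B]]]) (use A in auto)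
    next
      assume B: "dirichlet_end p2 r2"
      show thesis
        by (rule mixed[OF _ Ytop[OF interior_end_limits[OF A(2)] dirichlet_end_limits[OF B]]]) (use A in auto)
    qed
  next
    assume A: "b1 = ereal a" "\<bar>h1\<bar> < \<infinity>" "robin_end (real_of_ereal h1) p1 r1"
    show thesis
    proof (rule E2)
      assume B: "ereal a < b2" "interior_end p2 r2"
      show thesis by (rule mixed[OF _ Ytop[OF robin_end_limits[OF A(3)] interior_end_limits[OF B(2)]]]) (use B in auto)
    next
      assume B: "b2 = ereal a" "\<bar>h2\<bar> < \<infinity>" "robin_end (real_of_ereal h2) p2 r2"
      have "\<forall>\<^sub>F k in at_top. Y k = 0" if "real_of_ereal h1 = real_of_ereal h2"
        using robin_robin(2)[OF A(3) B(3) that] Y unfolding X_def by eventually_elim simp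
      then show thesis using robin_robin(1)[OF A(3) B(3)] unfolding X_def[symmetric]
        by (intro robin[OF A(1) B(1) A(2) B(2)] toY)
    next
      assume B: "h2 = \<infinity>" "dirichlet_end p2 r2"
      show thesis
        by (rule mixed[OF _ Ytop[OF robin_end_limits[OF A(3)] dirichlet_end_limits[OF B(2)]]]) (use B in auto)
    qed
  next
    assume A: "h1 = \<infinity>" "dirichlet_end p1 r1"
    show thesis
    proof (rule E2)
      assume B: "interior_end p2 r2"
      show thesis
        by (rule mixed[OF _ Ytop[OF dirichlet_end_limits[OF A(2)] interior_end_limits[OF B]]]) (use A in auto)
    next
      assume B: "robin_end (real_of_ereal h2) p2 r2"
      show thesis
        by (rule mixed[OF _ Ytop[OF dirichlet_end_limits[OF A(2)] robin_end_limits[OF B]]]) (use A in auto)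
    next
      assume B: "dirichlet_end p2 r2"
      have "\<forall>\<^sub>F k in at_top. p1 k = 0" "\<forall>\<^sub>F k in at_top. p2 k = 0"
        using A(2) B by (simp_all add: dirichlet_end_def)
      then have "\<forall>\<^sub>F k in at_top. Y k = 0" using Y unfolding X_def by eventually_elim simp
      then show thesis by (rule dirichlet[OF A(1)])
    qed
  qed
qed

theorem theorem1p3:
  fixes q1 q2 :: "real \<Rightarrow> real" and b1 b2 h1 h2 :: ereal
  assumes "is_potential q1 b1 h1" and "is_potential q2 b2 h2"
  defines "D \<equiv> \<lambda>(b::real) (\<kappa>::real). exp (2 * b * \<kappa>) *
    cmod (m_function q1 b1 h1 (of_real (- (\<kappa>\<^sup>2))) - m_function q2 b2 h2 (of_real (- (\<kappa>\<^sup>2))))"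
  shows "(\<forall>b>0. star_condition b q1 b1 h1 q2 b2 h2 \<longrightarrow>
            (D b \<longlongrightarrow> 4 * \<bar>real_of_ereal h1 - real_of_ereal h2\<bar>) at_top)
       \<and> (\<forall>b>0. \<forall>L>0. (D b \<longlongrightarrow> L) at_top \<longrightarrow>
            star_condition b q1 b1 h1 q2 b2 h2 \<and>
            L = 4 * \<bar>real_of_ereal h1 - real_of_ereal h2\<bar>)"
proof -
  have DK: "exp (2 * c * \<kappa>) * cmod (m_function q1 b1 h1 (of_real (- (\<kappa>\<^sup>2)))
      - m_function q2 b2 h2 (of_real (- (\<kappa>\<^sup>2)))) = D c \<kappa>" for c \<kappa> by (simp only: D_def)
  show ?thesis
  proof (rule conjI; intro allI impI)
    fix b :: real assume b: "0 < b" and star: "star_condition b q1 b1 h1 q2 b2 h2"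
    have bb: "b1 = ereal b" "b2 = ereal b" and h: "\<bar>h1\<bar> < \<infinity>" "\<bar>h2\<bar> < \<infinity>"
      and eq: "AE x in lebesgue. x \<in> {0<..<b} \<longrightarrow> q1 x = q2 x"
      using star unfolding star_condition_def by (cases h1; cases h2; auto)+
    show "(D b \<longlongrightarrow> 4 * \<bar>real_of_ereal h1 - real_of_ereal h2\<bar>) at_top"
    proof (rule m_function_difference[OF assms(1,2) b _ _ eq, unfolded DK])
      assume "\<not> (b1 = ereal b \<and> b2 = ereal b \<and> \<bar>h1\<bar> < \<infinity> \<and> \<bar>h2\<bar> < \<infinity>)"
      then show ?thesis using bb h by simp
    qed (use bb h in auto)
  next
    fix b L :: real assume b: "0 < b" and L: "0 < L" and lim: "(D b \<longlongrightarrow> L) at_top"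
    have pos: "0 < b1" "0 < b2" using assms(1,2) by (simp_all add: is_potential_def)
    have "0 < min (ereal b) (min b1 b2)" "min (ereal b) (min b1 b2) \<le> ereal b"
      using pos b by simp_all
    \<comment> \<open>Nothing yet relates \<open>b\<close> to \<open>b1\<close> and
      \<open>b2\<close>, and comparison of the potentials makes sense only where both exist.\<close>
    then obtain a where a: "ereal a = min (ereal b) (min b1 b2)"
      by (cases "min (ereal b) (min b1 b2)") auto
    have a0: "0 < a" using a b pos by (metis ereal_less(2) min_less_iff_conj)
    have ab: "a \<le> b" and a1: "ereal a \<le> b1" and a2: "ereal a \<le> b2"
      using a by (metis ereal_less_eq(3) min.bounded_iff order_refl)+
    have scale: "D a \<kappa> = exp (- (2 * (b - a) * \<kappa>)) * D b \<kappa>" for \<kappa>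
      unfolding D_def mult.assoc[symmetric] exp_add[symmetric] by (simp add: algebra_simps)
    have Da: "\<forall>\<^sub>F \<kappa> in at_top. D a \<kappa> \<le> L + 1"
      using order_tendstoD(2)[OF lim less_add_one] eventually_ge_at_top[of 0]
    proof eventually_elim
      case (elim \<kappa>)
      have "D a \<kappa> \<le> 1 * D b \<kappa>"
        unfolding scale using ab elim(2) by (intro mult_right_mono) (auto simp: D_def)
      with elim show ?case by simp
  qed
    have eq: "AE x in lebesgue. x \<in> {0<..<a} \<longrightarrow> q1 x = q2 x"
      by (rule local_borg_marchenko[OF assms(1,2) a0 a1 a2 Da[folded DK]])
    \<comment> \<open>Eventual equality of the m-functions makes \<open>D b\<close> vanish as well,
      whatever its exponential weight, against \<open>0 < L\<close>.\<close>
    have zero: False if "\<forall>\<^sub>F \<kappa> in at_top. D a \<kappa> = 0"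
    proof -
      have "\<forall>\<^sub>F \<kappa> in at_top. D b \<kappa> = 0" using that unfolding scale by eventually_elim simp
      from tendsto_unique[OF trivial_limit_at_top_linorder lim tendsto_eventually[OF this]] L show False by simp
  qed
    have tend: "(D a \<longlongrightarrow> 0) at_top" if "a < b"
    proof -
      have "0 < b - a" using that by simp
      then have "((\<lambda>\<kappa>. exp (- (2 * (b - a) * \<kappa>))) \<longlongrightarrow> 0) at_top" by real_asymp
      from tendsto_mult[OF this lim] show ?thesis unfolding scale[abs_def] by simp
  qed
    show "star_condition b q1 b1 h1 q2 b2 h2 \<and> L = 4 * \<bar>real_of_ereal h1 - real_of_ereal h2\<bar>"
    proof (rule m_function_difference[OF assms(1,2) a0 a1 a2 eq, unfolded DK])
      assume "ereal a < b1" "ereal a < b2" and D0: "(D a \<longlongrightarrow> 0) at_top"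
      \<comment> \<open>Neither \<open>b1\<close> nor \<open>b2\<close> attains the minimum, so
        \<open>b\<close> does.\<close>
      then have "a = b" using a by (auto simp: min_def split: if_splits)
      then have "L = 0" using tendsto_unique[OF trivial_limit_at_top_linorder lim, of 0] D0 by simp
      with L show ?thesis by simp
    next
      assume 1: "b1 = ereal a" "b2 = ereal a" "\<bar>h1\<bar> < \<infinity>" "\<bar>h2\<bar> < \<infinity>"
        and Dl: "(D a \<longlongrightarrow> 4 * \<bar>real_of_ereal h1 - real_of_ereal h2\<bar>) at_top"
        and D0: "real_of_ereal h1 = real_of_ereal h2 \<Longrightarrow> \<forall>\<^sub>F \<kappa> in at_top. D a \<kappa> = 0"
      \<comment> \<open>If \<open>a < b\<close>, then \<open>D a\<close> tends to 0 by
        \<open>tend\<close>, which forces equal boundary parameters; but then \<open>D a\<close> is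
        eventually exactly 0.\<close>
      have "a = b"
      proof (rule ccontr)
        assume "a \<noteq> b"
        with ab have "(D a \<longlongrightarrow> 0) at_top" by (intro tend) simp
        from tendsto_unique[OF trivial_limit_at_top_linorder Dl this] have "real_of_ereal h1 = real_of_ereal h2" by simp
        from zero[OF D0[OF this]] show False .
      qed
      then have "L = 4 * \<bar>real_of_ereal h1 - real_of_ereal h2\<bar>"
        using tendsto_unique[OF trivial_limit_at_top_linorder lim] Dl by blast
      moreover have "\<bar>h1\<bar> + \<bar>h2\<bar> < \<infinity>" using 1 by (cases h1; cases h2) auto
      ultimately show ?thesis using 1 eq \<open>a = b\<close> unfolding star_condition_def by simp
    next
      assume "\<forall>\<^sub>F \<kappa> in at_top. D a \<kappa> = 0"
      then show ?thesis using zero by blast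
    next
      assume "filterlim (D a) at_top at_top"
      then have "\<forall>\<^sub>F \<kappa> in at_top. L + 2 \<le> D a \<kappa>" by (simp add: filterlim_at_top)
      then have "\<forall>\<^sub>F \<kappa>::real in at_top. False" using Da by eventually_elim simp
      then show ?thesis by simp
    qed
  qed
qed

end
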